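(* Let $\Gamma$ be a finite digraph (with at least one vertex), $\mathbb{F}$ a field, and $\mathbf{k}$ a nonzero finitely generated commutative $\mathbb{F}$-algebra with $1$. Then, as dimensions of $\mathbb{F}$-algebras, $$GKdim\, L_{\mathbf{k}}(\Gamma)=GKdim\, L_{\mathbb{F}}(\Gamma)+GKdim(\mathbf{k}),$$ where the values may be infinite.
   Context: A digraph $\Gamma=(V,E,s,t)$ has vertex set $V$, arrow set $E$, and source and target maps $s,t:E\to V$ (written $se$, $te$). Let $E^*=\{e^*\mid e\in E\}$ with $s(e^* )=te$, $t(e^* )=se$. For a commutative ring $R$ with $1$, the Leavitt path algebra $L_{R}(\Gamma)$ is the $R$-algebra generated by $V\sqcup E\sqcup E^*$ with relations: (V) $vw=\delta_{v,w}v$ for $v,w\in V$; (E) $s(e)e=e=e\,t(e)$ for $e\in E\sqcup E^*$; (CK1) $e^*f=\delta_{e,f}\,t(e)$ for $e,f\in E$; (CK2) $v=\sum_{s(e)=v}ee^*$ for every $v$ with $0<|s^{-1}(v)|<\infty$. When $V$ is finite it has identity $1=\sum_{v\in V}v$. For a finitely generated nonzero $\mathbb{F}$-algebra $A$ with $1$, $GKdim(A)=\limsup_{n\to\infty}\frac{\log(\dim_{\mathbb{F}} W^n)}{\log n}$, where $W$ is a finite dimensional $\mathbb{F}$-subspace generating $A$ with $1\in W$ and $W^n$ is the span of $n$-fold products of elements of $W$; this is independent of $W$. All Gelfand-Kirillov dimensions here are over $\mathbb{F}$. *)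

theory Defs
  imports
    "HOL-Library.Extended_Real"
    "HOL-Library.Liminf_Limsup"
    "HOL-Algebra.QuotRing"
    "HOL-Algebra.Subrings"
    "Jordan_Normal_Form.Missing_VectorSpace"
    "Graph_Theory.Digraph"
begin

section \<open>Free associative algebras\<close>

text \<open>
  The free unital associative \<open>R\<close>-algebra on a set \<open>X\<close>: finitely supported functions from the
  words over \<open>X\<close> to \<open>R\<close>. A word of length \<open>n\<close> has the \<open>n + 1\<close> factorizations
  \<open>take i w @ drop i w\<close> with \<open>i \<le> n\<close>, over which the convolution product runs.
\<close>

definition free_algebra :: "('r, 'm) ring_scheme \<Rightarrow> 'x set \<Rightarrow> ('r, 'x list \<Rightarrow> 'r) module" where
  "free_algebra R X =
    \<lparr>carrier = {p. (\<forall>w. p w \<in> carrier R) \<and> finite {w. p w \<noteq> \<zero>\<^bsub>R\<^esub>}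
                 \<and> (\<forall>w. p w \<noteq> \<zero>\<^bsub>R\<^esub> \<longrightarrow> w \<in> lists X)},
     mult = (\<lambda>p q w. \<Oplus>\<^bsub>R\<^esub>i\<in>{..length w}. p (take i w) \<otimes>\<^bsub>R\<^esub> q (drop i w)),
     one = (\<lambda>w. if w = [] then \<one>\<^bsub>R\<^esub> else \<zero>\<^bsub>R\<^esub>),
     zero = (\<lambda>w. \<zero>\<^bsub>R\<^esub>),
     add = (\<lambda>p q w. p w \<oplus>\<^bsub>R\<^esub> q w),
     smult = (\<lambda>a p w. a \<otimes>\<^bsub>R\<^esub> p w)\<rparr>"

definition free_gen :: "('r, 'm) ring_scheme \<Rightarrow> 'x \<Rightarrow> 'x list \<Rightarrow> 'r" where
  "free_gen R x = (\<lambda>w. if w = [x] then \<one>\<^bsub>R\<^esub> else \<zero>\<^bsub>R\<^esub>)"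


section \<open>Leavitt path algebras\<close>

datatype ('v, 'e) leavitt_gen = Vertex 'v | Arrow 'e | Ghost 'e

definition edge_gens :: "('v, 'e) pre_digraph \<Rightarrow> ('v, 'e) leavitt_gen set" where
  "edge_gens G = Arrow ` arcs G \<union> Ghost ` arcs G"

definition leavitt_gens :: "('v, 'e) pre_digraph \<Rightarrow> ('v, 'e) leavitt_gen set" where
  "leavitt_gens G = Vertex ` verts G \<union> edge_gens G"

fun gen_source :: "('v, 'e) pre_digraph \<Rightarrow> ('v, 'e) leavitt_gen \<Rightarrow> 'v" where
  "gen_source G (Vertex v) = v"
| "gen_source G (Arrow e) = tail G e"
| "gen_source G (Ghost e) = head G e"

fun gen_target :: "('v, 'e) pre_digraph \<Rightarrow> ('v, 'e) leavitt_gen \<Rightarrow> 'v" where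
  "gen_target G (Vertex v) = v"
| "gen_target G (Arrow e) = head G e"
| "gen_target G (Ghost e) = tail G e"

text \<open>Each relation \<open>l = r\<close> is represented by the element \<open>l - r\<close> of the free algebra.\<close>

definition leavitt_relations ::
    "('r, 'm) ring_scheme \<Rightarrow> ('v, 'e) pre_digraph \<Rightarrow> (('v, 'e) leavitt_gen list \<Rightarrow> 'r) set" where
  "leavitt_relations R G =
    (let A = free_algebra R (leavitt_gens G); g = free_gen R in
       {g (Vertex v) \<otimes>\<^bsub>A\<^esub> g (Vertex w) \<ominus>\<^bsub>A\<^esub> (if v = w then g (Vertex v) else \<zero>\<^bsub>A\<^esub>) | v w.
          v \<in> verts G \<and> w \<in> verts G}
     \<union> {g (Vertex (gen_source G x)) \<otimes>\<^bsub>A\<^esub> g x \<ominus>\<^bsub>A\<^esub> g x | x. x \<in> edge_gens G}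
     \<union> {g x \<otimes>\<^bsub>A\<^esub> g (Vertex (gen_target G x)) \<ominus>\<^bsub>A\<^esub> g x | x. x \<in> edge_gens G}
     \<union> {g (Ghost e) \<otimes>\<^bsub>A\<^esub> g (Arrow f) \<ominus>\<^bsub>A\<^esub> (if e = f then g (Vertex (head G e)) else \<zero>\<^bsub>A\<^esub>) | e f.
          e \<in> arcs G \<and> f \<in> arcs G}
     \<union> {g (Vertex v) \<ominus>\<^bsub>A\<^esub> (\<Oplus>\<^bsub>A\<^esub>e\<in>out_arcs G v. g (Arrow e) \<otimes>\<^bsub>A\<^esub> g (Ghost e)) | v.
          v \<in> verts G \<and> finite (out_arcs G v) \<and> out_arcs G v \<noteq> {}})"

definition leavitt_ideal ::
    "('r, 'm) ring_scheme \<Rightarrow> ('v, 'e) pre_digraph \<Rightarrow> (('v, 'e) leavitt_gen list \<Rightarrow> 'r) set" where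
  "leavitt_ideal R G = genideal (free_algebra R (leavitt_gens G)) (leavitt_relations R G)"

text \<open>
  The Leavitt path algebra is presented as a possibly non-unital algebra, so it is a quotient of
  the free non-unital algebra, i.e. of the augmentation ideal \<open>{p. p [] = 0}\<close> of the free algebra.
  All relations lie in the augmentation ideal, and the ideal they generate there as a non-unital
  algebra is the same as the ideal they generate in the free unital algebra. Elements are cosets
  as in \<^const>\<open>FactRing\<close>. The field \<^const>\<open>one\<close> is an identity only when \<open>verts G\<close> is finite.
\<close>

definition leavitt_path_algebra ::
    "('r, 'm) ring_scheme \<Rightarrow> ('v, 'e) pre_digraph \<Rightarrow>
      ('r, (('v, 'e) leavitt_gen list \<Rightarrow> 'r) set) module" where
  "leavitt_path_algebra R G =
    (let A = free_algebra R (leavitt_gens G); J = leavitt_ideal R G in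
      \<lparr>carrier = {J +>\<^bsub>A\<^esub> p | p. p \<in> carrier A \<and> p [] = \<zero>\<^bsub>R\<^esub>},
       mult = mult (A Quot J),
       one = J +>\<^bsub>A\<^esub> (\<Oplus>\<^bsub>A\<^esub>v\<in>verts G. free_gen R (Vertex v)),
       zero = zero (A Quot J),
       add = add (A Quot J),
       smult = (\<lambda>a C. \<Union>p\<in>C. J +>\<^bsub>A\<^esub> (a \<odot>\<^bsub>A\<^esub> p))\<rparr>)"


section \<open>Algebras over a field\<close>

text \<open>An algebra \<open>A\<close> over a commutative \<open>F\<close>-algebra \<open>K\<close>, regarded as an algebra over \<open>F\<close>.\<close>

definition restrict_scalars ::
    "('f, 'k, 'n) module_scheme \<Rightarrow> ('k, 'a, 'l) module_scheme \<Rightarrow> ('f, 'a) module" where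
  "restrict_scalars K A =
    \<lparr>carrier = carrier A, mult = mult A, one = one A, zero = zero A, add = add A,
     smult = (\<lambda>c x. (c \<odot>\<^bsub>K\<^esub> \<one>\<^bsub>K\<^esub>) \<odot>\<^bsub>A\<^esub> x)\<rparr>"

definition generates_algebra ::
    "('f, 'm) ring_scheme \<Rightarrow> ('f, 'a, 'n) module_scheme \<Rightarrow> 'a set \<Rightarrow> bool" where
  "generates_algebra F A S \<longleftrightarrow>
    S \<subseteq> carrier A \<and>
    (\<forall>B. subspace F B A \<and> subring B A \<and> S \<subseteq> B \<longrightarrow> B = carrier A)"

definition finitely_generated_algebra ::
    "('f, 'm) ring_scheme \<Rightarrow> ('f, 'a, 'n) module_scheme \<Rightarrow> bool" where
  "finitely_generated_algebra F A \<longleftrightarrow> (\<exists>S. finite S \<and> generates_algebra F A S)"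


section \<open>Gelfand-Kirillov dimension\<close>

definition algebra_power ::
    "('f, 'm) ring_scheme \<Rightarrow> ('f, 'a, 'n) module_scheme \<Rightarrow> 'a set \<Rightarrow> nat \<Rightarrow> 'a set" where
  "algebra_power F A W n =
    module.span F A {foldr (\<otimes>\<^bsub>A\<^esub>) ws \<one>\<^bsub>A\<^esub> | ws. length ws = n \<and> set ws \<subseteq> W}"

definition generating_subspace ::
    "('f, 'm) ring_scheme \<Rightarrow> ('f, 'a, 'n) module_scheme \<Rightarrow> 'a set \<Rightarrow> bool" where
  "generating_subspace F A W \<longleftrightarrow>
    subspace F W A \<and> vectorspace.fin_dim F (A\<lparr>carrier := W\<rparr>) \<and>
    \<one>\<^bsub>A\<^esub> \<in> W \<and> generates_algebra F A W"

definition growth_exponent ::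
    "('f, 'm) ring_scheme \<Rightarrow> ('f, 'a, 'n) module_scheme \<Rightarrow> 'a set \<Rightarrow> ereal" where
  "growth_exponent F A W =
    limsup (\<lambda>n. ereal
      (ln (real (vectorspace.dim F (A\<lparr>carrier := algebra_power F A W n\<rparr>))) / ln (real n)))"

text \<open>
  The growth exponent does not depend on the choice of the generating subspace, so the description
  is well defined for every finitely generated nonzero algebra (and only meaningful for these).
\<close>

definition GKdim :: "('f, 'm) ring_scheme \<Rightarrow> ('f, 'a, 'n) module_scheme \<Rightarrow> ereal" where
  "GKdim F A = (THE d. \<exists>W. generating_subspace F A W \<and> d = growth_exponent F A W)"

end

theory Submission
  imports Defs "HOL-Library.Multiset_Order" "HOL-Library.Product_Lexorder" "HOL-Real_Asymp.Real_Asymp"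
begin

text \<open>
  The path algebra over \<open>K\<close> is the tensor product of \<open>K\<close> and the path algebra over \<open>F\<close>. Let \<open>S\<close> and \<open>T\<close> be
  finite generating sets of the two factors that contain \<open>1\<close>. As the factors commute with each other, the
  \<open>n\<close>-fold products of the elements \<open>a \<otimes> u\<close> with \<open>a \<in> S\<close> and \<open>u \<in> T\<close> are the elements \<open>b \<otimes> w\<close>, where \<open>b\<close>
  and \<open>w\<close> are \<open>n\<close>-fold products from \<open>S\<close> and from \<open>T\<close>. Hence the dimension of the \<open>n\<close>-th power is exactly the
  product of the dimensions in the factors (\<open>power_dim_pairs\<close>), and its logarithm is a sum. The limit
  superior of the quotients by \<open>ln n\<close> is additive as soon as one of the summands converges, and the one of
  the commutative algebra \<open>K\<close> does (\<open>finite_growth_tendsto\<close>). The other summand is arbitrary, and its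
  exponent may be infinite.

  The convergence for \<open>K\<close> is a theorem on monomials. Those monomials in the generators that are not linear
  combinations of smaller ones, in an order by degree first, form an order ideal, and those of degree at
  most \<open>n\<close> are a basis of the \<open>n\<close>-th power. The number of elements of degree at most \<open>n\<close> in an order ideal
  lies between two positive multiples of \<open>n ^ d\<close> for some \<open>d\<close> (\<open>down_closed_growth\<close>), by an induction on the number of
  variables.

  The tensor product is recognized from the presentation of the path algebra. The defining relations have
  integral coefficients, therefore every additive map of coefficient rings, applied to the coefficients,
  induces a map of path algebras (\<open>push_leavitt_ideal\<close>). The embedding of \<open>F\<close> into \<open>K\<close> gives the pairing
  of \<open>K\<close> with the path algebra over \<open>F\<close>; a linear functional on \<open>K\<close> gives a contraction in the opposite
  direction. Functionals separate a vector from a subspace, and this is enough for the independence of the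
  products of two bases (\<open>pairs_lin_indpt\<close>).

  Two more facts are needed for the formula to make sense: the growth exponent depends only on the algebra
  (\<open>GKdim_eq_power_growth\<close>), and the path algebra over \<open>F\<close> is not zero (\<open>L_one_neq_zero\<close>), which a
  representation on functions on \<open>V \<times> \<nat>\<close> shows.
\<close>

section \<open>Finitely spanned subspaces\<close>

context vectorspace
begin

lemma span_span_subset:
  assumes "T \<subseteq> carrier V" "S \<subseteq> span T"
  shows "span S \<subseteq> span T"
  using assms span_is_submodule span_is_subset by blast

lemma span_smult:
  assumes "T \<subseteq> carrier V" "c \<in> carrier K" "x \<in> span T"
  shows "c \<odot>\<^bsub>V\<^esub> x \<in> span T"
  using span_is_submodule[OF assms(1)] assms unfolding submodule_def by blast

text \<open>Induction along the terms of a linear combination; most statements about spans below are proved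
  with it and thus avoid sums over finite sets.\<close>

lemma span_induct [consumes 2, case_names zero add_smult]:
  assumes "T \<subseteq> carrier V" "x \<in> span T"
    and zero: "P \<zero>\<^bsub>V\<^esub>"
    and step: "\<And>c t y. \<lbrakk>c \<in> carrier K; t \<in> T; y \<in> span T; P y\<rbrakk> \<Longrightarrow> P (c \<odot>\<^bsub>V\<^esub> t \<oplus>\<^bsub>V\<^esub> y)"
  shows "P x"
proof -
  from assms(2) obtain a A where x: "x = lincomb a A" and A: "finite A" "A \<subseteq> T" "a \<in> A \<rightarrow> carrier K"
    unfolding span_def by blast
  have "P (lincomb a A)" using A
  proof (induction A)
    case empty
    then show ?case using zero by simp
  next
    case (insert t A)
    then have "lincomb a (insert t A) = a t \<odot>\<^bsub>V\<^esub> t \<oplus>\<^bsub>V\<^esub> lincomb a A"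
      using assms(1) by (intro lincomb_insert2) auto
    moreover have "lincomb a A \<in> span T" using insert unfolding span_def by blast
    ultimately show ?case using insert step by auto
  qed
  then show ?thesis using x by simp
qed

text \<open>A minimal subset with the given span is independent.\<close>

lemma finite_basis_of_span:
  assumes "finite S" "S \<subseteq> carrier V"
  obtains B where "B \<subseteq> S" "lin_indpt B" "span B = span S"
proof -
  obtain B where B: "B \<subseteq> S" "minimal B (\<lambda>B. span B = span S)"
    using minimal_exists[OF assms(1), of "\<lambda>B. span B = span S"] by auto
  have fB: "finite B" using B assms finite_subset by blast
  have "lin_indpt B"
  proof
    assume "lin_dep B"
    then obtain u where u: "u \<in> B" "u \<in> span (B - {u})"
      using lindep_span[of B] B assms fB by blast
    have "span B \<subseteq> span (B - {u})"
    proof (rule span_span_subset)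
      show "B - {u} \<subseteq> carrier V" using B assms by auto
      then have "B - {u} \<subseteq> span (B - {u})" by (rule in_own_span)
      then show "B \<subseteq> span (B - {u})" using u by auto
    qed
    then have "span (B - {u}) = span S"
      using span_is_monotone[of "B - {u}" B] B unfolding minimal_def by auto
    then show False using B u unfolding minimal_def by blast
  qed
  then show ?thesis using that B unfolding minimal_def by blast
qed

lemma dim_span_lin_indpt:
  assumes "finite B" "B \<subseteq> carrier V" "lin_indpt B"
  shows "vectorspace.dim K (vs (span B)) = card B"
proof -
  have sub: "submodule K (span B) V" using span_is_submodule assms by blast
  have B: "B \<subseteq> span B" using in_own_span assms by blast
  interpret W: vectorspace K "vs (span B)"
    using span_is_subspace[OF assms(2)] by (rule subspace_is_vs)
  have "W.basis B" unfolding W.basis_def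
    using span_li_not_depend[OF B sub] assms B by simp
  then show ?thesis using W.dim_basis assms by blast
qed

lemma fin_dim_span:
  assumes "finite S" "S \<subseteq> carrier V"
  shows "vectorspace.fin_dim K (vs (span S))"
proof -
  have sub: "submodule K (span S) V" using span_is_submodule assms by blast
  have S: "S \<subseteq> span S" using in_own_span assms by blast
  interpret W: vectorspace K "vs (span S)"
    using span_is_subspace[OF assms(2)] by (rule subspace_is_vs)
  show ?thesis unfolding W.fin_dim_def
    using span_li_not_depend[OF S sub] assms S by auto
qed

lemma fin_dim_subspace_span:
  assumes "subspace K W V" "vectorspace.fin_dim K (vs W)"
  obtains S where "finite S" "S \<subseteq> W" "W = span S"
proof -
  interpret W: vectorspace K "vs W"
    using assms(1) by (rule subspace_is_vs)
  obtain S where S: "finite S" "S \<subseteq> W" "W.span S = W"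
    using assms(2) unfolding W.fin_dim_def by auto
  then have "W = span S"
    using span_li_not_depend(1)[of S W] assms(1) unfolding subspace_def by simp
  then show ?thesis using that S by blast
qed

text \<open>Bases are chosen inside the two spanning sets and compared by the replacement theorem.\<close>

lemma dim_span_mono:
  assumes "finite T" "T \<subseteq> carrier V" "finite S" "S \<subseteq> span T"
  shows "vectorspace.dim K (vs (span S)) \<le> vectorspace.dim K (vs (span T))"
proof -
  have S: "S \<subseteq> carrier V" using assms span_is_subset2 by blast
  obtain B where B: "B \<subseteq> S" "lin_indpt B" "span B = span S"
    using finite_basis_of_span[OF assms(3) S] .
  obtain C where C: "C \<subseteq> T" "lin_indpt C" "span C = span T"
    using finite_basis_of_span[OF assms(1,2)] .
  have fin: "finite B" "finite C" and car: "B \<subseteq> carrier V" "C \<subseteq> carrier V"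
    using B C S assms finite_subset by blast+
  have "card B \<le> card C"
    using replacement[OF fin car(2) B(2)] B C assms by fastforce
  then show ?thesis
    using dim_span_lin_indpt fin car B C by metis
qed

lemma dim_span_pos:
  assumes "finite S" "S \<subseteq> carrier V" "x \<in> S" "x \<noteq> \<zero>\<^bsub>V\<^esub>"
  shows "0 < vectorspace.dim K (vs (span S))"
proof -
  obtain B where B: "B \<subseteq> S" "lin_indpt B" "span B = span S"
    using finite_basis_of_span[OF assms(1,2)] .
  have "B \<noteq> {}"
  proof
    assume "B = {}"
    then have "span S = {\<zero>\<^bsub>V\<^esub>}" using B span_empty by simp
    then show False using in_own_span[OF assms(2)] assms by blast
  qed
  moreover have "finite B" "B \<subseteq> carrier V" using B assms finite_subset by blast+
  ultimately show ?thesis using dim_span_lin_indpt[of B] B(2,3) by (simp add: card_gt_0_iff)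
qed

end

section \<open>Growth of finitely generated algebras\<close>

text \<open>
  A commutative algebra in the sense of \<^locale>\<open>algebra\<close> is one, but path algebras are not
  commutative, hence this weaker locale.
\<close>

locale unital_algebra = vectorspace F A + A: ring A for F A +
  assumes smult_mult_left: "\<lbrakk>c \<in> carrier F; x \<in> carrier A; y \<in> carrier A\<rbrakk> \<Longrightarrow>
      (c \<odot>\<^bsub>A\<^esub> x) \<otimes>\<^bsub>A\<^esub> y = c \<odot>\<^bsub>A\<^esub> (x \<otimes>\<^bsub>A\<^esub> y)"
    and smult_mult_right: "\<lbrakk>c \<in> carrier F; x \<in> carrier A; y \<in> carrier A\<rbrakk> \<Longrightarrow>
      x \<otimes>\<^bsub>A\<^esub> (c \<odot>\<^bsub>A\<^esub> y) = c \<odot>\<^bsub>A\<^esub> (x \<otimes>\<^bsub>A\<^esub> y)"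

text \<open>The products that span \<^const>\<open>algebra_power\<close>, bracketed to the right as there.\<close>

definition fold_products :: "('a, 'm) monoid_scheme \<Rightarrow> 'a set \<Rightarrow> nat \<Rightarrow> 'a set" where
  "fold_products A S n = {foldr (\<otimes>\<^bsub>A\<^esub>) ws \<one>\<^bsub>A\<^esub> | ws. length ws = n \<and> set ws \<subseteq> S}"

lemma fold_products_0 [simp]: "fold_products A S 0 = {\<one>\<^bsub>A\<^esub>}"
  by (auto simp: fold_products_def)

lemma fold_products_Suc:
  "fold_products A S (Suc n) = (\<lambda>(s, p). s \<otimes>\<^bsub>A\<^esub> p) ` (S \<times> fold_products A S n)"
proof (intro subset_antisym subsetI)
  fix x assume "x \<in> fold_products A S (Suc n)"
  then obtain ws where "x = foldr (\<otimes>\<^bsub>A\<^esub>) ws \<one>\<^bsub>A\<^esub>" "length ws = Suc n" "set ws \<subseteq> S"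
    unfolding fold_products_def by blast
  then show "x \<in> (\<lambda>(s, p). s \<otimes>\<^bsub>A\<^esub> p) ` (S \<times> fold_products A S n)"
    unfolding fold_products_def by (cases ws) auto
next
  fix x assume "x \<in> (\<lambda>(s, p). s \<otimes>\<^bsub>A\<^esub> p) ` (S \<times> fold_products A S n)"
  then obtain s ws where "x = s \<otimes>\<^bsub>A\<^esub> foldr (\<otimes>\<^bsub>A\<^esub>) ws \<one>\<^bsub>A\<^esub>" "s \<in> S" "length ws = n" "set ws \<subseteq> S"
    unfolding fold_products_def by auto
  then show "x \<in> fold_products A S (Suc n)"
    unfolding fold_products_def by (intro CollectI exI[of _ "s # ws"]) auto
qed

lemma finite_fold_products: "finite S \<Longrightarrow> finite (fold_products A S n)"
  by (induction n) (auto simp: fold_products_Suc)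

lemma algebra_power_alt: "algebra_power F A W n = module.span F A (fold_products A W n)"
  by (simp add: algebra_power_def fold_products_def)

context unital_algebra
begin

lemma fold_products_closed: "S \<subseteq> carrier A \<Longrightarrow> fold_products A S n \<subseteq> carrier A"
  by (induction n) (auto simp: fold_products_Suc)

text \<open>Factors \<open>1\<close> pad the shorter products.\<close>

lemma fold_products_incseq:
  assumes "S \<subseteq> carrier A" "\<one>\<^bsub>A\<^esub> \<in> S" "m \<le> n"
  shows "fold_products A S m \<subseteq> fold_products A S n"
  using assms(3)
proof (induction rule: dec_induct)
  case (step n)
  have "x \<in> fold_products A S (Suc n)" if "x \<in> fold_products A S n" for x
  proof -
    have "x = \<one>\<^bsub>A\<^esub> \<otimes>\<^bsub>A\<^esub> x" using subsetD[OF fold_products_closed[OF assms(1)] that] by simp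
    then show ?thesis unfolding fold_products_Suc using that assms(2) by force
  qed
  then show ?case using step by blast
qed simp

lemma one_in_fold_products:
  assumes "S \<subseteq> carrier A" "\<one>\<^bsub>A\<^esub> \<in> S"
  shows "\<one>\<^bsub>A\<^esub> \<in> fold_products A S n"
  using fold_products_incseq[OF assms, of 0 n] by auto

lemma fold_products_mult:
  assumes "S \<subseteq> carrier A" "x \<in> fold_products A S m" "y \<in> fold_products A S n"
  shows "x \<otimes>\<^bsub>A\<^esub> y \<in> fold_products A S (m + n)"
  using assms(2)
proof (induction m arbitrary: x)
  case 0
  then show ?case using assms subsetD[OF fold_products_closed[OF assms(1)] assms(3)] by simp
next
  case (Suc m)
  then obtain s p where x: "x = s \<otimes>\<^bsub>A\<^esub> p" "s \<in> S" "p \<in> fold_products A S m"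
    unfolding fold_products_Suc by auto
  moreover have "s \<in> carrier A" "p \<in> carrier A" "y \<in> carrier A"
    using x assms fold_products_closed[OF assms(1)] by blast+
  ultimately have "x \<otimes>\<^bsub>A\<^esub> y = s \<otimes>\<^bsub>A\<^esub> (p \<otimes>\<^bsub>A\<^esub> y)" by (simp add: A.m_assoc)
  then show ?case using Suc.IH[of p] x by (auto simp: fold_products_Suc)
qed

lemma span_mult:
  assumes S: "S \<subseteq> carrier A" and T: "T \<subseteq> carrier A" and U: "U \<subseteq> carrier A"
    and prod: "\<And>s t. \<lbrakk>s \<in> S; t \<in> T\<rbrakk> \<Longrightarrow> s \<otimes>\<^bsub>A\<^esub> t \<in> span U"
    and x: "x \<in> span S" and y: "y \<in> span T"
  shows "x \<otimes>\<^bsub>A\<^esub> y \<in> span U"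
proof -
  have cl: "span S \<subseteq> carrier A" "span T \<subseteq> carrier A"
    using S T span_is_subset2 by auto
  have 1: "s \<otimes>\<^bsub>A\<^esub> y \<in> span U" if s: "s \<in> S" for s
    using T y
  proof (induction rule: span_induct)
    case zero
    then show ?case using span_zero s S by auto
  next
    case (add_smult c t y)
    have *: "s \<in> carrier A" "t \<in> carrier A" "y \<in> carrier A" using add_smult s S T cl by blast+
    then have "s \<otimes>\<^bsub>A\<^esub> (c \<odot>\<^bsub>A\<^esub> t \<oplus>\<^bsub>A\<^esub> y) = c \<odot>\<^bsub>A\<^esub> (s \<otimes>\<^bsub>A\<^esub> t) \<oplus>\<^bsub>A\<^esub> s \<otimes>\<^bsub>A\<^esub> y"
      using add_smult by (simp add: A.r_distr smult_mult_right)
    then show ?case using span_add1[OF U] span_smult[OF U] add_smult prod s by simp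
  qed
  show ?thesis using S x
  proof (induction rule: span_induct)
    case zero
    then show ?case using span_zero y cl by auto
  next
    case (add_smult c t x)
    have *: "t \<in> carrier A" "y \<in> carrier A" "x \<in> carrier A" using add_smult y S T cl by blast+
    then have "(c \<odot>\<^bsub>A\<^esub> t \<oplus>\<^bsub>A\<^esub> x) \<otimes>\<^bsub>A\<^esub> y = c \<odot>\<^bsub>A\<^esub> (t \<otimes>\<^bsub>A\<^esub> y) \<oplus>\<^bsub>A\<^esub> x \<otimes>\<^bsub>A\<^esub> y"
      using add_smult by (simp add: A.l_distr smult_mult_left)
    then show ?case using span_add1[OF U] span_smult[OF U] add_smult 1 by simp
  qed
qed

text \<open>Expanding each factor from \<open>T\<close> into \<open>c\<close>-fold products of elements of \<open>S\<close> multiplies the length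
  by \<open>c\<close>. This is the comparison between two generating sets.\<close>

lemma fold_products_span:
  assumes "S \<subseteq> carrier A" "T \<subseteq> carrier A" "T \<subseteq> span (fold_products A S c)"
  shows "fold_products A T n \<subseteq> span (fold_products A S (c * n))"
proof (induction n)
  case 0
  then show ?case using in_own_span[of "{\<one>\<^bsub>A\<^esub>}"] by auto
next
  case (Suc n)
  have "t \<otimes>\<^bsub>A\<^esub> p \<in> span (fold_products A S (c * Suc n))" if "t \<in> T" "p \<in> fold_products A T n" for t p
  proof (rule span_mult)
    show "t \<in> span (fold_products A S c)" "p \<in> span (fold_products A S (c * n))"
      using that Suc assms by auto
    fix x y assume "x \<in> fold_products A S c" "y \<in> fold_products A S (c * n)"
    then have "x \<otimes>\<^bsub>A\<^esub> y \<in> fold_products A S (c * Suc n)"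
      using fold_products_mult[OF assms(1)] by auto
    then show "x \<otimes>\<^bsub>A\<^esub> y \<in> span (fold_products A S (c * Suc n))"
      using in_own_span fold_products_closed[OF assms(1)] by blast
  qed (simp_all add: fold_products_closed assms)
  then show ?case unfolding fold_products_Suc by auto
qed

lemma algebra_power_span:
  assumes "S \<subseteq> carrier A"
  shows "algebra_power F A (span S) n = span (fold_products A S n)"
proof -
  have "S \<subseteq> fold_products A S 1"
  proof
    fix s assume "s \<in> S"
    then have "s = s \<otimes>\<^bsub>A\<^esub> \<one>\<^bsub>A\<^esub>" using assms by auto
    then show "s \<in> fold_products A S 1" using \<open>s \<in> S\<close> unfolding One_nat_def fold_products_Suc by force
  qed
  then have "fold_products A (span S) n \<subseteq> span (fold_products A S (1 * n))"
    using assms by (intro fold_products_span span_is_monotone span_is_subset2)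
  moreover have "fold_products A S n \<subseteq> fold_products A (span S) n"
    using in_own_span[OF assms] unfolding fold_products_def by blast
  moreover have cl: "fold_products A S n \<subseteq> carrier A" by (rule fold_products_closed[OF assms])
  ultimately have "span (fold_products A (span S) n) \<subseteq> span (fold_products A S n)"
      "span (fold_products A S n) \<subseteq> span (fold_products A (span S) n)"
    using span_span_subset[OF cl] span_is_monotone by auto
  then show ?thesis unfolding algebra_power_alt by blast
qed

text \<open>The elements with the property \<open>P\<close> form a subalgebra that contains \<open>S\<close>.\<close>

lemma generated_induct [consumes 2, case_names generator one add smult mult]:
  assumes gen: "generates_algebra F A S" and x: "x \<in> carrier A"
    and generator: "\<And>s. s \<in> S \<Longrightarrow> P s" and one: "P \<one>\<^bsub>A\<^esub>"
    and add: "\<And>x y. \<lbrakk>x \<in> carrier A; y \<in> carrier A; P x; P y\<rbrakk> \<Longrightarrow> P (x \<oplus>\<^bsub>A\<^esub> y)"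
    and smult: "\<And>c x. \<lbrakk>c \<in> carrier F; x \<in> carrier A; P x\<rbrakk> \<Longrightarrow> P (c \<odot>\<^bsub>A\<^esub> x)"
    and mult: "\<And>x y. \<lbrakk>x \<in> carrier A; y \<in> carrier A; P x; P y\<rbrakk> \<Longrightarrow> P (x \<otimes>\<^bsub>A\<^esub> y)"
  shows "P x"
proof -
  let ?B = "{x \<in> carrier A. P x}"
  have "P (\<zero>\<^bsub>F\<^esub> \<odot>\<^bsub>A\<^esub> \<one>\<^bsub>A\<^esub>)" by (intro smult one) auto
  then have zero: "P \<zero>\<^bsub>A\<^esub>" by simp
  have "submodule F ?B A" by unfold_locales (use zero add smult in auto)
  moreover have "subring ?B A"
  proof (rule A.subringI)
    fix x assume x: "x \<in> ?B"
    then have "P ((\<ominus>\<^bsub>F\<^esub> \<one>\<^bsub>F\<^esub>) \<odot>\<^bsub>A\<^esub> x)" by (intro smult) auto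
    then show "\<ominus>\<^bsub>A\<^esub> x \<in> ?B" using x by (simp add: smult_l_minus)
  qed (use one add mult in auto)
  moreover have "S \<subseteq> ?B" using gen generator unfolding generates_algebra_def by blast
  ultimately have "?B = carrier A"
    using gen vectorspace_axioms unfolding generates_algebra_def subspace_def by blast
  then show ?thesis using x by blast
qed

text \<open>As \<open>1 \<in> S\<close>, the spans of the \<open>n\<close>-fold products increase with \<open>n\<close>, so that their union is closed
  under sums as well as under products.\<close>

lemma generates_imp_powers_exhaust:
  assumes S: "S \<subseteq> carrier A" "\<one>\<^bsub>A\<^esub> \<in> S" and gen: "generates_algebra F A S" and x: "x \<in> carrier A"
  shows "\<exists>n. x \<in> span (fold_products A S n)"
  using gen x
proof (induction rule: generated_induct)
  case (generator s)
  then have "s \<otimes>\<^bsub>A\<^esub> \<one>\<^bsub>A\<^esub> \<in> fold_products A S 1"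
    unfolding One_nat_def fold_products_Suc by force
  then have "s \<in> span (fold_products A S 1)"
    using subsetD[OF in_own_span[OF fold_products_closed[OF S(1)]], of _ 1] generator S by auto
  then show ?case ..
next
  case one
  then show ?case using span_self[of "\<one>\<^bsub>A\<^esub>"] by (intro exI[of _ 0]) simp
next
  case (add x y)
  then obtain m n where mn: "x \<in> span (fold_products A S m)" "y \<in> span (fold_products A S n)" by blast
  have "span (fold_products A S k) \<subseteq> span (fold_products A S (max m n))" if "k \<le> max m n" for k
    using span_is_monotone[OF fold_products_incseq[OF S that]] .
  then have "x \<in> span (fold_products A S (max m n))" "y \<in> span (fold_products A S (max m n))"
    using mn by (meson max.cobounded1 max.cobounded2 subsetD)+
  then show ?case using span_add1[OF fold_products_closed[OF S(1)]] by blast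
next
  case (smult c x)
  then show ?case using span_smult[OF fold_products_closed[OF S(1)]] by blast
next
  case (mult x y)
  then obtain m n where mn: "x \<in> span (fold_products A S m)" "y \<in> span (fold_products A S n)" by blast
  note cl = fold_products_closed[OF S(1)]
  have "x \<otimes>\<^bsub>A\<^esub> y \<in> span (fold_products A S (m + n))"
    using cl cl cl _ mn
  proof (rule span_mult)
    fix s t assume "s \<in> fold_products A S m" "t \<in> fold_products A S n"
    then show "s \<otimes>\<^bsub>A\<^esub> t \<in> span (fold_products A S (m + n))"
      using fold_products_mult[OF S(1)] subsetD[OF in_own_span[OF cl]] by blast
  qed
  then show ?case ..
qed

text \<open>A common exponent exists because the powers increase.\<close>

lemma finite_subset_of_power:
  assumes S: "S \<subseteq> carrier A" "\<one>\<^bsub>A\<^esub> \<in> S" and gen: "generates_algebra F A S"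
    and T: "finite T" "T \<subseteq> carrier A"
  obtains c where "0 < c" "T \<subseteq> span (fold_products A S c)"
proof -
  have mono: "span (fold_products A S m) \<subseteq> span (fold_products A S n)" if "m \<le> n" for m n
    using span_is_monotone fold_products_incseq[OF S that] by blast
  have "\<exists>c. T \<subseteq> span (fold_products A S c)" using T
  proof (induction T)
    case (insert t T)
    then obtain c where c: "T \<subseteq> span (fold_products A S c)" by blast
    obtain d where d: "t \<in> span (fold_products A S d)"
      using generates_imp_powers_exhaust[OF S gen, of t] insert.prems by blast
    show ?case using c d mono[of c "max c d"] mono[of d "max c d"]
      by (intro exI[of _ "max c d"]) auto
  qed simp
  then obtain c where "T \<subseteq> span (fold_products A S c)" by blast
  then have "T \<subseteq> span (fold_products A S (Suc c))" using mono[of c "Suc c"] by auto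
  then show ?thesis using that by blast
qed

end

abbreviation power_dim :: "('f, 'm) ring_scheme \<Rightarrow> ('f, 'a, 'n) module_scheme \<Rightarrow> 'a set \<Rightarrow> nat \<Rightarrow> nat" where
  "power_dim F A S n \<equiv> vectorspace.dim F (A\<lparr>carrier := module.span F A (fold_products A S n)\<rparr>)"

text \<open>Passing from \<open>d n\<close> to \<open>d (c * n)\<close> changes \<open>ln (d n) / ln n\<close> by the factor
  \<open>ln (c * n) / ln n\<close>, which tends to 1.\<close>

lemma limsup_log_ratio_rescale_le:
  fixes d d' :: "nat \<Rightarrow> nat"
  assumes c: "0 < c" and le: "\<And>n. d' n \<le> d (c * n)" and pos: "\<And>n. 0 < d' n"
  shows "limsup (\<lambda>n. ereal (ln (real (d' n)) / ln (real n))) \<le>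
    limsup (\<lambda>n. ereal (ln (real (d n)) / ln (real n)))" (is "_ \<le> ?L")
proof (rule ereal_le_real)
  fix C assume "?L \<le> ereal C"
  show "limsup (\<lambda>n. ereal (ln (real (d' n)) / ln (real n))) \<le> ereal C"
  proof (rule ereal_le_epsilon2)
    fix e :: real assume e: "0 < e"
    define C' where "C' = C + e"
    have "?L < ereal C'"
      using \<open>?L \<le> ereal C\<close> e unfolding C'_def by (simp add: le_less_trans)
    then have "\<forall>\<^sub>F n in sequentially. ereal (ln (real (d n)) / ln (real n)) < ereal C'"
      by (rule Limsup_lessD)
    then have "\<forall>\<^sub>F n in sequentially. ln (real (d n)) / ln (real n) < C'" by simp
    moreover have "filterlim (\<lambda>n. c * n) sequentially sequentially"
      using c by (intro mult_nat_left_at_top)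
    ultimately have ev: "\<forall>\<^sub>F n in sequentially. ln (real (d (c * n))) / ln (real (c * n)) < C'"
      by (rule eventually_compose_filterlim)
    have "limsup (\<lambda>n. ereal (ln (real (d' n)) / ln (real n))) \<le>
        limsup (\<lambda>n. ereal (C' * (ln (real (c * n)) / ln (real n))))"
    proof (rule Limsup_mono)
      show "\<forall>\<^sub>F n in sequentially. ereal (ln (real (d' n)) / ln (real n)) \<le>
          ereal (C' * (ln (real (c * n)) / ln (real n)))"
        using ev eventually_gt_at_top[of 1]
      proof eventually_elim
        case (elim n)
        have n: "1 < n" "1 < c * n" using elim c by (auto simp: less_le_trans)
        then have "1 < real n" "1 < real (c * n)" by linarith+
        then have ln: "0 < ln (real n)" "0 < ln (real (c * n))" using ln_gt_zero by blast+
        have "ln (real (d' n)) \<le> ln (real (d (c * n)))"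
          using le[of n] pos[of n] by simp
        also have "\<dots> \<le> C' * ln (real (c * n))"
          using elim ln by (simp add: field_simps del: of_nat_mult)
        finally show ?case using ln by (simp add: divide_right_mono del: of_nat_mult)
      qed
    qed
    also have "\<dots> = ereal C'"
    proof (rule lim_imp_Limsup)
      have "(\<lambda>n. C' * ((ln (real c) + ln (real n)) / ln (real n))) \<longlonglongrightarrow> C' * 1"
        by (intro tendsto_mult tendsto_const) real_asymp
      moreover have "\<forall>\<^sub>F n in sequentially. C' * ((ln (real c) + ln (real n)) / ln (real n)) =
          C' * (ln (real (c * n)) / ln (real n))"
        using eventually_gt_at_top[of 0] by eventually_elim (use c in \<open>simp add: ln_mult\<close>)
      ultimately have "(\<lambda>n. C' * (ln (real (c * n)) / ln (real n))) \<longlonglongrightarrow> C'"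
        using Lim_transform_eventually by fastforce
      then show "(\<lambda>n. ereal (C' * (ln (real (c * n)) / ln (real n)))) \<longlonglongrightarrow> ereal C'" by simp
    qed simp
    finally show "limsup (\<lambda>n. ereal (ln (real (d' n)) / ln (real n))) \<le> ereal C + ereal e"
      unfolding C'_def by simp
  qed
qed

context unital_algebra
begin

lemma power_dim_pos:
  assumes "\<one>\<^bsub>A\<^esub> \<noteq> \<zero>\<^bsub>A\<^esub>" "finite S" "S \<subseteq> carrier A" "\<one>\<^bsub>A\<^esub> \<in> S"
  shows "0 < power_dim F A S n"
  using assms one_in_fold_products finite_fold_products fold_products_closed by (intro dim_span_pos)

lemma power_growth_le:
  assumes nz: "\<one>\<^bsub>A\<^esub> \<noteq> \<zero>\<^bsub>A\<^esub>"
    and S: "finite S" "S \<subseteq> carrier A" "\<one>\<^bsub>A\<^esub> \<in> S" and gen: "generates_algebra F A S"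
    and T: "finite T" "T \<subseteq> carrier A" "\<one>\<^bsub>A\<^esub> \<in> T"
  shows "limsup (\<lambda>n. ereal (ln (real (power_dim F A T n)) / ln (real n))) \<le>
    limsup (\<lambda>n. ereal (ln (real (power_dim F A S n)) / ln (real n)))"
proof -
  obtain c where c: "0 < c" "T \<subseteq> span (fold_products A S c)"
    using finite_subset_of_power[OF S(2,3) gen T(1,2)] .
  show ?thesis
  proof (rule limsup_log_ratio_rescale_le[OF c(1)])
    fix n
    show "power_dim F A T n \<le> power_dim F A S (c * n)"
      using S T c by (intro dim_span_mono finite_fold_products fold_products_closed fold_products_span)
    show "0 < power_dim F A T n" using power_dim_pos nz T by blast
  qed
qed

lemma generates_algebra_span:
  assumes "S \<subseteq> carrier A"
  shows "generates_algebra F A (span S) \<longleftrightarrow> generates_algebra F A S"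
proof -
  have *: "span S \<subseteq> B \<longleftrightarrow> S \<subseteq> B" if "subspace F B A" for B
  proof
    assume "span S \<subseteq> B"
    then show "S \<subseteq> B" using in_own_span[OF assms] by (rule subset_trans[rotated])
  next
    assume "S \<subseteq> B"
    then show "span S \<subseteq> B" by (rule span_is_subset) (rule is_module[OF that])
  qed
  show ?thesis unfolding generates_algebra_def using assms span_is_subset2[OF assms] * by (metis (no_types, lifting))
qed

text \<open>Each of two finite generating sets lies in a power of the span of the other, so that the growth exponent is an
  invariant of the algebra and the definite description in \<^const>\<open>GKdim\<close> denotes.\<close>

theorem GKdim_eq_power_growth:
  assumes nz: "\<one>\<^bsub>A\<^esub> \<noteq> \<zero>\<^bsub>A\<^esub>"
    and S: "finite S" "S \<subseteq> carrier A" "\<one>\<^bsub>A\<^esub> \<in> S" and gen: "generates_algebra F A S"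
  shows "GKdim F A = limsup (\<lambda>n. ereal (ln (real (power_dim F A S n)) / ln (real n)))"
  unfolding GKdim_def
proof (rule the_equality)
  have "generating_subspace F A (span S)"
    unfolding generating_subspace_def
    using S gen span_is_subspace fin_dim_span in_own_span[OF S(2)] generates_algebra_span[OF S(2)]
    by blast
  moreover have "growth_exponent F A (span S) =
      limsup (\<lambda>n. ereal (ln (real (power_dim F A S n)) / ln (real n)))"
    unfolding growth_exponent_def algebra_power_span[OF S(2)] ..
  ultimately show "\<exists>W. generating_subspace F A W \<and>
      limsup (\<lambda>n. ereal (ln (real (power_dim F A S n)) / ln (real n))) = growth_exponent F A W"
    by (intro exI[of _ "span S"]) simp
next
  fix d assume "\<exists>W. generating_subspace F A W \<and> d = growth_exponent F A W"
  then obtain W where W: "generating_subspace F A W" and d: "d = growth_exponent F A W" by blast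
  obtain T0 where T0: "finite T0" "T0 \<subseteq> W" "W = span T0"
    using W fin_dim_subspace_span unfolding generating_subspace_def by blast
  define T where "T = insert \<one>\<^bsub>A\<^esub> T0"
  have W_car: "W \<subseteq> carrier A" using W unfolding generating_subspace_def generates_algebra_def by blast
  have one: "\<one>\<^bsub>A\<^esub> \<in> W" using W unfolding generating_subspace_def by blast
  have T: "finite T" "T \<subseteq> carrier A" "\<one>\<^bsub>A\<^esub> \<in> T"
    unfolding T_def using T0 W_car by auto
  have "T \<subseteq> span T0" using T0 one in_own_span[of T0] W_car unfolding T_def by auto
  then have WT: "W = span T"
    using T0 span_span_subset[of T0 T] span_is_monotone[of T0 T] W_car unfolding T_def by blast
  have "generates_algebra F A T"
    using W generates_algebra_span[OF T(2)] unfolding WT generating_subspace_def by blast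
  then show "d = limsup (\<lambda>n. ereal (ln (real (power_dim F A S n)) / ln (real n)))"
    unfolding d WT growth_exponent_def algebra_power_span[OF T(2)]
    using power_growth_le[OF nz S gen T] power_growth_le[OF nz T _ S] by (intro antisym) auto
qed

end

section \<open>Growth of order ideals of monomials\<close>

text \<open>Monomials are multisets of indices of variables: the product is the sum of multisets, and the degree
  is the size.\<close>

definition monomials :: "nat \<Rightarrow> nat multiset set" where
  "monomials r = {M. set_mset M \<subseteq> {..<r}}"

definition ball_count :: "nat multiset set \<Rightarrow> nat \<Rightarrow> nat" where
  "ball_count D n = card {M \<in> D. size M \<le> n}"

lemma finite_monomials_ball: "finite {M \<in> monomials r. size M \<le> n}"
proof -
  have "{M \<in> monomials r. size M \<le> n} \<subseteq> mset ` {xs. set xs \<subseteq> {..<r} \<and> length xs \<le> n}"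
  proof
    fix M assume M: "M \<in> {M \<in> monomials r. size M \<le> n}"
    obtain xs where "mset xs = M" using ex_mset by blast
    then show "M \<in> mset ` {xs. set xs \<subseteq> {..<r} \<and> length xs \<le> n}"
      using M unfolding monomials_def by (intro image_eqI[of _ _ xs]) auto
  qed
  then show ?thesis using finite_lists_length_le[of "{..<r}" n] finite_surj by blast
qed

lemma finite_ball: "D \<subseteq> monomials r \<Longrightarrow> finite {M \<in> D. size M \<le> n}"
  by (rule finite_subset[OF _ finite_monomials_ball[of r n]]) auto

text \<open>Dividing by the power of the last variable, whose exponent is \<open>k\<close>, lowers the degree by \<open>k\<close>.\<close>

lemma ball_count_slices:
  assumes D: "D \<subseteq> monomials (Suc r)"
    and S: "\<And>k. S k = {M \<in> monomials r. M + replicate_mset k r \<in> D}"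
  shows "ball_count D n = (\<Sum>k\<le>n. ball_count (S k) (n - k))"
proof -
  let ?B = "\<lambda>k. (\<lambda>M. M + replicate_mset k r) ` {M \<in> S k. size M \<le> n - k}"
  have r: "count M r = 0" if "M \<in> S k" for M k
    using that unfolding S monomials_def by (auto simp: not_in_iff[symmetric])
  have eq: "{M \<in> D. size M \<le> n} = (\<Union>k\<le>n. ?B k)"
  proof (intro subset_antisym subsetI)
    fix M assume M: "M \<in> {M \<in> D. size M \<le> n}"
    define k where "k = count M r"
    define N where "N = filter_mset (\<lambda>x. x \<noteq> r) M"
    have split: "M = N + replicate_mset k r"
      unfolding N_def k_def by (subst multiset_partition[of M "\<lambda>x. x \<noteq> r"]) (simp flip: filter_eq_replicate_mset)
    have "size M = size N + k" by (subst split) simp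
    then have sz: "k \<le> n" "size N \<le> n - k" using M by auto
    have "set_mset M \<subseteq> {..<Suc r}" using M D unfolding monomials_def by blast
    then have "N \<in> monomials r"
      unfolding monomials_def N_def using less_Suc_eq by auto
    then have "N \<in> S k" using split M unfolding S by simp
    then have "M \<in> ?B k" using split sz by auto
    then show "M \<in> (\<Union>k\<le>n. ?B k)" using sz by blast
  next
    fix M assume "M \<in> (\<Union>k\<le>n. ?B k)"
    then show "M \<in> {M \<in> D. size M \<le> n}" unfolding S by auto
  qed
  have fin: "finite {M \<in> S k. size M \<le> m}" for k m
    using finite_ball[of "S k" r m] unfolding S by auto
  have "card (\<Union>k\<le>n. ?B k) = (\<Sum>k\<le>n. card (?B k))"
  proof (rule card_UN_disjoint)
    show "\<forall>i\<in>{..n}. \<forall>j\<in>{..n}. i \<noteq> j \<longrightarrow> ?B i \<inter> ?B j = {}"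
    proof (intro ballI impI equals0I)
      fix i j M assume "i \<noteq> j" and M: "M \<in> ?B i \<inter> ?B j"
      obtain N where "N \<in> S i" "M = N + replicate_mset i r" using M by blast
      moreover obtain N' where "N' \<in> S j" "M = N' + replicate_mset j r" using M by blast
      ultimately have "count M r = i" "count M r = j" using r by (metis add_0 count_replicate_mset count_union)+
      then show False using \<open>i \<noteq> j\<close> by simp
    qed
  qed (use fin in auto)
  also have "\<dots> = (\<Sum>k\<le>n. ball_count (S k) (n - k))"
    unfolding ball_count_def by (intro sum.cong refl card_image inj_onI) simp
  finally show ?thesis unfolding ball_count_def eq .
qed

text \<open>
  The slices by the exponent of the last variable decrease, so that the zeroth one, of growth exponent
  \<open>d0\<close>, bounds the others. If some slice is empty, finitely many slices remain and the exponent is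
  \<open>d0\<close>. Otherwise all but finitely many slices grow with the least exponent \<open>\<delta>\<close> that occurs and together
  contribute \<open>\<delta> + 1\<close>; this may be below \<open>d0\<close>, hence the maximum. The lower bounds have to hold for
  all slices at once, which is why they are stated with a binomial coefficient and without a constant
  factor: the sum over the slices is then a hockey-stick sum.
\<close>

theorem down_closed_growth:
  assumes "D \<subseteq> monomials r" "D \<noteq> {}" and "\<And>M N. M + N \<in> D \<Longrightarrow> M \<in> D"
  shows "\<exists>d C. \<forall>n. (n + d) choose d \<le> ball_count D n \<and> ball_count D n \<le> C * (n + 1) ^ d"
  using assms
proof (induction r arbitrary: D)
  case 0
  then have "D = {{#}}" unfolding monomials_def by auto
  then have "ball_count D n = 1" for n unfolding ball_count_def by (simp add: Collect_conv_if)
  then show ?case by (intro exI[of _ 0] exI[of _ 1]) simp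
next
  case (Suc r)
  define S where "S k = {M \<in> monomials r. M + replicate_mset k r \<in> D}" for k
  have count: "ball_count D n = (\<Sum>k\<le>n. ball_count (S k) (n - k))" for n
    using ball_count_slices[OF Suc.prems(1) S_def] .
  have S_mono: "S l \<subseteq> S k" if "k \<le> l" for k l
  proof
    fix M assume M: "M \<in> S l"
    have "M + replicate_mset l r = (M + replicate_mset k r) + replicate_mset (l - k) r"
      using that by (intro multiset_eqI) simp
    then have "(M + replicate_mset k r) + replicate_mset (l - k) r \<in> D"
      using M unfolding S_def by (simp add: add.assoc)
    then show "M \<in> S k" using Suc.prems(3) M unfolding S_def by blast
  qed
  have bc_mono: "ball_count (S l) m \<le> ball_count (S k) n" if "k \<le> l" "m \<le> n" for k l m n
    unfolding ball_count_def
    using S_mono[OF that(1)] that(2) by (intro card_mono finite_ball[of _ r]) (auto simp: S_def)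
  have IH: "\<exists>d C. \<forall>n. (n + d) choose d \<le> ball_count (S k) n \<and> ball_count (S k) n \<le> C * (n + 1) ^ d"
    if "S k \<noteq> {}" for k
  proof (rule Suc.IH[OF _ that])
    show "S k \<subseteq> monomials r" unfolding S_def by blast
    fix M N assume "M + N \<in> S k"
    then have "M + N \<in> monomials r" "(M + replicate_mset k r) + N \<in> D"
      unfolding S_def by (auto simp: ac_simps)
    then show "M \<in> S k" using Suc.prems(3) unfolding S_def monomials_def by auto
  qed
  have "{#} \<in> D" using Suc.prems(2) Suc.prems(3)[of "{#}"] by auto
  then have "{#} \<in> S 0" unfolding S_def monomials_def by simp
  then obtain d0 C0 where b0: "\<And>n. (n + d0) choose d0 \<le> ball_count (S 0) n"
      "\<And>n. ball_count (S 0) n \<le> C0 * (n + 1) ^ d0"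
    using IH[of 0] by blast
  have lower0: "(n + d0) choose d0 \<le> ball_count D n" for n
  proof -
    have "ball_count (S 0) n \<le> ball_count D n"
      unfolding count using member_le_sum[where i = 0 and A = "{..n}" and f = "\<lambda>k. ball_count (S k) (n - k)"] by simp
    then show ?thesis using b0(1) le_trans by blast
  qed
  have upper0: "(\<Sum>k\<in>{..n} \<inter> {..<m}. ball_count (S k) (n - k)) \<le> m * C0 * (n + 1) ^ d0" for n m
  proof -
    have "(\<Sum>k\<in>{..n} \<inter> {..<m}. ball_count (S k) (n - k)) \<le> card ({..n} \<inter> {..<m}) * (C0 * (n + 1) ^ d0)"
      using sum_bounded_above[of "{..n} \<inter> {..<m}" "\<lambda>k. ball_count (S k) (n - k)" "C0 * (n + 1) ^ d0"]
        bc_mono[of 0] b0(2) le_trans by (metis diff_le_self le0 of_nat_id)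
    also have "\<dots> \<le> m * (C0 * (n + 1) ^ d0)"
      using card_mono[of "{..<m}" "{..n} \<inter> {..<m}"] by (intro mult_right_mono) auto
    finally show ?thesis by (simp add: mult.assoc)
  qed
  have split: "ball_count D n = (\<Sum>k\<in>{..n} \<inter> {..<m}. ball_count (S k) (n - k)) +
      (\<Sum>k\<in>{..n} \<inter> {m..}. ball_count (S k) (n - k))" for n m
  proof -
    have "{..n} = ({..n} \<inter> {..<m}) \<union> ({..n} \<inter> {m..})" by auto
    then show ?thesis unfolding count
      by (subst sum.union_disjoint[symmetric]) (auto intro!: sum.cong)
  qed
  show ?case
  proof (cases "\<exists>m. S m = {}")
    case True
    then obtain m where m: "S m = {}" by blast
    have "ball_count (S k) j = 0" if "m \<le> k" for k j
      using S_mono[OF that] m unfolding ball_count_def by simp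
    then have "ball_count D n \<le> m * C0 * (n + 1) ^ d0" for n
      using split[of n m] upper0[of n m] by simp
    then show ?thesis using lower0 by blast
  next
    case False
    then obtain d C where dC: "\<And>k n. (n + d k) choose d k \<le> ball_count (S k) n"
        "\<And>k n. ball_count (S k) n \<le> C k * (n + 1) ^ d k"
      using IH by metis
    obtain m where m: "\<And>k. d m \<le> d k" using ex_has_least_nat[of "\<lambda>_. True" _ d] by auto
    define \<delta> where "\<delta> = d m"
    have lower1: "(n + Suc \<delta>) choose Suc \<delta> \<le> ball_count D n" for n
    proof -
      have "(\<Sum>k\<le>n. (\<delta> + k) choose \<delta>) = (n + Suc \<delta>) choose Suc \<delta>"
        using choose_rising_sum(1)[of \<delta> n] by (simp add: ac_simps)
      moreover have "(\<Sum>k\<le>n. (\<delta> + k) choose \<delta>) = (\<Sum>k\<le>n. (\<delta> + (n - k)) choose \<delta>)"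
        by (rule sum.reindex_bij_witness[of _ "\<lambda>k. n - k" "\<lambda>k. n - k"]) auto
      moreover have "(\<Sum>k\<le>n. (\<delta> + (n - k)) choose \<delta>) \<le> ball_count D n"
        unfolding count
      proof (rule sum_mono)
        fix k
        have "(\<delta> + (n - k)) choose \<delta> = (\<delta> + (n - k)) choose (n - k)"
          using binomial_symmetric[of \<delta> "\<delta> + (n - k)"] by simp
        also have "\<dots> \<le> (d k + (n - k)) choose (n - k)"
          using m unfolding \<delta>_def by (intro binomial_right_mono) auto
        also have "\<dots> = (n - k + d k) choose d k"
          using binomial_symmetric[of "d k" "d k + (n - k)"] by (simp add: add.commute)
        finally show "(\<delta> + (n - k)) choose \<delta> \<le> ball_count (S k) (n - k)"
          using dC(1) le_trans by blast
      qed
      ultimately show ?thesis by simp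
    qed
    have upper1: "(\<Sum>k\<in>{..n} \<inter> {m..}. ball_count (S k) (n - k)) \<le> C m * (n + 1) ^ Suc \<delta>" for n
    proof -
      have "ball_count (S k) (n - k) \<le> C m * (n + 1) ^ \<delta>" if "k \<in> {..n} \<inter> {m..}" for k
        using bc_mono[of m k "n - k" n] dC(2)[of m n] that unfolding \<delta>_def by simp
      then have "(\<Sum>k\<in>{..n} \<inter> {m..}. ball_count (S k) (n - k)) \<le>
          card ({..n} \<inter> {m..}) * (C m * (n + 1) ^ \<delta>)"
        using sum_bounded_above[of "{..n} \<inter> {m..}" "\<lambda>k. ball_count (S k) (n - k)"] by simp
      also have "\<dots> \<le> (n + 1) * (C m * (n + 1) ^ \<delta>)"
        using card_mono[of "{..n}" "{..n} \<inter> {m..}"] by (intro mult_right_mono) auto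
      finally show ?thesis by (simp add: ac_simps)
    qed
    define e where "e = max d0 (Suc \<delta>)"
    have "(n + e) choose e \<le> ball_count D n" for n
      using lower0 lower1 unfolding e_def max_def by simp
    moreover have "ball_count D n \<le> (m * C0 + C m) * (n + 1) ^ e" for n
    proof -
      have "m * C0 * (n + 1) ^ d0 \<le> m * C0 * (n + 1) ^ e"
        unfolding e_def by (intro mult_left_mono power_increasing) auto
      moreover have "C m * (n + 1) ^ Suc \<delta> \<le> C m * (n + 1) ^ e"
        unfolding e_def by (intro mult_left_mono power_increasing) auto
      ultimately show ?thesis
        using split[of n m] upper0[of n m] upper1[of n] unfolding add_mult_distrib by linarith
    qed
    ultimately show ?thesis by blast
  qed
qed

text \<open>The lower bound is of order \<open>n ^ d\<close> too, by \<open>((n + d) / d) ^ d \<le> (n + d) choose d\<close>.\<close>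

lemma log_ratio_tendsto:
  fixes f :: "nat \<Rightarrow> nat"
  assumes low: "\<And>n. (n + d) choose d \<le> f n" and upp: "\<And>n. f n \<le> C * (n + 1) ^ d"
  shows "(\<lambda>n. ln (real (f n)) / ln (real n)) \<longlonglongrightarrow> real d"
proof (rule tendsto_sandwich)
  have pos: "0 < f n" for n using low[of n] zero_less_binomial[of d "n + d"] by linarith
  have C: "0 < C" using pos[of 0] upp[of 0] by (auto intro: Nat.gr0I)
  \<comment> \<open>The maximum matters for \<open>d = 0\<close> only, where the left-hand side vanishes anyway.\<close>
  show "\<forall>\<^sub>F n in sequentially. (real d * (ln (real n) - ln (real (max 1 d)))) / ln (real n)
      \<le> ln (real (f n)) / ln (real n)"
    using eventually_gt_at_top[of 1]
  proof eventually_elim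
    case (elim n)
    have "real d * (ln (real n) - ln (real (max 1 d))) \<le> ln (real (f n))"
    proof (cases "d = 0")
      case True
      then show ?thesis using pos[of n] by simp
    next
      case False
      have "(real n / real d) ^ d \<le> (real (n + d) / real d) ^ d"
        by (intro power_mono divide_right_mono) auto
      also have "\<dots> \<le> real ((n + d) choose d)"
        using binomial_ge_n_over_k_pow_k[of d "n + d", where 'a = real] by simp
      also have "\<dots> \<le> real (f n)" using low by simp
      finally have "ln ((real n / real d) ^ d) \<le> ln (real (f n))"
        using elim False by (subst ln_le_cancel_iff) (auto simp: pos)
      moreover have "ln ((real n / real d) ^ d) = real d * (ln (real n) - ln (real (max 1 d)))"
        using elim False by (simp add: ln_realpow ln_div max_def)
      ultimately show ?thesis by simp
    qed
    then show ?case using elim by (intro divide_right_mono) auto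
  qed
  show "\<forall>\<^sub>F n in sequentially. ln (real (f n)) / ln (real n) \<le>
      (ln (real C) + real d * ln (real n + 1)) / ln (real n)"
    using eventually_gt_at_top[of 1]
  proof eventually_elim
    case (elim n)
    have "real (f n) \<le> real C * (real n + 1) ^ d"
      using upp[of n] of_nat_le_iff[where 'a = real, of "f n" "C * (n + 1) ^ d"] by (simp add: add.commute)
    then have "ln (real (f n)) \<le> ln (real C * (real n + 1) ^ d)"
      using pos[of n] C by (subst ln_le_cancel_iff) auto
    also have "\<dots> = ln (real C) + real d * ln (real n + 1)"
      using C by (simp add: ln_mult ln_realpow)
    finally show ?case using elim by (intro divide_right_mono) auto
  qed
  have "(\<lambda>n. (ln (real n) - ln (real (max 1 d))) / ln (real n)) \<longlonglongrightarrow> 1" by real_asymp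
  then have "(\<lambda>n. real d * ((ln (real n) - ln (real (max 1 d))) / ln (real n))) \<longlonglongrightarrow> real d * 1"
    by (intro tendsto_mult tendsto_const)
  then show "(\<lambda>n. (real d * (ln (real n) - ln (real (max 1 d)))) / ln (real n)) \<longlonglongrightarrow> real d"
    by simp
  have "(\<lambda>n. ln (real C) / ln (real n) + real d * (ln (real n + 1) / ln (real n))) \<longlonglongrightarrow> 0 + real d * 1"
    by (intro tendsto_add tendsto_mult tendsto_const) real_asymp+
  then show "(\<lambda>n. (ln (real C) + real d * ln (real n + 1)) / ln (real n)) \<longlonglongrightarrow> real d"
    by (simp add: add_divide_distrib)
qed

section \<open>Commutative algebras have regular growth\<close>

context vectorspace
begin

lemma lin_indpt_insert:
  assumes "S \<subseteq> carrier V" "lin_indpt S" "v \<in> carrier V" "v \<notin> span S"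
  shows "lin_indpt (insert v S)"
proof -
  have "v \<notin> S" using assms in_own_span by blast
  then show ?thesis using lin_dep_iff_in_span[OF assms(1-3)] assms(4) by simp
qed

text \<open>Adding the vectors in the order of \<open>\<kappa>\<close>, each one lies outside of the span of its predecessors.\<close>

lemma lin_indpt_if_new:
  fixes f :: "'i \<Rightarrow> 'c" and \<kappa> :: "'i \<Rightarrow> 'o::linorder"
  assumes "finite I" "f ` I \<subseteq> carrier V" "inj_on \<kappa> I"
    and "\<And>i. i \<in> I \<Longrightarrow> f i \<notin> span (f ` {j \<in> I. \<kappa> j < \<kappa> i})"
  shows "lin_indpt (f ` I) \<and> inj_on f I"
  using assms
proof (induction rule: finite_ranking_induct[where f = \<kappa>])
  case empty
  then show ?case by (simp add: lin_dep_def)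
next
  case (insert i I)
  show ?case
  proof (cases "i \<in> I")
    case True
    then show ?thesis using insert.IH insert.prems by (simp add: insert_absorb)
  next
    case False
    have lt: "\<kappa> j < \<kappa> i" if "j \<in> I" for j
      using insert.hyps(2)[OF that] insert.prems(2) that False
      by (metis inj_on_contraD insertI1 insertI2 order_le_imp_less_or_eq)
    have "{j \<in> insert i I. \<kappa> j < \<kappa> k} = {j \<in> I. \<kappa> j < \<kappa> k}" if "k \<in> I" for k
      using lt[OF that] by auto
    then have eq: "k \<in> I \<Longrightarrow> {j \<in> insert i I. \<kappa> j < \<kappa> k} = {j \<in> I. \<kappa> j < \<kappa> k}" for k .
    have "f k \<notin> span (f ` {j \<in> I. \<kappa> j < \<kappa> k})" if "k \<in> I" for k
      using insert.prems(3)[of k] unfolding eq[OF that] using that by blast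
    then have IH: "lin_indpt (f ` I)" "inj_on f I"
      using insert.IH insert.prems by auto
    have "{j \<in> insert i I. \<kappa> j < \<kappa> i} = I" using lt by auto
    then have new: "f i \<notin> span (f ` I)" using insert.prems(3)[of i] by simp
    have "f i \<notin> f ` I" using new in_own_span[of "f ` I"] insert.prems by auto
    then show ?thesis using IH lin_indpt_insert[of "f ` I" "f i"] new insert.prems False by auto
  qed
qed

end

locale commutative_unital_algebra = unital_algebra F A + A: cring A for F A

lemma commutative_unital_algebraI:
  assumes "field F" "algebra F A"
  shows "commutative_unital_algebra F A"
proof -
  interpret F: field F by fact
  interpret algebra F A by fact
  show ?thesis
  proof (intro commutative_unital_algebra.intro unital_algebra.intro unital_algebra_axioms.intro)
    show "vectorspace F A" by (intro vectorspace.intro module_axioms F.field_axioms)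
    show "ring A" "cring A" by unfold_locales
    fix c x y assume "c \<in> carrier F" "x \<in> carrier A" "y \<in> carrier A"
    then show "(c \<odot>\<^bsub>A\<^esub> x) \<otimes>\<^bsub>A\<^esub> y = c \<odot>\<^bsub>A\<^esub> (x \<otimes>\<^bsub>A\<^esub> y)"
      by (rule smult_assoc2)
    then show "x \<otimes>\<^bsub>A\<^esub> (c \<odot>\<^bsub>A\<^esub> y) = c \<odot>\<^bsub>A\<^esub> (x \<otimes>\<^bsub>A\<^esub> y)"
      using \<open>c \<in> carrier F\<close> \<open>x \<in> carrier A\<close> \<open>y \<in> carrier A\<close>
      by (simp add: m_comm[of x] smult_assoc2)
  qed
qed

text \<open>Monomials are compared by their degree first.\<close>

definition deglex :: "nat multiset \<Rightarrow> nat \<times> nat multiset" where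
  "deglex M = (size M, M)"

lemma deglex_add_mono: "deglex M < deglex N \<Longrightarrow> deglex (M + L) < deglex (N + L)"
  by (auto simp: deglex_def less_prod_def)

locale monomial_generators = commutative_unital_algebra F A
  for F :: "('f, 'm) ring_scheme" and A :: "('f, 'a, 'n) module_scheme" +
  fixes x :: "nat \<Rightarrow> 'a" and r :: nat
  assumes x_closed: "\<And>i. i < r \<Longrightarrow> x i \<in> carrier A"
    and nonzero: "\<one>\<^bsub>A\<^esub> \<noteq> \<zero>\<^bsub>A\<^esub>"
begin

definition mon :: "nat multiset \<Rightarrow> 'a" where
  "mon M = finprod A (\<lambda>i. x i [^]\<^bsub>A\<^esub> count M i) {..<r}"

text \<open>The monomials that do not reduce to smaller ones modulo the relations between the generators, that is,
  those outside of the initial ideal of these relations.\<close>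

definition standard :: "nat multiset set" where
  "standard = {M \<in> monomials r. mon M \<notin> span (mon ` {N \<in> monomials r. deglex N < deglex M})}"

lemma mon_closed: "mon M \<in> carrier A"
  unfolding mon_def by (intro A.finprod_closed) (auto simp: x_closed)

lemma mon_empty: "mon {#} = \<one>\<^bsub>A\<^esub>"
  unfolding mon_def by (simp add: A.finprod_one_eqI)

lemma mon_add: "mon (M + N) = mon M \<otimes>\<^bsub>A\<^esub> mon N"
proof -
  have "mon (M + N) = finprod A (\<lambda>i. x i [^]\<^bsub>A\<^esub> count M i \<otimes>\<^bsub>A\<^esub> x i [^]\<^bsub>A\<^esub> count N i) {..<r}"
    unfolding mon_def by (intro A.finprod_cong') (auto simp: x_closed A.nat_pow_mult)
  also have "\<dots> = mon M \<otimes>\<^bsub>A\<^esub> mon N"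
    unfolding mon_def by (intro A.finprod_multf) (auto simp: x_closed)
  finally show ?thesis .
qed

lemma mon_single:
  assumes "i < r"
  shows "mon {#i#} = x i"
proof -
  have "mon {#i#} = finprod A (\<lambda>j. if i = j then x j else \<one>\<^bsub>A\<^esub>) {..<r}"
    unfolding mon_def using x_closed by (intro A.finprod_cong') auto
  also have "\<dots> = x i"
    using assms x_closed by (intro A.finprod_singleton) auto
  finally show ?thesis .
qed

text \<open>The order is compatible with multiplication, so multiplying a reduction of \<open>M\<close> by \<open>L\<close> gives a reduction
  of \<open>M + L\<close>.\<close>

lemma standard_down_closed:
  assumes "M + L \<in> standard"
  shows "M \<in> standard"
proof (rule ccontr)
  assume "M \<notin> standard"
  moreover have mons: "M \<in> monomials r" "L \<in> monomials r"
    using assms unfolding standard_def monomials_def by auto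
  ultimately have M: "mon M \<in> span (mon ` {N \<in> monomials r. deglex N < deglex M})"
    unfolding standard_def by blast
  have cl: "mon ` X \<subseteq> carrier A" for X using mon_closed by blast
  have "mon M \<otimes>\<^bsub>A\<^esub> mon L \<in> span (mon ` {N \<in> monomials r. deglex N < deglex (M + L)})"
  proof (rule span_mult[OF cl _ cl _ M])
    show "{mon L} \<subseteq> carrier A" "mon L \<in> span {mon L}" using mon_closed span_self by auto
    fix s t assume "s \<in> mon ` {N \<in> monomials r. deglex N < deglex M}" "t \<in> {mon L}"
    then obtain N where N: "N \<in> monomials r" "deglex N < deglex M" and st: "s = mon N" "t = mon L"
      by blast
    have "s \<otimes>\<^bsub>A\<^esub> t = mon (N + L)" unfolding st mon_add ..
    moreover have "N + L \<in> monomials r" using mons N(1) unfolding monomials_def by simp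
    moreover have "deglex (N + L) < deglex (M + L)" using N(2) by (rule deglex_add_mono)
    ultimately have "s \<otimes>\<^bsub>A\<^esub> t \<in> mon ` {N \<in> monomials r. deglex N < deglex (M + L)}"
      by (intro image_eqI[of _ _ "N + L"]) simp_all
    then show "s \<otimes>\<^bsub>A\<^esub> t \<in> span (mon ` {N \<in> monomials r. deglex N < deglex (M + L)})"
      by (rule subsetD[OF in_own_span[OF cl]])
  qed
  then show False using assms unfolding standard_def by (simp add: mon_add)
qed

lemma empty_standard: "{#} \<in> standard"
proof -
  have none: "{N \<in> monomials r. deglex N < deglex {#}} = {}"
    by (auto simp: deglex_def less_prod_def)
  have "span (mon ` {N \<in> monomials r. deglex N < deglex {#}}) = {\<zero>\<^bsub>A\<^esub>}"
    unfolding none using span_empty by simp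
  moreover have "{#} \<in> monomials r" unfolding monomials_def by simp
  ultimately show ?thesis
    unfolding standard_def using nonzero by (simp add: mon_empty)
qed

text \<open>Reduction terminates because \<^const>\<open>deglex\<close> takes values in a well-order; the bound on the right keeps
  track of the degree.\<close>

lemma mon_in_span_standard:
  assumes "M \<in> monomials r"
  shows "mon M \<in> span (mon ` {N \<in> standard. deglex N \<le> deglex M})"
  using assms
proof (induction "deglex M" arbitrary: M rule: less_induct)
  case less
  have cl: "mon ` X \<subseteq> carrier A" for X using mon_closed by blast
  show ?case
  proof (cases "M \<in> standard")
    case True
    then have "mon M \<in> mon ` {N \<in> standard. deglex N \<le> deglex M}" by blast
    then show ?thesis by (rule subsetD[OF in_own_span[OF cl]])
  next
    case False
    have "mon N \<in> span (mon ` {N \<in> standard. deglex N \<le> deglex M})"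
      if N: "N \<in> monomials r" "deglex N < deglex M" for N
    proof -
      have "mon ` {L \<in> standard. deglex L \<le> deglex N} \<subseteq> mon ` {N \<in> standard. deglex N \<le> deglex M}"
        using N(2) by auto
      then show ?thesis using less(1)[OF N(2,1)] span_is_monotone by blast
    qed
    then have "span (mon ` {N \<in> monomials r. deglex N < deglex M}) \<subseteq>
        span (mon ` {N \<in> standard. deglex N \<le> deglex M})"
      by (intro span_span_subset cl) auto
    then show ?thesis using False less.prems unfolding standard_def by blast
  qed
qed

text \<open>The generator \<open>1\<close> accounts for the monomials of degree less than \<open>n\<close>.\<close>

lemma fold_products_eq_mon:
  "fold_products A (insert \<one>\<^bsub>A\<^esub> (x ` {..<r})) n = mon ` {M \<in> monomials r. size M \<le> n}"
proof (induction n)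
  case 0
  then show ?case using mon_empty by (auto simp: monomials_def)
next
  case (Suc n)
  show ?case
  proof (intro subset_antisym subsetI)
    fix y assume "y \<in> fold_products A (insert \<one>\<^bsub>A\<^esub> (x ` {..<r})) (Suc n)"
    then obtain s M where y: "y = s \<otimes>\<^bsub>A\<^esub> mon M" and s: "s \<in> insert \<one>\<^bsub>A\<^esub> (x ` {..<r})"
      and M: "M \<in> monomials r" "size M \<le> n"
      unfolding fold_products_Suc Suc by auto
    from s consider "s = \<one>\<^bsub>A\<^esub>" | i where "i < r" "s = x i" by auto
    then show "y \<in> mon ` {M \<in> monomials r. size M \<le> Suc n}"
    proof cases
      case 1
      then have "y = mon M" using y mon_closed by simp
      then show ?thesis using M by auto
    next
      case 2
      then have "y = mon ({#i#} + M)" unfolding y mon_add by (simp add: mon_single)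
      moreover have "{#i#} + M \<in> monomials r" using 2 M unfolding monomials_def by auto
      ultimately show ?thesis using M by (intro image_eqI) auto
    qed
  next
    fix y assume "y \<in> mon ` {M \<in> monomials r. size M \<le> Suc n}"
    then obtain M where y: "y = mon M" and M: "M \<in> monomials r" "size M \<le> Suc n" by blast
    show "y \<in> fold_products A (insert \<one>\<^bsub>A\<^esub> (x ` {..<r})) (Suc n)"
    proof (cases M)
      case empty
      then have "y = \<one>\<^bsub>A\<^esub> \<otimes>\<^bsub>A\<^esub> mon {#}" using y mon_closed by simp
      moreover have "mon {#} \<in> mon ` {M \<in> monomials r. size M \<le> n}" by (auto simp: monomials_def)
      ultimately show ?thesis unfolding fold_products_Suc Suc by blast
    next
      case (add i N)
      then have iN: "i < r" "N \<in> monomials r" "size N \<le> n" using M unfolding monomials_def by auto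
      then have "y = x i \<otimes>\<^bsub>A\<^esub> mon N" using y add mon_add[of "{#i#}" N] by (simp add: mon_single)
      then show ?thesis unfolding fold_products_Suc Suc using iN by blast
    qed
  qed
qed

text \<open>Comparing degrees first ensures that reduction does not leave the span of the monomials of degree at
  most \<open>n\<close>, of which the standard monomials of this degree are therefore a basis.\<close>

lemma power_dim_eq_ball_count:
  "power_dim F A (insert \<one>\<^bsub>A\<^esub> (x ` {..<r})) n = ball_count standard n"
proof -
  let ?I = "{M \<in> standard. size M \<le> n}" and ?J = "{M \<in> monomials r. size M \<le> n}"
  have cl: "mon ` X \<subseteq> carrier A" for X using mon_closed by blast
  have IJ: "?I \<subseteq> ?J" unfolding standard_def by blast
  have fin: "finite ?I" using finite_monomials_ball finite_subset[OF IJ] by blast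
  have "lin_indpt (mon ` ?I) \<and> inj_on mon ?I"
  proof (rule lin_indpt_if_new[where \<kappa> = deglex, OF fin cl])
    show "inj_on deglex ?I" by (auto simp: inj_on_def deglex_def)
    fix M assume "M \<in> ?I"
    then have "mon M \<notin> span (mon ` {N \<in> monomials r. deglex N < deglex M})"
      unfolding standard_def by blast
    moreover have "mon ` {N \<in> ?I. deglex N < deglex M} \<subseteq> mon ` {N \<in> monomials r. deglex N < deglex M}"
      using IJ by blast
    ultimately show "mon M \<notin> span (mon ` {N \<in> ?I. deglex N < deglex M})"
      using span_is_monotone by blast
  qed
  moreover have "span (mon ` ?J) = span (mon ` ?I)"
  proof (rule subset_antisym)
    show "span (mon ` ?J) \<subseteq> span (mon ` ?I)"
    proof (rule span_span_subset[OF cl], rule image_subsetI)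
      fix M assume M: "M \<in> ?J"
      have "mon ` {N \<in> standard. deglex N \<le> deglex M} \<subseteq> mon ` ?I"
        using M by (auto simp: deglex_def less_eq_prod_def)
      then show "mon M \<in> span (mon ` ?I)"
        using mon_in_span_standard[of M] M span_is_monotone by blast
    qed
    show "span (mon ` ?I) \<subseteq> span (mon ` ?J)" using IJ by (intro span_is_monotone image_mono)
  qed
  ultimately show ?thesis
    unfolding fold_products_eq_mon ball_count_def
    using dim_span_lin_indpt[of "mon ` ?I"] fin cl card_image by fastforce
qed

lemma power_growth_tendsto:
  "\<exists>d::nat. (\<lambda>n. ln (real (power_dim F A (insert \<one>\<^bsub>A\<^esub> (x ` {..<r})) n)) / ln (real n)) \<longlonglongrightarrow> real d"
proof -
  have "standard \<subseteq> monomials r" unfolding standard_def by blast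
  moreover have "standard \<noteq> {}" using empty_standard by blast
  ultimately obtain d C where "\<And>n. (n + d) choose d \<le> ball_count standard n"
      "\<And>n. ball_count standard n \<le> C * (n + 1) ^ d"
    using down_closed_growth[of standard r] standard_down_closed by blast
  then show ?thesis unfolding power_dim_eq_ball_count using log_ratio_tendsto by blast
qed

end

text \<open>Standard monomials form an order ideal, and these have polynomial growth.\<close>

theorem (in commutative_unital_algebra) finite_growth_tendsto:
  assumes "\<one>\<^bsub>A\<^esub> \<noteq> \<zero>\<^bsub>A\<^esub>" "finite S" "S \<subseteq> carrier A"
  shows "\<exists>d::nat. (\<lambda>n. ln (real (power_dim F A (insert \<one>\<^bsub>A\<^esub> S) n)) / ln (real n)) \<longlonglongrightarrow> real d"
proof -
  obtain x where x: "S = x ` {..<card S}"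
    using ex_bij_betw_nat_finite[OF assms(2)] unfolding bij_betw_def atLeast0LessThan by metis
  interpret monomial_generators F A x "card S"
    using assms x by unfold_locales auto
  show ?thesis using power_growth_tendsto x by simp
qed

section \<open>Growth of a tensor product\<close>

definition linear_functional :: "('f, 'm) ring_scheme \<Rightarrow> ('f, 'a, 'n) module_scheme \<Rightarrow> ('a \<Rightarrow> 'f) \<Rightarrow> bool" where
  "linear_functional F V \<phi> \<longleftrightarrow>
    (\<forall>x\<in>carrier V. \<phi> x \<in> carrier F) \<and>
    (\<forall>x\<in>carrier V. \<forall>y\<in>carrier V. \<phi> (x \<oplus>\<^bsub>V\<^esub> y) = \<phi> x \<oplus>\<^bsub>F\<^esub> \<phi> y) \<and>
    (\<forall>c\<in>carrier F. \<forall>x\<in>carrier V. \<phi> (c \<odot>\<^bsub>V\<^esub> x) = c \<otimes>\<^bsub>F\<^esub> \<phi> x)"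

lemma (in vectorspace) maximal_submodule_avoiding:
  assumes T: "submodule K T V" "a \<notin> T"
  obtains M where "submodule K M V" "T \<subseteq> M" "a \<notin> M"
    "\<forall>N. submodule K N V \<and> a \<notin> N \<and> M \<subseteq> N \<longrightarrow> N = M"
proof -
  let ?\<A> = "{M. submodule K M V \<and> T \<subseteq> M \<and> a \<notin> M}"
  have "\<exists>M\<in>?\<A>. \<forall>X\<in>?\<A>. M \<subseteq> X \<longrightarrow> X = M"
  proof (rule subset_Zorn_nonempty)
    show "?\<A> \<noteq> {}" using T by blast
    fix \<C> assume ne: "\<C> \<noteq> {}" and chain: "subset.chain ?\<A> \<C>"
    have \<C>: "submodule K M V" "T \<subseteq> M" "a \<notin> M" if "M \<in> \<C>" for M
      using chain that unfolding subset.chain_def by auto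
    have "submodule K (\<Union>\<C>) V"
    proof (rule nested_union_vs[where I = \<C> and N = "\<lambda>M. M"])
      fix i j assume ij: "i \<in> \<C>" "j \<in> \<C>"
      then have "i \<subseteq> j \<or> j \<subseteq> i" using chain unfolding subset_chain_def by auto
      then show "\<exists>k. k \<in> \<C> \<and> i \<subseteq> k \<and> j \<subseteq> k" using ij by auto
    qed (simp_all add: \<C> ne)
    moreover have "T \<subseteq> \<Union>\<C>" using ne \<C>(2) by fastforce
    moreover have "a \<notin> \<Union>\<C>" using \<C>(3) by auto
    ultimately show "\<Union>\<C> \<in> ?\<A>" by simp
  qed
  then obtain M where M: "submodule K M V" "T \<subseteq> M" "a \<notin> M" and max: "\<forall>X\<in>?\<A>. M \<subseteq> X \<longrightarrow> X = M"
    by auto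
  show ?thesis
    using that[OF M] max M(2) by auto
qed

text \<open>
  A subspace \<open>M\<close> maximal among those that contain \<open>T\<close> but not \<open>a\<close> is a hyperplane complementary to the
  line through \<open>a\<close>. The functional is the coordinate along that line, up to the sign: \<open>\<phi> v\<close> is the
  scalar with \<open>v + \<phi>(v) a \<in> M\<close>.
\<close>

lemma (in vectorspace) functional_separating:
  assumes T: "submodule K T V" "a \<notin> T" and a: "a \<in> carrier V"
  obtains \<phi> where "linear_functional K V \<phi>" "\<And>v. v \<in> T \<Longrightarrow> \<phi> v = \<zero>\<^bsub>K\<^esub>" "\<phi> a \<noteq> \<zero>\<^bsub>K\<^esub>"
proof -
  obtain M where M1: "submodule K M V" and TM: "T \<subseteq> M" and M2: "a \<notin> M"
    and max: "\<forall>N. submodule K N V \<and> a \<notin> N \<and> M \<subseteq> N \<longrightarrow> N = M"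
    using maximal_submodule_avoiding[OF T] .
  note M = M1 M2
  have M_add: "x \<oplus>\<^bsub>V\<^esub> y \<in> M" if "x \<in> M" "y \<in> M" for x y
    using M(1) that unfolding submodule_def by blast
  have M_smult: "c \<odot>\<^bsub>V\<^esub> x \<in> M" if "c \<in> carrier K" "x \<in> M" for c x
    using M(1) that unfolding submodule_def by blast
  have M_zero: "\<zero>\<^bsub>V\<^esub> \<in> M" using M(1) unfolding submodule_def by blast
  have M_carrier: "M \<subseteq> carrier V" using M(1) unfolding submodule_def by blast
  have scaled: "c = \<zero>\<^bsub>K\<^esub>" if "c \<in> carrier K" "c \<odot>\<^bsub>V\<^esub> a \<in> M" for c
  proof (rule ccontr)
    assume "c \<noteq> \<zero>\<^bsub>K\<^esub>"
    then have "a = inv\<^bsub>K\<^esub> c \<odot>\<^bsub>V\<^esub> (c \<odot>\<^bsub>V\<^esub> a)" "inv\<^bsub>K\<^esub> c \<in> carrier K"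
      using mult_inverse[OF that(1) a refl] that by (auto simp: field_Units)
    then show False using M_smult[OF _ that(2)] M(2) by metis
  qed
  have decomp: "\<exists>c\<in>carrier K. v \<oplus>\<^bsub>V\<^esub> c \<odot>\<^bsub>V\<^esub> a \<in> M" if v: "v \<in> carrier V" for v
  proof (cases "v \<in> M")
    case True
    then show ?thesis using a v by (intro bexI[of _ "\<zero>\<^bsub>K\<^esub>"]) auto
  next
    case False
    \<comment> \<open>By maximality, adjoining \<open>v\<close> to \<open>M\<close> captures \<open>a\<close>; solve for \<open>v\<close>.\<close>
    have M': "subspace K M V" and L: "subspace K (span {v}) V"
      using M(1) v span_is_subspace vectorspace_axioms unfolding subspace_def by auto
    let ?N = "subspace_sum M (span {v})"
    have "M \<subseteq> ?N" "span {v} \<subseteq> ?N"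
      using in_sum_vs[OF M' L] in_sum_vs[OF L M'] vsum_comm[OF M' L] by auto
    moreover have "v \<in> span {v}" using span_self v by blast
    moreover have "submodule K ?N V" using is_module[OF sum_is_subspace[OF M' L]] .
    ultimately have "a \<in> ?N" using max False by auto
    then obtain m w where "m \<in> M" "w \<in> span {v}" and a_eq: "a = m \<oplus>\<^bsub>V\<^esub> w"
      unfolding submodule_sum_def by auto
    moreover obtain d where "d \<in> carrier K" "w = d \<odot>\<^bsub>V\<^esub> v"
      using finite_in_span[of "{v}" w] calculation(2) v by (auto simp: lincomb_def Pi_def)
    ultimately have md: "m \<in> M" "d \<in> carrier K" "a = m \<oplus>\<^bsub>V\<^esub> d \<odot>\<^bsub>V\<^esub> v" by auto
    have m: "m \<in> carrier V" using md M_carrier by blast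
    have "d \<noteq> \<zero>\<^bsub>K\<^esub>" using md m M(2) v by auto
    then have inv: "inv\<^bsub>K\<^esub> d \<in> carrier K" "inv\<^bsub>K\<^esub> d \<otimes>\<^bsub>K\<^esub> d = \<one>\<^bsub>K\<^esub>" using md by (auto simp: field_Units)
    let ?e = "inv\<^bsub>K\<^esub> d"
    have "?e \<odot>\<^bsub>V\<^esub> a = ?e \<odot>\<^bsub>V\<^esub> m \<oplus>\<^bsub>V\<^esub> v"
      using md m v inv by (simp add: smult_r_distr smult_assoc1[symmetric])
    then have "v \<oplus>\<^bsub>V\<^esub> (\<ominus>\<^bsub>K\<^esub> ?e) \<odot>\<^bsub>V\<^esub> a = v \<oplus>\<^bsub>V\<^esub> \<ominus>\<^bsub>V\<^esub> (?e \<odot>\<^bsub>V\<^esub> m \<oplus>\<^bsub>V\<^esub> v)"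
      using a inv by (simp add: smult_l_minus)
    also have "\<dots> = v \<oplus>\<^bsub>V\<^esub> (\<ominus>\<^bsub>V\<^esub> v \<oplus>\<^bsub>V\<^esub> \<ominus>\<^bsub>V\<^esub> (?e \<odot>\<^bsub>V\<^esub> m))"
      using m v inv by (simp add: M.minus_add M.add.m_comm)
    also have "\<dots> = \<ominus>\<^bsub>V\<^esub> (?e \<odot>\<^bsub>V\<^esub> m)"
      using m v inv by (simp add: M.r_neg2)
    also have "\<dots> = (\<ominus>\<^bsub>K\<^esub> ?e) \<odot>\<^bsub>V\<^esub> m" using m inv by (simp add: smult_l_minus)
    finally show ?thesis using M_smult md inv by (metis R.a_inv_closed)
  qed
  define \<phi> where "\<phi> v = (THE c. c \<in> carrier K \<and> v \<oplus>\<^bsub>V\<^esub> c \<odot>\<^bsub>V\<^esub> a \<in> M)" for v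
  have unique: "c = c'" if "c \<in> carrier K" "c' \<in> carrier K" "v \<in> carrier V"
      "v \<oplus>\<^bsub>V\<^esub> c \<odot>\<^bsub>V\<^esub> a \<in> M" "v \<oplus>\<^bsub>V\<^esub> c' \<odot>\<^bsub>V\<^esub> a \<in> M" for c c' v
  proof -
    have "(v \<oplus>\<^bsub>V\<^esub> c \<odot>\<^bsub>V\<^esub> a) \<oplus>\<^bsub>V\<^esub> (\<ominus>\<^bsub>K\<^esub> \<one>\<^bsub>K\<^esub>) \<odot>\<^bsub>V\<^esub> (v \<oplus>\<^bsub>V\<^esub> c' \<odot>\<^bsub>V\<^esub> a) \<in> M"
      using that M_add M_smult by auto
    moreover have "(v \<oplus>\<^bsub>V\<^esub> c \<odot>\<^bsub>V\<^esub> a) \<oplus>\<^bsub>V\<^esub> (\<ominus>\<^bsub>K\<^esub> \<one>\<^bsub>K\<^esub>) \<odot>\<^bsub>V\<^esub> (v \<oplus>\<^bsub>V\<^esub> c' \<odot>\<^bsub>V\<^esub> a) =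
        (v \<oplus>\<^bsub>V\<^esub> \<ominus>\<^bsub>V\<^esub> v) \<oplus>\<^bsub>V\<^esub> (c \<odot>\<^bsub>V\<^esub> a \<oplus>\<^bsub>V\<^esub> \<ominus>\<^bsub>V\<^esub> (c' \<odot>\<^bsub>V\<^esub> a))"
      using that a by (simp add: smult_l_minus M.minus_add M.add.m_ac)
    moreover have "\<dots> = (c \<oplus>\<^bsub>K\<^esub> \<ominus>\<^bsub>K\<^esub> c') \<odot>\<^bsub>V\<^esub> a"
      using that a by (simp add: smult_l_distr smult_l_minus M.r_neg)
    ultimately have "c \<oplus>\<^bsub>K\<^esub> \<ominus>\<^bsub>K\<^esub> c' = \<zero>\<^bsub>K\<^esub>" using scaled that by auto
    then show ?thesis using that R.minus_equality[of c "\<ominus>\<^bsub>K\<^esub> c'"] by (simp add: R.minus_minus)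
  qed
  have \<phi>: "\<phi> v \<in> carrier K" "v \<oplus>\<^bsub>V\<^esub> \<phi> v \<odot>\<^bsub>V\<^esub> a \<in> M" if v: "v \<in> carrier V" for v
  proof -
    have "\<exists>!c. c \<in> carrier K \<and> v \<oplus>\<^bsub>V\<^esub> c \<odot>\<^bsub>V\<^esub> a \<in> M"
      using decomp[OF v] unique[OF _ _ v] by blast
    then have "\<phi> v \<in> carrier K \<and> v \<oplus>\<^bsub>V\<^esub> \<phi> v \<odot>\<^bsub>V\<^esub> a \<in> M"
      unfolding \<phi>_def by (rule theI')
    then show "\<phi> v \<in> carrier K" "v \<oplus>\<^bsub>V\<^esub> \<phi> v \<odot>\<^bsub>V\<^esub> a \<in> M" by auto
  qed
  have "linear_functional K V \<phi>"
    unfolding linear_functional_def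
  proof (intro conjI ballI)
    fix v w assume vw: "v \<in> carrier V" "w \<in> carrier V"
    have "(v \<oplus>\<^bsub>V\<^esub> w) \<oplus>\<^bsub>V\<^esub> (\<phi> v \<oplus>\<^bsub>K\<^esub> \<phi> w) \<odot>\<^bsub>V\<^esub> a =
        (v \<oplus>\<^bsub>V\<^esub> \<phi> v \<odot>\<^bsub>V\<^esub> a) \<oplus>\<^bsub>V\<^esub> (w \<oplus>\<^bsub>V\<^esub> \<phi> w \<odot>\<^bsub>V\<^esub> a)"
      using vw \<phi> a by (simp add: smult_l_distr M.add.m_ac)
    then have "(v \<oplus>\<^bsub>V\<^esub> w) \<oplus>\<^bsub>V\<^esub> (\<phi> v \<oplus>\<^bsub>K\<^esub> \<phi> w) \<odot>\<^bsub>V\<^esub> a \<in> M" using M_add \<phi> vw by simp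
    then show "\<phi> (v \<oplus>\<^bsub>V\<^esub> w) = \<phi> v \<oplus>\<^bsub>K\<^esub> \<phi> w"
      using vw \<phi> by (intro unique[of _ _ "v \<oplus>\<^bsub>V\<^esub> w"]) auto
  next
    fix c v assume cv: "c \<in> carrier K" "v \<in> carrier V"
    have "c \<odot>\<^bsub>V\<^esub> v \<oplus>\<^bsub>V\<^esub> (c \<otimes>\<^bsub>K\<^esub> \<phi> v) \<odot>\<^bsub>V\<^esub> a = c \<odot>\<^bsub>V\<^esub> (v \<oplus>\<^bsub>V\<^esub> \<phi> v \<odot>\<^bsub>V\<^esub> a)"
      using cv \<phi> a by (simp add: smult_r_distr smult_assoc1)
    then have "c \<odot>\<^bsub>V\<^esub> v \<oplus>\<^bsub>V\<^esub> (c \<otimes>\<^bsub>K\<^esub> \<phi> v) \<odot>\<^bsub>V\<^esub> a \<in> M" using M_smult \<phi> cv by simp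
    then show "\<phi> (c \<odot>\<^bsub>V\<^esub> v) = c \<otimes>\<^bsub>K\<^esub> \<phi> v"
      using cv \<phi> by (intro unique[of _ _ "c \<odot>\<^bsub>V\<^esub> v"]) auto
  qed (use \<phi> in auto)
  moreover have "\<phi> a \<noteq> \<zero>\<^bsub>K\<^esub>" using \<phi>(2)[OF a] a M(2) by auto
  moreover have "\<phi> v = \<zero>\<^bsub>K\<^esub>" if "v \<in> T" for v
  proof (rule unique)
    show v: "v \<in> carrier V" "v \<oplus>\<^bsub>V\<^esub> \<phi> v \<odot>\<^bsub>V\<^esub> a \<in> M" "\<phi> v \<in> carrier K"
      using that TM M_carrier \<phi> by blast+
    show "v \<oplus>\<^bsub>V\<^esub> \<zero>\<^bsub>K\<^esub> \<odot>\<^bsub>V\<^esub> a \<in> M" using that TM v a by auto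
  qed simp
  ultimately show ?thesis using that by blast
qed

lemma (in vectorspace) lin_indpt_familyI:
  assumes "finite I" "f ` I \<subseteq> carrier V" "\<And>i. i \<in> I \<Longrightarrow> f i \<notin> span (f ` (I - {i}))"
  shows "lin_indpt (f ` I)" "inj_on f I"
proof -
  show "inj_on f I"
  proof (rule inj_onI, rule ccontr)
    fix i j assume ij: "i \<in> I" "j \<in> I" "f i = f j" "i \<noteq> j"
    then have "f i \<in> f ` (I - {i})" by auto
    moreover have "f ` (I - {i}) \<subseteq> carrier V" using assms(2) by blast
    ultimately show False using in_own_span assms(3) ij by blast
  qed
  show "lin_indpt (f ` I)"
  proof
    assume "lin_dep (f ` I)"
    then obtain i where i: "i \<in> I" "f i \<in> span (f ` I - {f i})"
      using lindep_span[of "f ` I"] assms by auto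
    have "f ` I - {f i} \<subseteq> f ` (I - {i})" by blast
    then show False using i assms(3) span_is_monotone by blast
  qed
qed

lemma (in vectorspace) span_eqI:
  assumes "S \<subseteq> carrier V" "T \<subseteq> carrier V" "S \<subseteq> span T" "T \<subseteq> span S"
  shows "span S = span T"
  using assms span_span_subset by blast

text \<open>Eventually \<open>f n\<close> can be replaced by the constant \<open>d + e\<close>.\<close>

lemma limsup_add_convergent_le:
  fixes f g :: "nat \<Rightarrow> real"
  assumes "f \<longlonglongrightarrow> d"
  shows "limsup (\<lambda>n. ereal (f n + g n)) \<le> ereal d + limsup (\<lambda>n. ereal (g n))"
proof (rule ereal_le_epsilon2)
  fix e :: real assume "0 < e"
  then have "\<forall>\<^sub>F n in sequentially. f n < d + e"
    using order_tendstoD(2)[OF assms, of "d + e"] by simp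
  then have "limsup (\<lambda>n. ereal (f n + g n)) \<le> limsup (\<lambda>n. ereal (d + e) + ereal (g n))"
    by (intro Limsup_mono) (auto elim: eventually_mono)
  also have "\<dots> = ereal (d + e) + limsup (\<lambda>n. ereal (g n))"
    by (rule Limsup_add_ereal_left) auto
  finally show "limsup (\<lambda>n. ereal (f n + g n)) \<le> ereal d + limsup (\<lambda>n. ereal (g n)) + ereal e"
    by (simp add: ac_simps flip: plus_ereal.simps(1))
qed

lemma limsup_add_convergent:
  fixes f g :: "nat \<Rightarrow> real"
  assumes "f \<longlonglongrightarrow> d"
  shows "limsup (\<lambda>n. ereal (f n + g n)) = ereal d + limsup (\<lambda>n. ereal (g n))"
proof (rule antisym)
  \<comment> \<open>The other inequality is the previous lemma for \<open>- f\<close> and \<open>f + g\<close>.\<close>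
  have "limsup (\<lambda>n. ereal (g n)) \<le> ereal (- d) + limsup (\<lambda>n. ereal (f n + g n))"
    using limsup_add_convergent_le[of "\<lambda>n. - f n" "- d" "\<lambda>n. f n + g n"] tendsto_minus[OF assms] by simp
  then show "ereal d + limsup (\<lambda>n. ereal (g n)) \<le> limsup (\<lambda>n. ereal (f n + g n))"
    by (cases "limsup (\<lambda>n. ereal (g n))"; cases "limsup (\<lambda>n. ereal (f n + g n))") auto
qed (rule limsup_add_convergent_le[OF assms])

text \<open>
  A presentation of \<open>C\<close> as the tensor product of \<open>K\<close> and \<open>A\<close> over \<open>F\<close> that does not construct one:
  \<open>\<beta>\<close> is the pairing, and the last assumption asks that each functional on \<open>K\<close> induces a
  contraction of \<open>C\<close> to \<open>A\<close>, which is what makes the pairing injective.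
\<close>

locale tensor_product_algebra = K: unital_algebra F K + A: unital_algebra F A + C: unital_algebra F C
  for F :: "('f, 'm) ring_scheme" and K :: "('f, 'k, 'n) module_scheme"
    and A :: "('f, 'a, 'p) module_scheme" and C :: "('f, 'c, 'q) module_scheme" +
  fixes \<beta> :: "'k \<Rightarrow> 'a \<Rightarrow> 'c"
  assumes \<beta>_closed: "\<lbrakk>a \<in> carrier K; u \<in> carrier A\<rbrakk> \<Longrightarrow> \<beta> a u \<in> carrier C"
    and \<beta>_add_left: "\<lbrakk>a \<in> carrier K; b \<in> carrier K; u \<in> carrier A\<rbrakk> \<Longrightarrow> \<beta> (a \<oplus>\<^bsub>K\<^esub> b) u = \<beta> a u \<oplus>\<^bsub>C\<^esub> \<beta> b u"
    and \<beta>_add_right: "\<lbrakk>a \<in> carrier K; u \<in> carrier A; v \<in> carrier A\<rbrakk> \<Longrightarrow> \<beta> a (u \<oplus>\<^bsub>A\<^esub> v) = \<beta> a u \<oplus>\<^bsub>C\<^esub> \<beta> a v"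
    and \<beta>_smult_left: "\<lbrakk>c \<in> carrier F; a \<in> carrier K; u \<in> carrier A\<rbrakk> \<Longrightarrow> \<beta> (c \<odot>\<^bsub>K\<^esub> a) u = c \<odot>\<^bsub>C\<^esub> \<beta> a u"
    and \<beta>_smult_right: "\<lbrakk>c \<in> carrier F; a \<in> carrier K; u \<in> carrier A\<rbrakk> \<Longrightarrow> \<beta> a (c \<odot>\<^bsub>A\<^esub> u) = c \<odot>\<^bsub>C\<^esub> \<beta> a u"
    and \<beta>_mult: "\<lbrakk>a \<in> carrier K; b \<in> carrier K; u \<in> carrier A; v \<in> carrier A\<rbrakk> \<Longrightarrow>
      \<beta> (a \<otimes>\<^bsub>K\<^esub> b) (u \<otimes>\<^bsub>A\<^esub> v) = \<beta> a u \<otimes>\<^bsub>C\<^esub> \<beta> b v"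
    and \<beta>_one: "\<beta> \<one>\<^bsub>K\<^esub> \<one>\<^bsub>A\<^esub> = \<one>\<^bsub>C\<^esub>"
    and \<beta>_generates: "generates_algebra F C {\<beta> a u | a u. a \<in> carrier K \<and> u \<in> carrier A}"
    and contraction: "linear_functional F K \<phi> \<Longrightarrow> \<exists>\<tau>.
      (\<forall>x\<in>carrier C. \<tau> x \<in> carrier A) \<and>
      (\<forall>x\<in>carrier C. \<forall>y\<in>carrier C. \<tau> (x \<oplus>\<^bsub>C\<^esub> y) = \<tau> x \<oplus>\<^bsub>A\<^esub> \<tau> y) \<and>
      (\<forall>c\<in>carrier F. \<forall>x\<in>carrier C. \<tau> (c \<odot>\<^bsub>C\<^esub> x) = c \<odot>\<^bsub>A\<^esub> \<tau> x) \<and>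
      (\<forall>a\<in>carrier K. \<forall>u\<in>carrier A. \<tau> (\<beta> a u) = \<phi> a \<odot>\<^bsub>A\<^esub> u)"
begin

abbreviation pairs :: "'k set \<Rightarrow> 'a set \<Rightarrow> 'c set" where
  "pairs S T \<equiv> (\<lambda>(a, u). \<beta> a u) ` (S \<times> T)"

lemma pairs_closed: "\<lbrakk>S \<subseteq> carrier K; T \<subseteq> carrier A\<rbrakk> \<Longrightarrow> pairs S T \<subseteq> carrier C"
  using \<beta>_closed by auto

lemma \<beta>_zero_left: "u \<in> carrier A \<Longrightarrow> \<beta> \<zero>\<^bsub>K\<^esub> u = \<zero>\<^bsub>C\<^esub>"
  using \<beta>_smult_left[of "\<zero>\<^bsub>F\<^esub>" "\<zero>\<^bsub>K\<^esub>" u] \<beta>_closed[of "\<zero>\<^bsub>K\<^esub>" u] by simp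

lemma \<beta>_zero_right: "a \<in> carrier K \<Longrightarrow> \<beta> a \<zero>\<^bsub>A\<^esub> = \<zero>\<^bsub>C\<^esub>"
  using \<beta>_smult_right[of "\<zero>\<^bsub>F\<^esub>" a "\<zero>\<^bsub>A\<^esub>"] \<beta>_closed[of a "\<zero>\<^bsub>A\<^esub>"] by simp

lemma \<beta>_in_span_pairs:
  assumes S: "S \<subseteq> carrier K" and T: "T \<subseteq> carrier A" and a: "a \<in> K.span S" and u: "u \<in> A.span T"
  shows "\<beta> a u \<in> C.span (pairs S T)"
proof -
  have cl: "K.span S \<subseteq> carrier K" "A.span T \<subseteq> carrier A" and P: "pairs S T \<subseteq> carrier C"
    using S T K.span_is_subset2 A.span_is_subset2 pairs_closed by auto
  have 1: "\<beta> s u \<in> C.span (pairs S T)" if s: "s \<in> S" for s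
    using T u
  proof (induction rule: A.span_induct)
    case zero
    then show ?case using \<beta>_zero_right s S C.span_zero by auto
  next
    case (add_smult c t y)
    have *: "s \<in> carrier K" "t \<in> carrier A" "y \<in> carrier A" using add_smult s S T cl by blast+
    have "\<beta> s t \<in> C.span (pairs S T)" using s add_smult(2) C.in_own_span[OF P] by blast
    then show ?case using * add_smult C.span_add1[OF P] C.span_smult[OF P]
      by (simp add: \<beta>_add_right \<beta>_smult_right)
  qed
  show ?thesis using S a
  proof (induction rule: K.span_induct)
    case zero
    then show ?case using \<beta>_zero_left u cl C.span_zero by auto
  next
    case (add_smult c t y)
    have *: "u \<in> carrier A" "t \<in> carrier K" "y \<in> carrier K" using add_smult u S T cl by blast+
    show ?case using * 1[OF add_smult(2)] add_smult C.span_add1[OF P] C.span_smult[OF P]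
      by (simp add: \<beta>_add_left \<beta>_smult_left)
  qed
qed

text \<open>Contracting with a functional that vanishes on all members of \<open>B\<close> but one isolates the terms
  that contain this member.\<close>

lemma pairs_lin_indpt:
  assumes B: "finite B" "B \<subseteq> carrier K" "K.lin_indpt B"
    and D: "finite D" "D \<subseteq> carrier A" "A.lin_indpt D"
  shows "C.lin_indpt (pairs B D)" "inj_on (\<lambda>(a, u). \<beta> a u) (B \<times> D)"
proof -
  have new: "(\<lambda>(a, u). \<beta> a u) i \<notin> C.span ((\<lambda>(a, u). \<beta> a u) ` (B \<times> D - {i}))" if i: "i \<in> B \<times> D" for i
  proof
    assume in_span: "(\<lambda>(a, u). \<beta> a u) i \<in> C.span ((\<lambda>(a, u). \<beta> a u) ` (B \<times> D - {i}))"
    obtain a u where au: "i = (a, u)" "a \<in> B" "u \<in> D" using i by auto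
    have car: "a \<in> carrier K" "u \<in> carrier A" using au B D by auto
    have sub: "B - {a} \<subseteq> carrier K" "D - {u} \<subseteq> carrier A" using B D by auto
    have "a \<notin> K.span (B - {a})" using K.lindep_span[of B] B au by auto
    then obtain \<phi> where \<phi>: "linear_functional F K \<phi>" "\<And>v. v \<in> K.span (B - {a}) \<Longrightarrow> \<phi> v = \<zero>\<^bsub>F\<^esub>" "\<phi> a \<noteq> \<zero>\<^bsub>F\<^esub>"
      using K.functional_separating[OF K.span_is_submodule[OF sub(1)] _ car(1)] by blast
    obtain \<tau> where \<tau>: "\<And>x. x \<in> carrier C \<Longrightarrow> \<tau> x \<in> carrier A"
        "\<And>x y. \<lbrakk>x \<in> carrier C; y \<in> carrier C\<rbrakk> \<Longrightarrow> \<tau> (x \<oplus>\<^bsub>C\<^esub> y) = \<tau> x \<oplus>\<^bsub>A\<^esub> \<tau> y"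
        "\<And>c x. \<lbrakk>c \<in> carrier F; x \<in> carrier C\<rbrakk> \<Longrightarrow> \<tau> (c \<odot>\<^bsub>C\<^esub> x) = c \<odot>\<^bsub>A\<^esub> \<tau> x"
        "\<And>a u. \<lbrakk>a \<in> carrier K; u \<in> carrier A\<rbrakk> \<Longrightarrow> \<tau> (\<beta> a u) = \<phi> a \<odot>\<^bsub>A\<^esub> u"
      using contraction[OF \<phi>(1)] by blast
    have \<phi>_closed: "\<phi> v \<in> carrier F" if "v \<in> carrier K" for v
      using \<phi>(1) that unfolding linear_functional_def by blast
    have P: "(\<lambda>(a, u). \<beta> a u) ` (B \<times> D - {i}) \<subseteq> carrier C" using \<beta>_closed B D by auto
    have "\<tau> x \<in> A.span (D - {u})" if "x \<in> C.span ((\<lambda>(a, u). \<beta> a u) ` (B \<times> D - {i}))" for x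
      using P that
    proof (induction rule: C.span_induct)
      case zero
      have "\<tau> (\<zero>\<^bsub>F\<^esub> \<odot>\<^bsub>C\<^esub> \<zero>\<^bsub>C\<^esub>) = \<zero>\<^bsub>F\<^esub> \<odot>\<^bsub>A\<^esub> \<tau> \<zero>\<^bsub>C\<^esub>" by (rule \<tau>(3)) auto
      then show ?case using \<tau>(1)[of "\<zero>\<^bsub>C\<^esub>"] A.span_zero by simp
    next
      case (add_smult c t y)
      then obtain b v where t: "t = \<beta> b v" "b \<in> B" "v \<in> D" "(b, v) \<noteq> i" by auto
      have bv: "b \<in> carrier K" "v \<in> carrier A" using t B D by auto
      have y: "y \<in> carrier C" using add_smult(3) C.span_is_subset2[OF P] by blast
      have "\<phi> b \<odot>\<^bsub>A\<^esub> v \<in> A.span (D - {u})"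
      proof (cases "b = a")
        case True
        then have "v \<in> D - {u}" using t au by auto
        then have "v \<in> A.span (D - {u})" using A.in_own_span[OF sub(2)] by blast
        then show ?thesis using A.span_smult[OF sub(2)] \<phi>_closed bv by blast
      next
        case False
        then have "b \<in> K.span (B - {a})" using t K.in_own_span[OF sub(1)] by blast
        then show ?thesis using \<phi>(2) bv A.span_zero by simp
      qed
      then have "c \<odot>\<^bsub>A\<^esub> (\<phi> b \<odot>\<^bsub>A\<^esub> v) \<oplus>\<^bsub>A\<^esub> \<tau> y \<in> A.span (D - {u})"
        using add_smult A.span_add1[OF sub(2)] A.span_smult[OF sub(2)] by blast
      then show ?case using add_smult(1) bv y \<beta>_closed by (simp add: \<tau> t)
    qed
    from this[OF in_span] have "\<phi> a \<odot>\<^bsub>A\<^esub> u \<in> A.span (D - {u})" using \<tau>(4) car au by simp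
    moreover have "inv\<^bsub>F\<^esub> (\<phi> a) \<in> carrier F"
      using \<phi>(3) \<phi>_closed[OF car(1)] by (simp add: K.field_Units)
    ultimately have "inv\<^bsub>F\<^esub> (\<phi> a) \<odot>\<^bsub>A\<^esub> (\<phi> a \<odot>\<^bsub>A\<^esub> u) \<in> A.span (D - {u})"
      using A.span_smult[OF sub(2)] by simp
    then have "u \<in> A.span (D - {u})"
      using A.mult_inverse[OF \<phi>_closed[OF car(1)] car(2) refl \<phi>(3)] by simp
    then show False using A.lindep_span[of D] D au by auto
  qed
  have fin: "finite (B \<times> D)" using B D by simp
  have car: "pairs B D \<subseteq> carrier C" using pairs_closed B D by blast
  show "C.lin_indpt (pairs B D)" "inj_on (\<lambda>(a, u). \<beta> a u) (B \<times> D)"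
    using C.lin_indpt_familyI[OF fin car new] by blast+
qed

text \<open>The pairs of members of two bases form a basis.\<close>

lemma dim_span_pairs:
  assumes S: "finite S" "S \<subseteq> carrier K" and T: "finite T" "T \<subseteq> carrier A"
  shows "vectorspace.dim F (C\<lparr>carrier := C.span (pairs S T)\<rparr>) =
    vectorspace.dim F (K\<lparr>carrier := K.span S\<rparr>) * vectorspace.dim F (A\<lparr>carrier := A.span T\<rparr>)"
proof -
  obtain B where B: "B \<subseteq> S" "K.lin_indpt B" "K.span B = K.span S" using K.finite_basis_of_span[OF S] .
  obtain D where D: "D \<subseteq> T" "A.lin_indpt D" "A.span D = A.span T" using A.finite_basis_of_span[OF T] .
  have fin: "finite B" "finite D" using B D S T finite_subset by blast+
  have car: "B \<subseteq> carrier K" "D \<subseteq> carrier A" using B D S T by blast+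
  note li = pairs_lin_indpt[OF fin(1) car(1) B(2) fin(2) car(2) D(2)]
  have "C.span (pairs S T) = C.span (pairs B D)"
  proof (rule C.span_eqI)
    show "pairs S T \<subseteq> C.span (pairs B D)"
    proof clarify
      fix a u assume "a \<in> S" "u \<in> T"
      then have "a \<in> K.span B" "u \<in> A.span D"
        using B(3) D(3) K.in_own_span[OF S(2)] A.in_own_span[OF T(2)] by blast+
      then show "\<beta> a u \<in> C.span (pairs B D)" by (rule \<beta>_in_span_pairs[OF car])
    qed
    have "pairs B D \<subseteq> pairs S T" using B D by blast
    then show "pairs B D \<subseteq> C.span (pairs S T)" using C.in_own_span[OF pairs_closed[OF S(2) T(2)]] by blast
  qed (use pairs_closed S T car in blast)+
  also have "vectorspace.dim F (C\<lparr>carrier := \<dots>\<rparr>) = card (B \<times> D)"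
    using C.dim_span_lin_indpt[OF _ pairs_closed[OF car] li(1)] fin card_image[OF li(2)] by simp
  finally show ?thesis
    using K.dim_span_lin_indpt[OF fin(1) car(1) B(2)] A.dim_span_lin_indpt[OF fin(2) car(2) D(2)] B(3) D(3)
    by (simp add: card_cartesian_product)
qed

lemma fold_products_pairs:
  assumes S: "S \<subseteq> carrier K" and T: "T \<subseteq> carrier A"
  shows "fold_products C (pairs S T) n = pairs (fold_products K S n) (fold_products A T n)"
proof (induction n)
  case 0
  then show ?case by (simp add: \<beta>_one)
next
  case (Suc n)
  have m: "\<beta> s t \<otimes>\<^bsub>C\<^esub> \<beta> p q = \<beta> (s \<otimes>\<^bsub>K\<^esub> p) (t \<otimes>\<^bsub>A\<^esub> q)"
    if "s \<in> S" "t \<in> T" "p \<in> fold_products K S n" "q \<in> fold_products A T n" for s t p q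
  proof -
    have "s \<in> carrier K" "t \<in> carrier A" "p \<in> carrier K" "q \<in> carrier A"
      using that S T K.fold_products_closed A.fold_products_closed by blast+
    then show ?thesis using \<beta>_mult by simp
  qed
  show ?case unfolding fold_products_Suc Suc
  proof (intro subset_antisym subsetI)
    fix x assume "x \<in> (\<lambda>(s, p). s \<otimes>\<^bsub>C\<^esub> p) ` (pairs S T \<times> pairs (fold_products K S n) (fold_products A T n))"
    then obtain s t p q where x: "x = \<beta> s t \<otimes>\<^bsub>C\<^esub> \<beta> p q"
      and *: "s \<in> S" "t \<in> T" "p \<in> fold_products K S n" "q \<in> fold_products A T n" by auto
    show "x \<in> pairs ((\<lambda>(s, p). s \<otimes>\<^bsub>K\<^esub> p) ` (S \<times> fold_products K S n)) ((\<lambda>(s, p). s \<otimes>\<^bsub>A\<^esub> p) ` (T \<times> fold_products A T n))"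
      unfolding x m[OF *] using * by blast
  next
    fix x assume "x \<in> pairs ((\<lambda>(s, p). s \<otimes>\<^bsub>K\<^esub> p) ` (S \<times> fold_products K S n)) ((\<lambda>(s, p). s \<otimes>\<^bsub>A\<^esub> p) ` (T \<times> fold_products A T n))"
    then obtain s t p q where x: "x = \<beta> (s \<otimes>\<^bsub>K\<^esub> p) (t \<otimes>\<^bsub>A\<^esub> q)"
      and *: "s \<in> S" "t \<in> T" "p \<in> fold_products K S n" "q \<in> fold_products A T n" by auto
    show "x \<in> (\<lambda>(s, p). s \<otimes>\<^bsub>C\<^esub> p) ` (pairs S T \<times> pairs (fold_products K S n) (fold_products A T n))"
      unfolding x m[OF *, symmetric] using * by blast
  qed
qed

lemma power_dim_pairs:
  assumes S: "finite S" "S \<subseteq> carrier K" and T: "finite T" "T \<subseteq> carrier A"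
  shows "power_dim F C (pairs S T) n = power_dim F K S n * power_dim F A T n"
  unfolding fold_products_pairs[OF S(2) T(2)]
  using S T by (intro dim_span_pairs finite_fold_products K.fold_products_closed A.fold_products_closed)

text \<open>Both factors are mapped to \<open>C\<close> by pairing with \<open>1\<close>, and \<open>\<beta> a u\<close> is the product of \<open>\<beta> a 1\<close> and \<open>\<beta> 1 u\<close>.\<close>

lemma generates_pairs:
  assumes S: "generates_algebra F K S" "\<one>\<^bsub>K\<^esub> \<in> S" and T: "generates_algebra F A T" "\<one>\<^bsub>A\<^esub> \<in> T"
  shows "generates_algebra F C (pairs S T)"
  unfolding generates_algebra_def
proof (intro conjI allI impI)
  have car: "S \<subseteq> carrier K" "T \<subseteq> carrier A" using S T unfolding generates_algebra_def by auto
  then show "pairs S T \<subseteq> carrier C" by (rule pairs_closed)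
  fix B assume B: "subspace F B C \<and> subring B C \<and> pairs S T \<subseteq> B"
  have sub: "submodule F B C" and ring: "subring B C" using B unfolding subspace_def by auto
  have B_one: "\<one>\<^bsub>C\<^esub> \<in> B" using subringE(3)[OF ring] .
  have B_add: "x \<oplus>\<^bsub>C\<^esub> y \<in> B" if "x \<in> B" "y \<in> B" for x y
    using submodule.m_closed[OF sub that] .
  have B_mult: "x \<otimes>\<^bsub>C\<^esub> y \<in> B" if "x \<in> B" "y \<in> B" for x y
    using subringE(6)[OF ring that] .
  have B_smult: "c \<odot>\<^bsub>C\<^esub> x \<in> B" if "c \<in> carrier F" "x \<in> B" for c x
    using submodule.smult_closed[OF sub that] .
  have left: "\<beta> a \<one>\<^bsub>A\<^esub> \<in> B" if "a \<in> carrier K" for a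
    using S(1) that
  proof (induction rule: K.generated_induct)
    case (generator s)
    then show ?case using B T(2) by auto
  next
    case (mult a b)
    then show ?case using B_mult \<beta>_mult[of a b "\<one>\<^bsub>A\<^esub>" "\<one>\<^bsub>A\<^esub>"] by simp
  qed (simp_all add: \<beta>_one \<beta>_add_left \<beta>_smult_left B_one B_add B_smult)
  have right: "\<beta> \<one>\<^bsub>K\<^esub> u \<in> B" if "u \<in> carrier A" for u
    using T(1) that
  proof (induction rule: A.generated_induct)
    case (generator s)
    then show ?case using B S(2) by auto
  next
    case (mult u v)
    then show ?case using B_mult \<beta>_mult[of "\<one>\<^bsub>K\<^esub>" "\<one>\<^bsub>K\<^esub>" u v] by simp
  qed (simp_all add: \<beta>_one \<beta>_add_right \<beta>_smult_right B_one B_add B_smult)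
  have "\<beta> a u \<in> B" if au: "a \<in> carrier K" "u \<in> carrier A" for a u
    using B_mult[OF left[OF au(1)] right[OF au(2)]] \<beta>_mult[of a "\<one>\<^bsub>K\<^esub>" "\<one>\<^bsub>A\<^esub>" u] au by simp
  then show "B = carrier C" using \<beta>_generates B unfolding generates_algebra_def by blast
qed

lemma tensor_nonzero:
  assumes "\<one>\<^bsub>K\<^esub> \<noteq> \<zero>\<^bsub>K\<^esub>" "\<one>\<^bsub>A\<^esub> \<noteq> \<zero>\<^bsub>A\<^esub>"
  shows "\<one>\<^bsub>C\<^esub> \<noteq> \<zero>\<^bsub>C\<^esub>"
proof -
  have "K.lin_indpt {\<one>\<^bsub>K\<^esub>}" "A.lin_indpt {\<one>\<^bsub>A\<^esub>}"
    using K.lindep_span[of "{\<one>\<^bsub>K\<^esub>}"] A.lindep_span[of "{\<one>\<^bsub>A\<^esub>}"] assms by (auto simp: K.span_empty A.span_empty)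
  then have "C.lin_indpt {\<one>\<^bsub>C\<^esub>}" using pairs_lin_indpt(1)[of "{\<one>\<^bsub>K\<^esub>}" "{\<one>\<^bsub>A\<^esub>}"] by (simp add: \<beta>_one)
  then show ?thesis using C.vs_zero_lin_dep[of "{\<one>\<^bsub>C\<^esub>}"] by auto
qed

text \<open>
  The limit superior is additive here because the growth of \<open>K\<close> has a limit; for arbitrary factors
  only an inequality would remain.
\<close>

theorem GKdim_tensor_product:
  assumes nz: "\<one>\<^bsub>K\<^esub> \<noteq> \<zero>\<^bsub>K\<^esub>" "\<one>\<^bsub>A\<^esub> \<noteq> \<zero>\<^bsub>A\<^esub>"
    and S: "finite S" "\<one>\<^bsub>K\<^esub> \<in> S" "generates_algebra F K S"
    and T: "finite T" "\<one>\<^bsub>A\<^esub> \<in> T" "generates_algebra F A T"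
    and lim: "(\<lambda>n. ln (real (power_dim F K S n)) / ln (real n)) \<longlonglongrightarrow> d"
  shows "GKdim F C = GKdim F A + GKdim F K"
proof -
  have car: "S \<subseteq> carrier K" "T \<subseteq> carrier A" using S T unfolding generates_algebra_def by auto
  let ?k = "\<lambda>n. ln (real (power_dim F K S n)) / ln (real n)"
  let ?a = "\<lambda>n. ln (real (power_dim F A T n)) / ln (real n)"
  have K: "GKdim F K = limsup (\<lambda>n. ereal (?k n))"
    by (rule K.GKdim_eq_power_growth[OF nz(1) S(1) car(1) S(2,3)])
  have k_lim: "(\<lambda>n. ereal (?k n)) \<longlonglongrightarrow> ereal d" using lim by simp
  have K': "GKdim F K = ereal d" unfolding K using k_lim by (rule lim_imp_Limsup[OF sequentially_bot])
  have A: "GKdim F A = limsup (\<lambda>n. ereal (?a n))"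
    by (rule A.GKdim_eq_power_growth[OF nz(2) T(1) car(2) T(2,3)])
  have "\<one>\<^bsub>C\<^esub> \<in> pairs S T" using S(2) T(2) \<beta>_one by force
  then have "GKdim F C = limsup (\<lambda>n. ereal (ln (real (power_dim F C (pairs S T) n)) / ln (real n)))"
    using S T car by (intro C.GKdim_eq_power_growth tensor_nonzero nz pairs_closed generates_pairs) auto
  also have "(\<lambda>n. ereal (ln (real (power_dim F C (pairs S T) n)) / ln (real n))) =
      (\<lambda>n. ereal (?k n + ?a n))"
  proof
    fix n
    have "0 < power_dim F K S n" "0 < power_dim F A T n"
      using K.power_dim_pos[OF nz(1) S(1) car(1) S(2)] A.power_dim_pos[OF nz(2) T(1) car(2) T(2)] by auto
    then show "ereal (ln (real (power_dim F C (pairs S T) n)) / ln (real n)) = ereal (?k n + ?a n)"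
      unfolding power_dim_pairs[OF S(1) car(1) T(1) car(2)]
      by (simp add: ln_mult add_divide_distrib)
  qed
  also have "limsup \<dots> = ereal d + limsup (\<lambda>n. ereal (?a n))"
    by (rule limsup_add_convergent[OF lim])
  finally show ?thesis unfolding A K' by (simp add: add.commute)
qed

end

section \<open>The free algebra\<close>

text \<open>The multiplication of the free algebra, which does not depend on the alphabet.\<close>

definition conv :: "('r, 'm) ring_scheme \<Rightarrow> ('x list \<Rightarrow> 'r) \<Rightarrow> ('x list \<Rightarrow> 'r) \<Rightarrow> 'x list \<Rightarrow> 'r" where
  "conv R p q w = (\<Oplus>\<^bsub>R\<^esub>i\<in>{..length w}. p (take i w) \<otimes>\<^bsub>R\<^esub> q (drop i w))"

definition monomial :: "('r, 'm) ring_scheme \<Rightarrow> 'r \<Rightarrow> 'x list \<Rightarrow> 'x list \<Rightarrow> 'r" where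
  "monomial R c w = (\<lambda>v. if v = w then c else \<zero>\<^bsub>R\<^esub>)"

lemma free_algebra_simps:
  "monoid.mult (free_algebra R X) = conv R"
  "one (free_algebra R X) = monomial R \<one>\<^bsub>R\<^esub> []"
  "zero (free_algebra R X) = (\<lambda>w. \<zero>\<^bsub>R\<^esub>)"
  "add (free_algebra R X) = (\<lambda>p q w. p w \<oplus>\<^bsub>R\<^esub> q w)"
  "smult (free_algebra R X) = (\<lambda>a p w. a \<otimes>\<^bsub>R\<^esub> p w)"
  by (auto simp: free_algebra_def conv_def monomial_def fun_eq_iff)

lemma free_gen_eq_monomial: "free_gen R x = monomial R \<one>\<^bsub>R\<^esub> [x]"
  by (simp add: free_gen_def monomial_def)

lemma free_algebra_carrier_iff: "p \<in> carrier (free_algebra R X) \<longleftrightarrow>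
    (\<forall>w. p w \<in> carrier R) \<and> finite {w. p w \<noteq> \<zero>\<^bsub>R\<^esub>} \<and> (\<forall>w. p w \<noteq> \<zero>\<^bsub>R\<^esub> \<longrightarrow> w \<in> lists X)"
  by (simp add: free_algebra_def)

context cring
begin

lemma conv_closed:
  assumes "\<And>w. p w \<in> carrier R" "\<And>w. q w \<in> carrier R"
  shows "conv R p q w \<in> carrier R"
  unfolding conv_def using assms by (intro finsum_closed) auto

lemma conv_Nil:
  assumes "\<And>w. p w \<in> carrier R" "\<And>w. q w \<in> carrier R"
  shows "conv R p q [] = p [] \<otimes> q []"
  unfolding conv_def using assms by simp

lemma conv_Cons:
  assumes "\<And>w. p w \<in> carrier R" "\<And>w. q w \<in> carrier R"
  shows "conv R p q (x # w) = p [] \<otimes> q (x # w) \<oplus> conv R (\<lambda>v. p (x # v)) q w"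
proof -
  have "conv R p q (x # w) =
      (\<Oplus>i\<in>{..length w}. p (x # take i w) \<otimes> q (drop i w)) \<oplus> p [] \<otimes> q (x # w)"
    unfolding conv_def length_Cons using assms by (subst finsum_Suc2) auto
  then show ?thesis
    unfolding conv_def using assms by (simp add: a_comm Pi_def)
qed

lemma conv_linear_left:
  assumes "a \<in> carrier R" "\<And>w. s w \<in> carrier R" "\<And>w. t w \<in> carrier R" "\<And>w. q w \<in> carrier R"
  shows "conv R (\<lambda>v. a \<otimes> s v \<oplus> t v) q w = a \<otimes> conv R s q w \<oplus> conv R t q w"
  using assms(2-)
proof (induction w arbitrary: s t)
  case Nil
  then show ?case using assms(1) by (simp add: conv_Nil l_distr m_assoc)
next
  case (Cons x w)
  have "conv R (\<lambda>v. a \<otimes> s v \<oplus> t v) q (x # w) =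
      (a \<otimes> s [] \<oplus> t []) \<otimes> q (x # w) \<oplus> (a \<otimes> conv R (\<lambda>v. s (x # v)) q w \<oplus> conv R (\<lambda>v. t (x # v)) q w)"
    using Cons assms(1) by (simp add: conv_Cons)
  also have "\<dots> = a \<otimes> (s [] \<otimes> q (x # w) \<oplus> conv R (\<lambda>v. s (x # v)) q w) \<oplus>
      (t [] \<otimes> q (x # w) \<oplus> conv R (\<lambda>v. t (x # v)) q w)"
    using Cons.prems assms(1) conv_closed[of "\<lambda>v. s (x # v)" q w] conv_closed[of "\<lambda>v. t (x # v)" q w]
    by (simp add: l_distr r_distr m_assoc a_ac)
  finally show ?case using Cons.prems by (simp add: conv_Cons)
qed

text \<open>Splitting off the first letter turns associativity into an induction on the word, with no
  reordering of double sums.\<close>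

lemma conv_assoc:
  assumes "\<And>w. p w \<in> carrier R" "\<And>w. q w \<in> carrier R" "\<And>w. r w \<in> carrier R"
  shows "conv R (conv R p q) r w = conv R p (conv R q r) w"
  using assms(1)
proof (induction w arbitrary: p)
  case Nil
  have cl: "conv R p q w \<in> carrier R" "conv R q r w \<in> carrier R" for w
    using Nil assms(2,3) by (auto intro: conv_closed)
  show ?case using Nil assms(2,3) cl by (simp add: conv_Nil m_assoc)
next
  case (Cons x w)
  have px: "\<And>v. p (x # v) \<in> carrier R" using Cons.prems .
  have cl: "p w \<in> carrier R" "q w \<in> carrier R" "r w \<in> carrier R" "conv R p q w \<in> carrier R"
      "conv R q r w \<in> carrier R" "conv R (\<lambda>v. p (x # v)) q w \<in> carrier R"
      "conv R (\<lambda>v. q (x # v)) r w \<in> carrier R" "conv R (\<lambda>v. p (x # v)) (conv R q r) w \<in> carrier R" for w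
    using Cons.prems assms(2,3) by (auto intro!: conv_closed)
  have "conv R (conv R p q) r (x # w) =
      p [] \<otimes> q [] \<otimes> r (x # w) \<oplus> conv R (\<lambda>v. p [] \<otimes> q (x # v) \<oplus> conv R (\<lambda>v. p (x # v)) q v) r w"
    using cl by (simp add: conv_Cons conv_Nil)
  also have "conv R (\<lambda>v. p [] \<otimes> q (x # v) \<oplus> conv R (\<lambda>v. p (x # v)) q v) r w =
      p [] \<otimes> conv R (\<lambda>v. q (x # v)) r w \<oplus> conv R (conv R (\<lambda>v. p (x # v)) q) r w"
    using cl by (intro conv_linear_left) auto
  also have "conv R (conv R (\<lambda>v. p (x # v)) q) r w = conv R (\<lambda>v. p (x # v)) (conv R q r) w"
    by (rule Cons.IH[OF px])
  also have "p [] \<otimes> q [] \<otimes> r (x # w) \<oplus> (p [] \<otimes> conv R (\<lambda>v. q (x # v)) r w \<oplus> conv R (\<lambda>v. p (x # v)) (conv R q r) w)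
      = p [] \<otimes> (q [] \<otimes> r (x # w) \<oplus> conv R (\<lambda>v. q (x # v)) r w) \<oplus> conv R (\<lambda>v. p (x # v)) (conv R q r) w"
    using cl by (simp add: r_distr m_assoc a_assoc)
  also have "\<dots> = conv R p (conv R q r) (x # w)" using cl by (simp add: conv_Cons)
  finally show ?case .
qed

lemma conv_zero_left: "(\<And>w. q w \<in> carrier R) \<Longrightarrow> conv R (\<lambda>v. \<zero>) q w = \<zero>"
  unfolding conv_def by simp

lemma conv_monomial_left:
  fixes q :: "'x list \<Rightarrow> 'a" and u w :: "'x list"
  assumes "c \<in> carrier R" "\<And>w. q w \<in> carrier R"
  shows "conv R (monomial R c u) q w = (if take (length u) w = u then c \<otimes> q (drop (length u) w) else \<zero>)"
proof (induction u arbitrary: w)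
  case Nil
  have "(\<lambda>v. monomial R c [] (x # v)) = (\<lambda>v. \<zero>)" for x :: 'x unfolding monomial_def by auto
  then show ?case using assms by (cases w) (simp_all add: conv_Nil conv_Cons conv_zero_left monomial_def)
next
  case (Cons y u)
  have cl: "monomial R c v w \<in> carrier R" for v w :: "'x list" using assms(1) unfolding monomial_def by simp
  have "(\<lambda>v. monomial R c (y # u) (x # v)) = (if x = y then monomial R c u else (\<lambda>v. \<zero>))" for x
    unfolding monomial_def by auto
  moreover have "monomial R c (y # u) [] = \<zero>" unfolding monomial_def by simp
  ultimately show ?case
    using assms cl Cons by (cases w) (simp_all add: conv_Nil conv_Cons conv_zero_left)
qed

lemma conv_one_right:
  fixes p :: "'x list \<Rightarrow> 'a"
  assumes "\<And>w. p w \<in> carrier R"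
  shows "conv R p (monomial R \<one> []) w = p w"
  using assms
proof (induction w arbitrary: p)
  case Nil
  then show ?case by (simp add: conv_Nil monomial_def)
next
  case (Cons x w)
  have "monomial R \<one> [] (x # w) = \<zero>" "\<And>v :: 'x list. monomial R \<one> [] v \<in> carrier R"
    unfolding monomial_def by auto
  then show ?case using Cons.prems Cons.IH[of "\<lambda>v. p (x # v)"] by (simp add: conv_Cons)
qed

lemma conv_add_left:
  assumes "\<And>w. s w \<in> carrier R" "\<And>w. t w \<in> carrier R" "\<And>w. q w \<in> carrier R"
  shows "conv R (\<lambda>v. s v \<oplus> t v) q w = conv R s q w \<oplus> conv R t q w"
  using conv_linear_left[of \<one> s t q w] assms conv_closed[of s q] by simp

lemma conv_add_right:
  assumes "\<And>w. s w \<in> carrier R" "\<And>w. t w \<in> carrier R" "\<And>w. q w \<in> carrier R"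
  shows "conv R q (\<lambda>v. s v \<oplus> t v) w = conv R q s w \<oplus> conv R q t w"
  unfolding conv_def using assms by (simp add: r_distr finsum_addf Pi_def)

lemma conv_support:
  assumes "\<And>w. p w \<in> carrier R" "\<And>w. q w \<in> carrier R" "conv R p q w \<noteq> \<zero>"
  obtains u v where "w = u @ v" "p u \<noteq> \<zero>" "q v \<noteq> \<zero>"
proof -
  have "\<exists>i. p (take i w) \<otimes> q (drop i w) \<noteq> \<zero>"
  proof (rule ccontr)
    assume "\<not> ?thesis"
    then have "conv R p q w = \<zero>" unfolding conv_def by (intro add.finprod_one_eqI) simp
    then show False using assms by simp
  qed
  then obtain i where "p (take i w) \<otimes> q (drop i w) \<noteq> \<zero>" by blast
  then have "p (take i w) \<noteq> \<zero>" "q (drop i w) \<noteq> \<zero>" using assms by auto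
  then show ?thesis using that[of "take i w" "drop i w"] by simp
qed

lemma free_algebra_ring: "ring (free_algebra R X)"
proof (rule ringI)
  note free_algebra_simps [simp]
  let ?A = "free_algebra R X"
  have cl: "p w \<in> carrier R" if "p \<in> carrier ?A" for p w
    using that by (simp add: free_algebra_carrier_iff)
  show "abelian_group ?A"
  proof (rule abelian_groupI)
    fix p q assume p: "p \<in> carrier ?A" and q: "q \<in> carrier ?A"
    have "{w. p w \<oplus> q w \<noteq> \<zero>} \<subseteq> {w. p w \<noteq> \<zero>} \<union> {w. q w \<noteq> \<zero>}" by auto
    then have "finite {w. p w \<oplus> q w \<noteq> \<zero>}"
      by (rule finite_subset) (use p q in \<open>auto simp: free_algebra_carrier_iff\<close>)
    moreover have "w \<in> lists X" if "p w \<oplus> q w \<noteq> \<zero>" for w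
      using that p q unfolding free_algebra_carrier_iff by (metis r_zero zero_closed)
    ultimately show "p \<oplus>\<^bsub>?A\<^esub> q \<in> carrier ?A"
      using p q by (simp add: free_algebra_carrier_iff)
    show "p \<oplus>\<^bsub>?A\<^esub> q = q \<oplus>\<^bsub>?A\<^esub> p" using cl p q by (auto simp: a_comm)
  next
    fix p assume p: "p \<in> carrier ?A"
    have "(\<lambda>w. \<ominus> p w) \<in> carrier ?A"
    proof -
      have "{w. \<ominus> p w \<noteq> \<zero>} \<subseteq> {w. p w \<noteq> \<zero>}" by auto
      then have "finite {w. \<ominus> p w \<noteq> \<zero>}"
        by (rule finite_subset) (use p in \<open>auto simp: free_algebra_carrier_iff\<close>)
      moreover have "w \<in> lists X" if "\<ominus> p w \<noteq> \<zero>" for w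
        using that p unfolding free_algebra_carrier_iff by (metis minus_zero)
      ultimately show ?thesis using p by (simp add: free_algebra_carrier_iff)
    qed
    moreover have "(\<lambda>w. \<ominus> p w) \<oplus>\<^bsub>?A\<^esub> p = \<zero>\<^bsub>?A\<^esub>" using cl p by (auto simp: l_neg)
    ultimately show "\<exists>q\<in>carrier ?A. q \<oplus>\<^bsub>?A\<^esub> p = \<zero>\<^bsub>?A\<^esub>" by blast
  qed (use cl in \<open>auto simp: a_assoc free_algebra_carrier_iff\<close>)
  show "monoid ?A"
  proof (rule monoidI)
    fix p q assume p: "p \<in> carrier ?A" and q: "q \<in> carrier ?A"
    have "{w. conv R p q w \<noteq> \<zero>} \<subseteq> (\<lambda>(u, v). u @ v) ` ({w. p w \<noteq> \<zero>} \<times> {w. q w \<noteq> \<zero>})"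
    proof
      fix w assume "w \<in> {w. conv R p q w \<noteq> \<zero>}"
      then obtain u v where "w = u @ v" "p u \<noteq> \<zero>" "q v \<noteq> \<zero>"
        using conv_support[of p q w] cl[OF p] cl[OF q] by auto
      then show "w \<in> (\<lambda>(u, v). u @ v) ` ({w. p w \<noteq> \<zero>} \<times> {w. q w \<noteq> \<zero>})" by auto
    qed
    then have "finite {w. conv R p q w \<noteq> \<zero>}"
      by (rule finite_subset) (use p q in \<open>auto simp: free_algebra_carrier_iff\<close>)
    moreover have "w \<in> lists X" if w: "conv R p q w \<noteq> \<zero>" for w
    proof -
      obtain u v where "w = u @ v" "p u \<noteq> \<zero>" "q v \<noteq> \<zero>"
        using conv_support[of p q w] cl[OF p] cl[OF q] w by auto
      then show ?thesis using p q by (auto simp: free_algebra_carrier_iff)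
    qed
    ultimately show "p \<otimes>\<^bsub>?A\<^esub> q \<in> carrier ?A"
      using conv_closed[of p q] cl[OF p] cl[OF q] by (simp add: free_algebra_carrier_iff)
  next
    show "\<one>\<^bsub>?A\<^esub> \<in> carrier ?A" by (auto simp: free_algebra_carrier_iff monomial_def)
  next
    fix p q r assume "p \<in> carrier ?A" "q \<in> carrier ?A" "r \<in> carrier ?A"
    then show "p \<otimes>\<^bsub>?A\<^esub> q \<otimes>\<^bsub>?A\<^esub> r = p \<otimes>\<^bsub>?A\<^esub> (q \<otimes>\<^bsub>?A\<^esub> r)"
      using cl by (simp add: fun_eq_iff conv_assoc)
  next
    fix p assume p: "p \<in> carrier ?A"
    show "\<one>\<^bsub>?A\<^esub> \<otimes>\<^bsub>?A\<^esub> p = p" "p \<otimes>\<^bsub>?A\<^esub> \<one>\<^bsub>?A\<^esub> = p"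
      using cl[OF p] by (simp_all add: fun_eq_iff conv_monomial_left conv_one_right)
  qed
  fix p q r assume *: "p \<in> carrier ?A" "q \<in> carrier ?A" "r \<in> carrier ?A"
  show "(p \<oplus>\<^bsub>?A\<^esub> q) \<otimes>\<^bsub>?A\<^esub> r = p \<otimes>\<^bsub>?A\<^esub> r \<oplus>\<^bsub>?A\<^esub> q \<otimes>\<^bsub>?A\<^esub> r"
    "r \<otimes>\<^bsub>?A\<^esub> (p \<oplus>\<^bsub>?A\<^esub> q) = r \<otimes>\<^bsub>?A\<^esub> p \<oplus>\<^bsub>?A\<^esub> r \<otimes>\<^bsub>?A\<^esub> q"
    using cl * by (simp_all add: fun_eq_iff conv_add_left conv_add_right)
qed

lemma monomial_closed: "\<lbrakk>c \<in> carrier R; w \<in> lists X\<rbrakk> \<Longrightarrow> monomial R c w \<in> carrier (free_algebra R X)"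
  by (auto simp: free_algebra_carrier_iff monomial_def)

lemma monomial_mult:
  assumes "c \<in> carrier R" "d \<in> carrier R"
  shows "conv R (monomial R c u) (monomial R d v) = monomial R (c \<otimes> d) (u @ v)"
proof
  fix w
  have "take (length u) w = u \<and> drop (length u) w = v \<longleftrightarrow> w = u @ v"
    by (metis append_eq_conv_conj append_take_drop_id)
  moreover have "monomial R d v w \<in> carrier R" for w using assms unfolding monomial_def by simp
  ultimately show "conv R (monomial R c u) (monomial R d v) w = monomial R (c \<otimes> d) (u @ v) w"
    using assms by (auto simp: conv_monomial_left) (auto simp: monomial_def)
qed

lemma free_algebra_induct [consumes 1, case_names zero monomial add]:
  assumes "p \<in> carrier (free_algebra R X)"
    and zero: "P (\<lambda>w. \<zero>)"
    and mono: "\<And>c w. \<lbrakk>c \<in> carrier R; w \<in> lists X\<rbrakk> \<Longrightarrow> P (monomial R c w)"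
    and add: "\<And>p q. \<lbrakk>p \<in> carrier (free_algebra R X); q \<in> carrier (free_algebra R X); P p; P q\<rbrakk> \<Longrightarrow>
      P (\<lambda>w. p w \<oplus> q w)"
  shows "P p"
proof -
  have "finite {w. p w \<noteq> \<zero>}" using assms(1) by (simp add: free_algebra_carrier_iff)
  then show ?thesis using assms(1)
  proof (induction "{w. p w \<noteq> \<zero>}" arbitrary: p rule: finite_induct)
    case empty
    then have "p = (\<lambda>w. \<zero>)" by auto
    then show ?case using zero by simp
  next
    case (insert u S)
    let ?q = "p(u := \<zero>)"
    have S: "S = {w. ?q w \<noteq> \<zero>}" using insert.hyps by auto
    have q: "?q \<in> carrier (free_algebra R X)"
      using insert.prems insert.hyps(1) S by (auto simp: free_algebra_carrier_iff)
    have u: "p u \<in> carrier R" "u \<in> lists X"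
      using insert.prems insert.hyps(4) unfolding free_algebra_carrier_iff by blast+
    have "p = (\<lambda>w. monomial R (p u) u w \<oplus> ?q w)"
      using insert.prems by (auto simp: fun_eq_iff monomial_def free_algebra_carrier_iff)
    moreover have "P (\<lambda>w. monomial R (p u) u w \<oplus> ?q w)"
      by (rule add[OF monomial_closed[OF u] q mono[OF u] insert.hyps(3)[OF S q]])
    ultimately show ?case by simp
  qed
qed

text \<open>The augmentation ideal is spanned by the nonempty words.\<close>

lemma augmentation_induct [consumes 2, case_names zero monomial add]:
  assumes p: "p \<in> carrier (free_algebra R X)" "p [] = \<zero>"
    and zero: "P (\<lambda>w. \<zero>)"
    and mono: "\<And>c x w. \<lbrakk>c \<in> carrier R; x \<in> X; w \<in> lists X\<rbrakk> \<Longrightarrow> P (monomial R c (x # w))"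
    and add: "\<And>p q. \<lbrakk>p \<in> carrier (free_algebra R X); q \<in> carrier (free_algebra R X); p [] = \<zero>; q [] = \<zero>; P p; P q\<rbrakk> \<Longrightarrow>
      P (\<lambda>w. p w \<oplus> q w)"
  shows "P p"
proof -
  have cl: "p([] := \<zero>) \<in> carrier (free_algebra R X)" if "p \<in> carrier (free_algebra R X)" for p
  proof -
    have "finite {w. (p([] := \<zero>)) w \<noteq> \<zero>}"
      by (rule finite_subset[of _ "{w. p w \<noteq> \<zero>}"]) (use that in \<open>auto simp: free_algebra_carrier_iff\<close>)
    then show ?thesis using that by (auto simp: free_algebra_carrier_iff)
  qed
  have "P (p([] := \<zero>))" using p(1)
  proof (induction rule: free_algebra_induct)
    case zero
    then show ?case using assms(3) by (simp add: fun_upd_idem)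
  next
    case (monomial c w)
    show ?case
    proof (cases w)
      case Nil
      then have "(monomial R c w)([] := \<zero>) = (\<lambda>w. \<zero>)" by (auto simp: monomial_def)
      then show ?thesis using assms(3) by simp
    next
      case (Cons x v)
      then have "(monomial R c w)([] := \<zero>) = monomial R c (x # v)" by (auto simp: monomial_def)
      then show ?thesis using mono[of c x v] monomial Cons by simp
    qed
  next
    case (add p q)
    have "(\<lambda>w. p w \<oplus> q w)([] := \<zero>) = (\<lambda>w. (p([] := \<zero>)) w \<oplus> (q([] := \<zero>)) w)" by auto
    moreover have "P (\<lambda>w. (p([] := \<zero>)) w \<oplus> (q([] := \<zero>)) w)"
      by (rule assms(5)[OF cl[OF add(1)] cl[OF add(2)] _ _ add(3,4)]) simp_all
    ultimately show ?case by (simp only:)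
  qed
  moreover have "p([] := \<zero>) = p" using p(2) by auto
  ultimately show ?thesis by simp
qed

lemma free_algebra_minus:
  assumes "p \<in> carrier (free_algebra R X)"
  shows "\<ominus>\<^bsub>free_algebra R X\<^esub> p = (\<lambda>w. \<ominus> p w)"
proof -
  interpret A: ring "free_algebra R X" by (rule free_algebra_ring)
  have p: "p w \<in> carrier R" for w using assms by (simp add: free_algebra_carrier_iff)
  have "p w \<oplus> (\<ominus>\<^bsub>free_algebra R X\<^esub> p) w = \<zero>" for w
    using A.r_neg[OF assms] by (simp add: fun_eq_iff free_algebra_simps)
  moreover have "(\<ominus>\<^bsub>free_algebra R X\<^esub> p) w \<in> carrier R" for w
    using A.a_inv_closed[OF assms] by (simp add: free_algebra_carrier_iff)
  ultimately have "\<ominus> p w = (\<ominus>\<^bsub>free_algebra R X\<^esub> p) w" for w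
    using p by (metis minus_equality a_comm)
  then show ?thesis by auto
qed

lemma free_algebra_diff:
  assumes "p \<in> carrier (free_algebra R X)" "q \<in> carrier (free_algebra R X)"
  shows "p \<ominus>\<^bsub>free_algebra R X\<^esub> q = (\<lambda>w. p w \<ominus> q w)"
  unfolding a_minus_def[of "free_algebra R X"] using assms by (simp add: free_algebra_minus free_algebra_simps a_minus_def)

lemma conv_monomial_right:
  fixes q :: "'x list \<Rightarrow> 'a" and u w :: "'x list"
  assumes "c \<in> carrier R" "\<And>w. q w \<in> carrier R"
  shows "conv R q (monomial R c u) w =
    (if drop (length w - length u) w = u then q (take (length w - length u) w) \<otimes> c else \<zero>)"
proof -
  let ?k = "length w - length u"
  have eq: "drop i w = u \<longleftrightarrow> i = ?k \<and> drop ?k w = u" if "i \<le> length w" for i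
    using that by (auto simp: le_diff_conv)
  show ?thesis
  proof (cases "drop ?k w = u")
    case True
    have "conv R q (monomial R c u) w = (\<Oplus>i\<in>{..length w}. if ?k = i then q (take i w) \<otimes> c else \<zero>)"
      unfolding conv_def
    proof (rule add.finprod_cong')
      fix i assume "i \<in> {..length w}"
      then show "q (take i w) \<otimes> monomial R c u (drop i w) = (if ?k = i then q (take i w) \<otimes> c else \<zero>)"
        using eq[of i] True assms by (auto simp: monomial_def)
    qed (use assms in auto)
    also have "\<dots> = q (take ?k w) \<otimes> c"
      using assms by (intro add.finprod_singleton) auto
    finally show ?thesis using True by simp
  next
    case False
    have "conv R q (monomial R c u) w = \<zero>"
      unfolding conv_def
    proof (rule add.finprod_one_eqI)
      fix i assume "i \<in> {..length w}"
      then show "q (take i w) \<otimes> monomial R c u (drop i w) = \<zero>"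
        using eq[of i] False assms by (simp add: monomial_def)
    qed
    then show ?thesis using False by simp
  qed
qed

lemma free_algebra_smult_conv:
  assumes "c \<in> carrier R" "p \<in> carrier (free_algebra R X)"
  shows "(\<lambda>w. c \<otimes> p w) = conv R (monomial R c []) p"
  using assms by (simp add: fun_eq_iff conv_monomial_left free_algebra_carrier_iff)

lemma free_algebra_smult_closed:
  assumes "c \<in> carrier R" "p \<in> carrier (free_algebra R X)"
  shows "(\<lambda>w. c \<otimes> p w) \<in> carrier (free_algebra R X)"
proof -
  interpret A: ring "free_algebra R X" by (rule free_algebra_ring)
  have "monomial R c [] \<in> carrier (free_algebra R X)" using assms(1) by (intro monomial_closed) auto
  then show ?thesis
    using A.m_closed[OF _ assms(2)] unfolding free_algebra_smult_conv[OF assms] free_algebra_simps(1) by blast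
qed

text \<open>Every element is a sum of monomials, so it is enough to absorb these.\<close>

lemma free_algebra_idealI:
  assumes carrier: "I \<subseteq> carrier (free_algebra R X)"
    and zero: "\<zero>\<^bsub>free_algebra R X\<^esub> \<in> I"
    and add: "\<And>p q. \<lbrakk>p \<in> I; q \<in> I\<rbrakk> \<Longrightarrow> p \<oplus>\<^bsub>free_algebra R X\<^esub> q \<in> I"
    and left: "\<And>c u p. \<lbrakk>c \<in> carrier R; u \<in> lists X; p \<in> I\<rbrakk> \<Longrightarrow>
      monomial R c u \<otimes>\<^bsub>free_algebra R X\<^esub> p \<in> I"
    and right: "\<And>c u p. \<lbrakk>c \<in> carrier R; u \<in> lists X; p \<in> I\<rbrakk> \<Longrightarrow>
      p \<otimes>\<^bsub>free_algebra R X\<^esub> monomial R c u \<in> I"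
  shows "ideal I (free_algebra R X)"
proof -
  let ?A = "free_algebra R X"
  interpret A: ring ?A by (rule free_algebra_ring)
  have mult: "m \<otimes>\<^bsub>?A\<^esub> p \<in> I \<and> p \<otimes>\<^bsub>?A\<^esub> m \<in> I" if p: "p \<in> I" and m: "m \<in> carrier ?A" for m p
    using m
  proof (induction rule: free_algebra_induct)
    case zero
    have "p \<in> carrier ?A" using p carrier by blast
    then have "\<zero>\<^bsub>?A\<^esub> \<otimes>\<^bsub>?A\<^esub> p = \<zero>\<^bsub>?A\<^esub>" "p \<otimes>\<^bsub>?A\<^esub> \<zero>\<^bsub>?A\<^esub> = \<zero>\<^bsub>?A\<^esub>" by auto
    then show ?case using assms(2) unfolding free_algebra_simps by simp
  next
    case (monomial c w)
    then show ?case using left[OF _ _ p] right[OF _ _ p] by simp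
  next
    case (add m n)
    have "p \<in> carrier ?A" using p carrier by blast
    then have "(m \<oplus>\<^bsub>?A\<^esub> n) \<otimes>\<^bsub>?A\<^esub> p = m \<otimes>\<^bsub>?A\<^esub> p \<oplus>\<^bsub>?A\<^esub> n \<otimes>\<^bsub>?A\<^esub> p"
      "p \<otimes>\<^bsub>?A\<^esub> (m \<oplus>\<^bsub>?A\<^esub> n) = p \<otimes>\<^bsub>?A\<^esub> m \<oplus>\<^bsub>?A\<^esub> p \<otimes>\<^bsub>?A\<^esub> n"
      using add by (auto simp: A.l_distr A.r_distr)
    then have "(m \<oplus>\<^bsub>?A\<^esub> n) \<otimes>\<^bsub>?A\<^esub> p \<in> I \<and> p \<otimes>\<^bsub>?A\<^esub> (m \<oplus>\<^bsub>?A\<^esub> n) \<in> I" using add assms(3) by simp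
    then show ?case by (simp add: free_algebra_simps)
  qed
  show ?thesis
  proof (rule idealI[OF A.ring_axioms])
    show "subgroup I (add_monoid ?A)"
    proof (rule A.add.subgroupI)
      show "I \<subseteq> carrier ?A" by (rule carrier)
      show "I \<noteq> {}" using zero by blast
      fix p assume p: "p \<in> I"
      then have pc: "p \<in> carrier ?A" using carrier by blast
      have "(\<ominus>\<^bsub>?A\<^esub> \<one>\<^bsub>?A\<^esub>) \<otimes>\<^bsub>?A\<^esub> p \<in> I" using mult[OF p] by simp
      then show "\<ominus>\<^bsub>?A\<^esub> p \<in> I" using pc by (simp add: A.l_minus)
      fix q assume "q \<in> I"
      then show "p \<oplus>\<^bsub>?A\<^esub> q \<in> I" using add p by blast
    qed
  qed (use mult in auto)
qed

end

section \<open>Change of coefficients\<close>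

lemma leavitt_relations_cases:
  assumes "r \<in> leavitt_relations R G"
  defines "A \<equiv> free_algebra R (leavitt_gens G)" and "g \<equiv> free_gen R"
  obtains
    (vertices) v w where "v \<in> verts G" "w \<in> verts G"
      "r = g (Vertex v) \<otimes>\<^bsub>A\<^esub> g (Vertex w) \<ominus>\<^bsub>A\<^esub> (if v = w then g (Vertex v) else \<zero>\<^bsub>A\<^esub>)"
  | (source) x where "x \<in> edge_gens G" "r = g (Vertex (gen_source G x)) \<otimes>\<^bsub>A\<^esub> g x \<ominus>\<^bsub>A\<^esub> g x"
  | (target) x where "x \<in> edge_gens G" "r = g x \<otimes>\<^bsub>A\<^esub> g (Vertex (gen_target G x)) \<ominus>\<^bsub>A\<^esub> g x"
  | (CK1) e f where "e \<in> arcs G" "f \<in> arcs G"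
      "r = g (Ghost e) \<otimes>\<^bsub>A\<^esub> g (Arrow f) \<ominus>\<^bsub>A\<^esub> (if e = f then g (Vertex (head G e)) else \<zero>\<^bsub>A\<^esub>)"
  | (CK2) v where "v \<in> verts G" "finite (out_arcs G v)" "out_arcs G v \<noteq> {}"
      "r = g (Vertex v) \<ominus>\<^bsub>A\<^esub> (\<Oplus>\<^bsub>A\<^esub>e\<in>out_arcs G v. g (Arrow e) \<otimes>\<^bsub>A\<^esub> g (Ghost e))"
  using assms(1) unfolding leavitt_relations_def Let_def A_def[symmetric] g_def[symmetric] by blast

lemma leavitt_relations_intros:
  fixes R :: "('r, 'm) ring_scheme" and G :: "('v, 'e) pre_digraph"
  defines "A \<equiv> free_algebra R (leavitt_gens G)" and "g \<equiv> free_gen R"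
  shows "\<lbrakk>v \<in> verts G; w \<in> verts G\<rbrakk> \<Longrightarrow>
      g (Vertex v) \<otimes>\<^bsub>A\<^esub> g (Vertex w) \<ominus>\<^bsub>A\<^esub> (if v = w then g (Vertex v) else \<zero>\<^bsub>A\<^esub>)
        \<in> leavitt_relations R G"
    and "x \<in> edge_gens G \<Longrightarrow>
      g (Vertex (gen_source G x)) \<otimes>\<^bsub>A\<^esub> g x \<ominus>\<^bsub>A\<^esub> g x \<in> leavitt_relations R G"
    and "x \<in> edge_gens G \<Longrightarrow>
      g x \<otimes>\<^bsub>A\<^esub> g (Vertex (gen_target G x)) \<ominus>\<^bsub>A\<^esub> g x \<in> leavitt_relations R G"
    and "\<lbrakk>e \<in> arcs G; f \<in> arcs G\<rbrakk> \<Longrightarrow>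
      g (Ghost e) \<otimes>\<^bsub>A\<^esub> g (Arrow f) \<ominus>\<^bsub>A\<^esub> (if e = f then g (Vertex (head G e)) else \<zero>\<^bsub>A\<^esub>)
        \<in> leavitt_relations R G"
    and "\<lbrakk>v \<in> verts G; finite (out_arcs G v); out_arcs G v \<noteq> {}\<rbrakk> \<Longrightarrow>
      g (Vertex v) \<ominus>\<^bsub>A\<^esub> (\<Oplus>\<^bsub>A\<^esub>e\<in>out_arcs G v. g (Arrow e) \<otimes>\<^bsub>A\<^esub> g (Ghost e))
        \<in> leavitt_relations R G"
  unfolding leavitt_relations_def Let_def A_def[symmetric] g_def[symmetric] by blast+

lemma (in wf_digraph) vertex_gens:
  shows "v \<in> verts G \<Longrightarrow> Vertex v \<in> leavitt_gens G"
    and "x \<in> edge_gens G \<Longrightarrow> x \<in> leavitt_gens G"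
    and "e \<in> arcs G \<Longrightarrow> Arrow e \<in> leavitt_gens G"
    and "e \<in> arcs G \<Longrightarrow> Ghost e \<in> leavitt_gens G"
    and "x \<in> edge_gens G \<Longrightarrow> gen_source G x \<in> verts G"
    and "x \<in> edge_gens G \<Longrightarrow> gen_target G x \<in> verts G"
  by (auto simp: leavitt_gens_def edge_gens_def)

locale coefficient_map = R: cring R + S: cring S + hom: abelian_group_hom R S h
  for R :: "('r, 'm) ring_scheme" and S :: "('s, 'n) ring_scheme" and h :: "'r \<Rightarrow> 's"
begin

lemma push_closed:
  assumes "p \<in> carrier (free_algebra R X)"
  shows "(\<lambda>w. h (p w)) \<in> carrier (free_algebra S X)"
proof -
  have "{w. h (p w) \<noteq> \<zero>\<^bsub>S\<^esub>} \<subseteq> {w. p w \<noteq> \<zero>\<^bsub>R\<^esub>}" by auto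
  moreover have "finite {w. p w \<noteq> \<zero>\<^bsub>R\<^esub>}" using assms by (simp add: free_algebra_carrier_iff)
  ultimately have "finite {w. h (p w) \<noteq> \<zero>\<^bsub>S\<^esub>}" by (rule finite_subset)
  moreover have "w \<in> lists X" if "h (p w) \<noteq> \<zero>\<^bsub>S\<^esub>" for w
  proof -
    have "p w \<noteq> \<zero>\<^bsub>R\<^esub>" using that by auto
    then show ?thesis using assms unfolding free_algebra_carrier_iff by blast
  qed
  ultimately show ?thesis using assms by (simp add: free_algebra_carrier_iff)
qed

lemma coefficient_map_scale:
  assumes "c \<in> carrier R"
  shows "coefficient_map R S (\<lambda>x. h (c \<otimes>\<^bsub>R\<^esub> x))"
proof -
  have "abelian_group_hom R S (\<lambda>x. h (c \<otimes>\<^bsub>R\<^esub> x))"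
    by (rule abelian_group_homI)
      (use assms R.abelian_group_axioms S.abelian_group_axioms in
        \<open>auto simp: hom_def R.r_distr intro!: group_hom.intro group_hom_axioms.intro R.a_group S.a_group\<close>)
  then show ?thesis by (intro coefficient_map.intro R.cring_axioms S.cring_axioms)
qed

lemma push_monomial_left:
  assumes "c \<in> carrier R" "p \<in> carrier (free_algebra R X)"
  shows "(\<lambda>w. h (conv R (monomial R c u) p w)) = conv S (monomial S \<one>\<^bsub>S\<^esub> u) (\<lambda>w. h (c \<otimes>\<^bsub>R\<^esub> p w))"
proof -
  have "p w \<in> carrier R" for w using assms(2) by (simp add: free_algebra_carrier_iff)
  then show ?thesis
    using assms(1) by (simp add: fun_eq_iff R.conv_monomial_left S.conv_monomial_left)
qed

lemma push_monomial_right: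
  assumes "c \<in> carrier R" "p \<in> carrier (free_algebra R X)"
  shows "(\<lambda>w. h (conv R p (monomial R c u) w)) = conv S (\<lambda>w. h (c \<otimes>\<^bsub>R\<^esub> p w)) (monomial S \<one>\<^bsub>S\<^esub> u)"
proof -
  have "p w \<in> carrier R" for w using assms(2) by (simp add: free_algebra_carrier_iff)
  then show ?thesis
    using assms(1) by (simp add: fun_eq_iff R.conv_monomial_right S.conv_monomial_right R.m_comm)
qed

text \<open>This holds when \<open>p\<close> and \<open>q\<close> are given by the same formula with integral coefficients, as each value
  of \<open>p\<close> is then an integral multiple of \<open>1\<close>.\<close>

definition related :: "'x set \<Rightarrow> ('x list \<Rightarrow> 'r) \<Rightarrow> ('x list \<Rightarrow> 's) \<Rightarrow> bool" where
  "related X p q \<longleftrightarrow> p \<in> carrier (free_algebra R X) \<and> q \<in> carrier (free_algebra S X) \<and>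
    (\<forall>w. h (p w) = h \<one>\<^bsub>R\<^esub> \<otimes>\<^bsub>S\<^esub> q w)"

lemma related_zero: "related X \<zero>\<^bsub>free_algebra R X\<^esub> \<zero>\<^bsub>free_algebra S X\<^esub>"
  by (simp add: related_def free_algebra_simps free_algebra_carrier_iff)

lemma related_monomial: "w \<in> lists X \<Longrightarrow> related X (monomial R \<one>\<^bsub>R\<^esub> w) (monomial S \<one>\<^bsub>S\<^esub> w)"
  unfolding related_def by (auto simp: R.monomial_closed S.monomial_closed) (auto simp: monomial_def)

lemma related_gen: "x \<in> X \<Longrightarrow> related X (free_gen R x) (free_gen S x)"
  unfolding free_gen_eq_monomial by (rule related_monomial) simp

lemma related_gen_mult:
  assumes "x \<in> X" "y \<in> X"
  shows "related X (free_gen R x \<otimes>\<^bsub>free_algebra R X\<^esub> free_gen R y) (free_gen S x \<otimes>\<^bsub>free_algebra S X\<^esub> free_gen S y)"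
  unfolding free_gen_eq_monomial free_algebra_simps
  using assms by (simp add: R.monomial_mult S.monomial_mult related_monomial)

lemma related_closed:
  assumes "related X p q"
  shows "p \<in> carrier (free_algebra R X)" "q \<in> carrier (free_algebra S X)"
    "p w \<in> carrier R" "q w \<in> carrier S" "h (p w) = h \<one>\<^bsub>R\<^esub> \<otimes>\<^bsub>S\<^esub> q w"
  using assms unfolding related_def free_algebra_carrier_iff by blast+

lemma related_add:
  assumes "related X p q" "related X p' q'"
  shows "related X (p \<oplus>\<^bsub>free_algebra R X\<^esub> p') (q \<oplus>\<^bsub>free_algebra S X\<^esub> q')"
proof -
  interpret AR: ring "free_algebra R X" by (rule R.free_algebra_ring)
  interpret AS: ring "free_algebra S X" by (rule S.free_algebra_ring)
  note cl = related_closed(1,2)[OF assms(1)] related_closed(1,2)[OF assms(2)]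
  have "p \<oplus>\<^bsub>free_algebra R X\<^esub> p' \<in> carrier (free_algebra R X)"
    "q \<oplus>\<^bsub>free_algebra S X\<^esub> q' \<in> carrier (free_algebra S X)" using cl by auto
  moreover have "h ((p \<oplus>\<^bsub>free_algebra R X\<^esub> p') w) = h \<one>\<^bsub>R\<^esub> \<otimes>\<^bsub>S\<^esub> (q \<oplus>\<^bsub>free_algebra S X\<^esub> q') w" for w
    using related_closed(3-5)[OF assms(1), of w] related_closed(3-5)[OF assms(2), of w]
    by (simp add: free_algebra_simps S.r_distr)
  ultimately show ?thesis unfolding related_def by blast
qed

lemma related_diff:
  assumes "related X p q" "related X p' q'"
  shows "related X (p \<ominus>\<^bsub>free_algebra R X\<^esub> p') (q \<ominus>\<^bsub>free_algebra S X\<^esub> q')"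
proof -
  interpret AR: ring "free_algebra R X" by (rule R.free_algebra_ring)
  interpret AS: ring "free_algebra S X" by (rule S.free_algebra_ring)
  note cl = related_closed(1,2)[OF assms(1)] related_closed(1,2)[OF assms(2)]
  have "p \<ominus>\<^bsub>free_algebra R X\<^esub> p' \<in> carrier (free_algebra R X)"
    "q \<ominus>\<^bsub>free_algebra S X\<^esub> q' \<in> carrier (free_algebra S X)" using cl by auto
  moreover have "h ((p \<ominus>\<^bsub>free_algebra R X\<^esub> p') w) = h \<one>\<^bsub>R\<^esub> \<otimes>\<^bsub>S\<^esub> (q \<ominus>\<^bsub>free_algebra S X\<^esub> q') w" for w
    using related_closed(3-5)[OF assms(1), of w] related_closed(3-5)[OF assms(2), of w]
    unfolding R.free_algebra_diff[OF cl(1,3)] S.free_algebra_diff[OF cl(2,4)]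
    by (simp add: R.minus_eq S.minus_eq S.r_distr S.r_minus)
  ultimately show ?thesis unfolding related_def by blast
qed

lemma related_finsum:
  assumes "finite I" "\<And>i. i \<in> I \<Longrightarrow> related X (p i) (q i)"
  shows "related X (\<Oplus>\<^bsub>free_algebra R X\<^esub>i\<in>I. p i) (\<Oplus>\<^bsub>free_algebra S X\<^esub>i\<in>I. q i)"
  using assms
proof (induction I)
  case empty
  interpret AR: ring "free_algebra R X" by (rule R.free_algebra_ring)
  interpret AS: ring "free_algebra S X" by (rule S.free_algebra_ring)
  show ?case using related_zero by simp
next
  case (insert i I)
  interpret AR: ring "free_algebra R X" by (rule R.free_algebra_ring)
  interpret AS: ring "free_algebra S X" by (rule S.free_algebra_ring)
  have "p \<in> I \<rightarrow> carrier (free_algebra R X)" "q \<in> I \<rightarrow> carrier (free_algebra S X)"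
    "p i \<in> carrier (free_algebra R X)" "q i \<in> carrier (free_algebra S X)"
    using insert.prems related_closed(1,2) by blast+
  then show ?case
    using insert by (simp add: AR.finsum_insert AS.finsum_insert related_add)
qed

lemma relation_transfer:
  assumes "wf_digraph G" "r \<in> leavitt_relations R G"
  shows "\<exists>r'\<in>leavitt_relations S G. related (leavitt_gens G) r r'"
proof -
  interpret wf_digraph G by fact
  note rel = related_diff related_gen related_gen_mult related_zero related_finsum
  note vertex_gens [simp]
  from assms(2) show ?thesis
  proof (cases rule: leavitt_relations_cases)
    case (vertices v w)
    show ?thesis unfolding vertices(3)
      by (rule bexI[OF _ leavitt_relations_intros(1)[OF vertices(1,2)]])
        (use vertices in \<open>cases "v = w"; auto intro!: rel\<close>)
  next
    case (source x)
    show ?thesis unfolding source(2)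
      by (rule bexI[OF _ leavitt_relations_intros(2)[OF source(1)]]) (use source in \<open>auto intro!: rel\<close>)
  next
    case (target x)
    show ?thesis unfolding target(2)
      by (rule bexI[OF _ leavitt_relations_intros(3)[OF target(1)]]) (use target in \<open>auto intro!: rel\<close>)
  next
    case (CK1 e f)
    show ?thesis unfolding CK1(3)
      by (rule bexI[OF _ leavitt_relations_intros(4)[OF CK1(1,2)]])
        (use CK1 in \<open>cases "e = f"; auto intro!: rel\<close>)
  next
    case (CK2 v)
    show ?thesis unfolding CK2(4)
      by (rule bexI[OF _ leavitt_relations_intros(5)[OF CK2(1-3)]]) (use CK2 in \<open>auto intro!: rel\<close>)
  qed
qed

end

text \<open>Transfer along the identity map shows in particular that the relations are elements of the free
  algebra.\<close>

lemma relations_closed: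
  assumes "cring R" "wf_digraph G"
  shows "leavitt_relations R G \<subseteq> carrier (free_algebra R (leavitt_gens G))"
proof
  fix r assume "r \<in> leavitt_relations R G"
  interpret R: cring R by fact
  have "abelian_group_hom R R (\<lambda>x. x)"
    by (rule abelian_group_homI)
      (auto simp: hom_def intro!: group_hom.intro group_hom_axioms.intro R.a_group R.abelian_group_axioms)
  then interpret coefficient_map R R "\<lambda>x. x"
    by (intro coefficient_map.intro R.cring_axioms)
  show "r \<in> carrier (free_algebra R (leavitt_gens G))"
    using relation_transfer[OF assms(2) \<open>r \<in> _\<close>] related_closed(1) by blast
qed

lemma leavitt_ideal_ideal:
  assumes "cring R" "wf_digraph G"
  shows "ideal (leavitt_ideal R G) (free_algebra R (leavitt_gens G))"
proof -
  interpret A: ring "free_algebra R (leavitt_gens G)" using assms(1) by (rule cring.free_algebra_ring)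
  show ?thesis unfolding leavitt_ideal_def by (rule A.genideal_ideal[OF relations_closed[OF assms]])
qed

text \<open>
  As the relations have integral coefficients, an additive map of the coefficients respects the
  ideals, even if it is not multiplicative. This applies to a ring homomorphism and to a linear
  functional alike. The ideal \<open>I\<close> of the proof refers to all additive maps at once, since multiplication
  by a monomial \<open>c u\<close> replaces \<open>h\<close> by \<open>\<lambda>x. h (c x)\<close>.
\<close>

theorem push_leavitt_ideal:
  assumes "coefficient_map R S h" and wf: "wf_digraph G" and "p \<in> leavitt_ideal R G"
  shows "(\<lambda>w. h (p w)) \<in> leavitt_ideal S G"
proof -
  let ?X = "leavitt_gens G"
  let ?AR = "free_algebra R ?X" and ?AS = "free_algebra S ?X"
  interpret base: coefficient_map R S h by fact
  interpret AR: ring ?AR by (rule base.R.free_algebra_ring)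
  interpret AS: ring ?AS by (rule base.S.free_algebra_ring)
  interpret J: ideal "leavitt_ideal S G" ?AS by (rule leavitt_ideal_ideal[OF base.S.cring_axioms wf])
  define I where "I = {p \<in> carrier ?AR. \<forall>h. coefficient_map R S h \<longrightarrow> (\<lambda>w. h (p w)) \<in> leavitt_ideal S G}"
  have I_zero: "\<zero>\<^bsub>?AR\<^esub> \<in> I"
  proof -
    have "(\<lambda>w. h (\<zero>\<^bsub>?AR\<^esub> w)) = \<zero>\<^bsub>?AS\<^esub>" if "coefficient_map R S h" for h
    proof -
      interpret h: coefficient_map R S h by fact
      show ?thesis by (simp add: free_algebra_simps)
    qed
    then show ?thesis using AR.zero_closed J.zero_closed unfolding I_def by simp
  qed
  have I_add: "p \<oplus>\<^bsub>?AR\<^esub> q \<in> I" if "p \<in> I" "q \<in> I" for p q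
  proof -
    have pq: "p \<in> carrier ?AR" "q \<in> carrier ?AR" using that unfolding I_def by auto
    have "(\<lambda>w. h ((p \<oplus>\<^bsub>?AR\<^esub> q) w)) \<in> leavitt_ideal S G" if h: "coefficient_map R S h" for h
    proof -
      interpret h: coefficient_map R S h by fact
      have "(\<lambda>w. h ((p \<oplus>\<^bsub>?AR\<^esub> q) w)) = (\<lambda>w. h (p w)) \<oplus>\<^bsub>?AS\<^esub> (\<lambda>w. h (q w))"
        using pq by (simp add: free_algebra_simps free_algebra_carrier_iff)
      then show ?thesis using \<open>p \<in> I\<close> \<open>q \<in> I\<close> h J.a_closed unfolding I_def by simp
    qed
    then show ?thesis using pq unfolding I_def by simp
  qed
  have I_carrier: "I \<subseteq> carrier ?AR" unfolding I_def by blast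
  have left_monomial: "monomial R c u \<otimes>\<^bsub>?AR\<^esub> p \<in> I" and right_monomial: "p \<otimes>\<^bsub>?AR\<^esub> monomial R c u \<in> I"
    if "c \<in> carrier R" "u \<in> lists ?X" "p \<in> I" for c u p
  proof -
    have p: "p \<in> carrier ?AR" using that I_carrier by blast
    have m: "monomial R c u \<in> carrier ?AR" using base.R.monomial_closed[OF that(1,2)] .
    have m': "monomial S \<one>\<^bsub>S\<^esub> u \<in> carrier ?AS" using base.S.monomial_closed[OF base.S.one_closed that(2)] .
    have *: "(\<lambda>w. h ((monomial R c u \<otimes>\<^bsub>?AR\<^esub> p) w)) \<in> leavitt_ideal S G \<and>
        (\<lambda>w. h ((p \<otimes>\<^bsub>?AR\<^esub> monomial R c u) w)) \<in> leavitt_ideal S G" if h: "coefficient_map R S h" for h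
    proof -
      interpret h: coefficient_map R S h by fact
      have "(\<lambda>w. h (c \<otimes>\<^bsub>R\<^esub> p w)) \<in> leavitt_ideal S G"
        using \<open>p \<in> I\<close> h.coefficient_map_scale[OF \<open>c \<in> carrier R\<close>] unfolding I_def by blast
      then have "monomial S \<one>\<^bsub>S\<^esub> u \<otimes>\<^bsub>?AS\<^esub> (\<lambda>w. h (c \<otimes>\<^bsub>R\<^esub> p w)) \<in> leavitt_ideal S G"
          "(\<lambda>w. h (c \<otimes>\<^bsub>R\<^esub> p w)) \<otimes>\<^bsub>?AS\<^esub> monomial S \<one>\<^bsub>S\<^esub> u \<in> leavitt_ideal S G"
        using J.I_l_closed[OF _ m'] J.I_r_closed[OF _ m'] by auto
      then show ?thesis
        using h.push_monomial_left[OF \<open>c \<in> carrier R\<close> p, of u] h.push_monomial_right[OF \<open>c \<in> carrier R\<close> p, of u]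
        by (simp add: free_algebra_simps)
    qed
    show "monomial R c u \<otimes>\<^bsub>?AR\<^esub> p \<in> I" "p \<otimes>\<^bsub>?AR\<^esub> monomial R c u \<in> I"
      using * AR.m_closed[OF m p] AR.m_closed[OF p m] unfolding I_def by auto
  qed
  have "ideal I ?AR"
    by (rule base.R.free_algebra_idealI[OF I_carrier I_zero I_add left_monomial right_monomial])
  moreover have "leavitt_relations R G \<subseteq> I"
  proof
    fix r assume r: "r \<in> leavitt_relations R G"
    have "(\<lambda>w. h (r w)) \<in> leavitt_ideal S G" if h: "coefficient_map R S h" for h
    proof -
      interpret h: coefficient_map R S h by fact
      obtain r' where r': "r' \<in> leavitt_relations S G" "h.related ?X r r'"
        using h.relation_transfer[OF wf r] by blast
      have "r' \<in> leavitt_ideal S G"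
        using r'(1) AS.genideal_self[OF relations_closed[OF base.S.cring_axioms wf]] unfolding leavitt_ideal_def by blast
      then have "monomial S (h \<one>\<^bsub>R\<^esub>) [] \<otimes>\<^bsub>?AS\<^esub> r' \<in> leavitt_ideal S G"
        by (intro J.I_l_closed base.S.monomial_closed) auto
      moreover have "(\<lambda>w. h (r w)) = monomial S (h \<one>\<^bsub>R\<^esub>) [] \<otimes>\<^bsub>?AS\<^esub> r'"
        unfolding free_algebra_simps using h.related_closed[OF r'(2)]
        by (subst base.S.free_algebra_smult_conv[symmetric]) auto
      ultimately show ?thesis by simp
    qed
    then show "r \<in> I" using r relations_closed[OF base.R.cring_axioms wf] unfolding I_def by blast
  qed
  ultimately have "leavitt_ideal R G \<subseteq> I"
    unfolding leavitt_ideal_def by (rule AR.genideal_minimal)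
  then show ?thesis using assms(1,3) unfolding I_def by blast
qed

section \<open>The Leavitt path algebra as an associative algebra\<close>

text \<open>\<open>FQ\<close> is the quotient of the unital free algebra. The path algebra \<open>L\<close> is the image of the augmentation
  ideal in it and inherits its operations.\<close>

locale leavitt = cring R + G: fin_digraph G
  for R :: "('r, 'm) ring_scheme" (structure) and G :: "('v, 'e) pre_digraph"
begin

abbreviation FA :: "('r, ('v, 'e) leavitt_gen list \<Rightarrow> 'r) module" where
  "FA \<equiv> free_algebra R (leavitt_gens G)"

abbreviation L :: "('r, (('v, 'e) leavitt_gen list \<Rightarrow> 'r) set) module" where
  "L \<equiv> leavitt_path_algebra R G"

abbreviation FQ :: "(('v, 'e) leavitt_gen list \<Rightarrow> 'r) set ring" where
  "FQ \<equiv> FA Quot leavitt_ideal R G"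

definition cls :: "(('v, 'e) leavitt_gen list \<Rightarrow> 'r) \<Rightarrow> (('v, 'e) leavitt_gen list \<Rightarrow> 'r) set" where
  "cls p = leavitt_ideal R G +>\<^bsub>FA\<^esub> p"

abbreviation word :: "'r \<Rightarrow> ('v, 'e) leavitt_gen list \<Rightarrow> (('v, 'e) leavitt_gen list \<Rightarrow> 'r) set" where
  "word c w \<equiv> cls (monomial R c w)"

sublocale FA: ring FA
  by (rule free_algebra_ring)

sublocale J: ideal "leavitt_ideal R G" FA
  by (rule leavitt_ideal_ideal) unfold_locales

sublocale FQ: ring FQ
  by (rule J.quotient_is_ring)

sublocale cls: ring_hom_ring FA FQ cls
  using J.rcos_ring_hom_ring unfolding cls_def[abs_def] .

lemma cls_eq_iff: "\<lbrakk>p \<in> carrier FA; q \<in> carrier FA\<rbrakk> \<Longrightarrow> cls p = cls q \<longleftrightarrow> p \<ominus>\<^bsub>FA\<^esub> q \<in> leavitt_ideal R G"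
  unfolding cls_def using FA.quotient_eq_iff_same_a_r_cos[OF J.ideal_axioms] by blast

lemma in_cls_iff:
  assumes "p \<in> carrier FA"
  shows "q \<in> cls p \<longleftrightarrow> q \<in> carrier FA \<and> cls q = cls p"
proof
  assume "q \<in> cls p"
  then obtain j where j: "j \<in> leavitt_ideal R G" "q = j \<oplus>\<^bsub>FA\<^esub> p"
    unfolding cls_def a_r_coset_def' by blast
  have "j \<in> carrier FA" using j(1) J.a_subset by blast
  then have "q \<in> carrier FA" "q \<ominus>\<^bsub>FA\<^esub> p = j"
    using j(2) assms by (simp_all add: FA.minus_eq FA.a_assoc FA.r_neg)
  then show "q \<in> carrier FA \<and> cls q = cls p" using j(1) assms cls_eq_iff by auto
next
  assume "q \<in> carrier FA \<and> cls q = cls p"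
  then show "q \<in> cls p" using J.a_rcos_self unfolding cls_def by blast
qed

lemma cls_zero: "cls \<zero>\<^bsub>FA\<^esub> = \<zero>\<^bsub>FQ\<^esub>"
  by (rule cls.hom_zero)

lemma L_simps:
  "carrier L = {cls p | p. p \<in> carrier FA \<and> p [] = \<zero>}"
  "monoid.mult L = monoid.mult FQ" "add L = add FQ" "zero L = zero FQ"
  "one L = cls (\<Oplus>\<^bsub>FA\<^esub>v\<in>verts G. free_gen R (Vertex v))"
  "smult L = (\<lambda>a C. \<Union>p\<in>C. cls (a \<odot>\<^bsub>FA\<^esub> p))"
  by (simp_all add: leavitt_path_algebra_def Let_def cls_def)

lemma L_in_FQ: "x \<in> carrier L \<Longrightarrow> x \<in> carrier FQ"
  unfolding L_simps by auto

lemma smult_cls: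
  assumes "a \<in> carrier R" "p \<in> carrier FA"
  shows "a \<odot>\<^bsub>L\<^esub> cls p = word a [] \<otimes>\<^bsub>FQ\<^esub> cls p" "a \<odot>\<^bsub>L\<^esub> cls p = cls (\<lambda>w. a \<otimes> p w)"
proof -
  have m: "monomial R a [] \<in> carrier FA" using assms by (intro monomial_closed) auto
  have eq: "cls (\<lambda>w. a \<otimes> q w) = word a [] \<otimes>\<^bsub>FQ\<^esub> cls q" if "q \<in> carrier FA" for q
    using cls.hom_mult[OF m that] free_algebra_smult_conv[OF assms(1) that] by (simp add: free_algebra_simps)
  have "a \<odot>\<^bsub>L\<^esub> cls p = (\<Union>q\<in>cls p. cls (\<lambda>w. a \<otimes> q w))"
    unfolding L_simps by (simp add: free_algebra_simps)
  also have "\<dots> = (\<Union>q\<in>cls p. word a [] \<otimes>\<^bsub>FQ\<^esub> cls p)"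
    using eq in_cls_iff[OF assms(2)] by (intro SUP_cong refl) metis
  also have "\<dots> = word a [] \<otimes>\<^bsub>FQ\<^esub> cls p" using in_cls_iff[OF assms(2)] assms by auto
  finally show "a \<odot>\<^bsub>L\<^esub> cls p = word a [] \<otimes>\<^bsub>FQ\<^esub> cls p" .
  then show "a \<odot>\<^bsub>L\<^esub> cls p = cls (\<lambda>w. a \<otimes> p w)" using eq assms by simp
qed

lemma word_closed: "\<lbrakk>c \<in> carrier R; w \<in> lists (leavitt_gens G)\<rbrakk> \<Longrightarrow> word c w \<in> carrier FQ"
  by (intro cls.hom_closed monomial_closed)

lemma word_mult:
  "\<lbrakk>c \<in> carrier R; d \<in> carrier R; u \<in> lists (leavitt_gens G); v \<in> lists (leavitt_gens G)\<rbrakk> \<Longrightarrow>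
    word c u \<otimes>\<^bsub>FQ\<^esub> word d v = word (c \<otimes> d) (u @ v)"
  using cls.hom_mult[of "monomial R c u" "monomial R d v"]
  by (simp add: monomial_closed free_algebra_simps monomial_mult)

lemma word_in_L: "\<lbrakk>c \<in> carrier R; x \<in> leavitt_gens G; w \<in> lists (leavitt_gens G)\<rbrakk> \<Longrightarrow> word c (x # w) \<in> carrier L"
  unfolding L_simps by (intro CollectI exI[of _ "monomial R c (x # w)"]) (auto simp: monomial_closed, simp add: monomial_def)

lemma L_induct [consumes 1, case_names zero word add]:
  assumes "x \<in> carrier L"
    and "P \<zero>\<^bsub>L\<^esub>"
    and "\<And>c y w. \<lbrakk>c \<in> carrier R; y \<in> leavitt_gens G; w \<in> lists (leavitt_gens G)\<rbrakk> \<Longrightarrow> P (word c (y # w))"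
    and "\<And>x y. \<lbrakk>x \<in> carrier L; y \<in> carrier L; P x; P y\<rbrakk> \<Longrightarrow> P (x \<oplus>\<^bsub>L\<^esub> y)"
  shows "P x"
proof -
  obtain p where p: "p \<in> carrier FA" "p [] = \<zero>" "x = cls p" using assms(1) unfolding L_simps by blast
  have "P (cls p)" using p(1,2)
  proof (induction rule: augmentation_induct)
    case zero
    then show ?case using assms(2) cls_zero by (simp add: L_simps free_algebra_simps)
  next
    case (monomial c y w)
    then show ?case using assms(3) by simp
  next
    case (add p q)
    have "cls (\<lambda>w. p w \<oplus> q w) = cls p \<oplus>\<^bsub>L\<^esub> cls q"
      using cls.hom_add[OF add(1,2)] by (simp add: L_simps free_algebra_simps)
    moreover have "cls p \<in> carrier L" "cls q \<in> carrier L" using add unfolding L_simps by blast+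
    ultimately show ?case using assms(4) add by simp
  qed
  then show ?thesis using p by simp
qed

lemma relation_zero: "r \<in> leavitt_relations R G \<Longrightarrow> r \<in> leavitt_ideal R G"
  using FA.genideal_self[OF relations_closed] cring_axioms G.wf_digraph unfolding leavitt_ideal_def by blast

lemma gens_finite: "finite (leavitt_gens G)"
  by (simp add: leavitt_gens_def edge_gens_def)

lemma vertex_word_mult:
  assumes "v \<in> verts G" "w \<in> verts G"
  shows "word \<one> [Vertex v] \<otimes>\<^bsub>FQ\<^esub> word \<one> [Vertex w] = (if v = w then word \<one> [Vertex v] else \<zero>\<^bsub>FQ\<^esub>)"
proof -
  let ?z = "if v = w then free_gen R (Vertex v) else \<zero>\<^bsub>FA\<^esub>"
  have c: "free_gen R (Vertex u) \<in> carrier FA" if "u \<in> verts G" for u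
    using that G.vertex_gens unfolding free_gen_eq_monomial by (intro monomial_closed) auto
  have "cls (free_gen R (Vertex v) \<otimes>\<^bsub>FA\<^esub> free_gen R (Vertex w)) = cls ?z"
    using relation_zero[OF leavitt_relations_intros(1)[OF assms]] c assms
    by (subst cls_eq_iff) auto
  then show ?thesis
    using cls.hom_mult[OF c c, OF assms] cls_zero by (simp add: free_gen_eq_monomial split: if_splits)
qed

lemma source_word_mult:
  assumes "x \<in> leavitt_gens G"
  shows "word \<one> [Vertex (gen_source G x)] \<otimes>\<^bsub>FQ\<^esub> word \<one> [x] = word \<one> [x]" "gen_source G x \<in> verts G"
proof -
  have "(\<exists>v\<in>verts G. x = Vertex v) \<or> x \<in> edge_gens G" using assms unfolding leavitt_gens_def by blast
  then have "word \<one> [Vertex (gen_source G x)] \<otimes>\<^bsub>FQ\<^esub> word \<one> [x] = word \<one> [x] \<and> gen_source G x \<in> verts G"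
  proof
    assume "\<exists>v\<in>verts G. x = Vertex v"
    then show ?thesis using vertex_word_mult by auto
  next
    assume x: "x \<in> edge_gens G"
    let ?s = "Vertex (gen_source G x)"
    have s: "gen_source G x \<in> verts G" using G.vertex_gens x by blast
    have c: "free_gen R ?s \<in> carrier FA" "free_gen R x \<in> carrier FA"
      using assms s G.vertex_gens(1) unfolding free_gen_eq_monomial by (auto intro!: monomial_closed)
    have "cls (free_gen R ?s \<otimes>\<^bsub>FA\<^esub> free_gen R x) = cls (free_gen R x)"
      using relation_zero[OF leavitt_relations_intros(2)[OF x]] c by (subst cls_eq_iff) auto
    then show ?thesis using cls.hom_mult[OF c] s by (simp add: free_gen_eq_monomial)
  qed
  then show "word \<one> [Vertex (gen_source G x)] \<otimes>\<^bsub>FQ\<^esub> word \<one> [x] = word \<one> [x]" "gen_source G x \<in> verts G" by auto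
qed

lemma target_word_mult:
  assumes "x \<in> leavitt_gens G"
  shows "word \<one> [x] \<otimes>\<^bsub>FQ\<^esub> word \<one> [Vertex (gen_target G x)] = word \<one> [x]" "gen_target G x \<in> verts G"
proof -
  have "(\<exists>v\<in>verts G. x = Vertex v) \<or> x \<in> edge_gens G" using assms unfolding leavitt_gens_def by blast
  then have "word \<one> [x] \<otimes>\<^bsub>FQ\<^esub> word \<one> [Vertex (gen_target G x)] = word \<one> [x] \<and> gen_target G x \<in> verts G"
  proof
    assume "\<exists>v\<in>verts G. x = Vertex v"
    then show ?thesis using vertex_word_mult by auto
  next
    assume x: "x \<in> edge_gens G"
    let ?t = "Vertex (gen_target G x)"
    have t: "gen_target G x \<in> verts G" using G.vertex_gens x by blast
    have c: "free_gen R ?t \<in> carrier FA" "free_gen R x \<in> carrier FA"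
      using assms t G.vertex_gens(1) unfolding free_gen_eq_monomial by (auto intro!: monomial_closed)
    have "cls (free_gen R x \<otimes>\<^bsub>FA\<^esub> free_gen R ?t) = cls (free_gen R x)"
      using relation_zero[OF leavitt_relations_intros(3)[OF x]] c by (subst cls_eq_iff) auto
    then show ?thesis using cls.hom_mult[OF c(2,1)] t by (simp add: free_gen_eq_monomial)
  qed
  then show "word \<one> [x] \<otimes>\<^bsub>FQ\<^esub> word \<one> [Vertex (gen_target G x)] = word \<one> [x]" "gen_target G x \<in> verts G" by auto
qed

lemma one_L: "\<one>\<^bsub>L\<^esub> = (\<Oplus>\<^bsub>FQ\<^esub>v\<in>verts G. word \<one> [Vertex v])"
proof -
  have c: "(\<lambda>v. free_gen R (Vertex v)) \<in> verts G \<rightarrow> carrier FA"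
    using G.vertex_gens(1) unfolding free_gen_eq_monomial by (auto intro!: monomial_closed)
  show ?thesis unfolding L_simps cls.hom_finsum[OF c] by (simp add: comp_def free_gen_eq_monomial)
qed

lemma vertex_words_closed: "(\<lambda>v. word \<one> [Vertex v]) \<in> verts G \<rightarrow> carrier FQ"
  using G.vertex_gens(1) by (auto intro!: word_closed)

text \<open>Writing \<open>x\<close> as the product of its source and \<open>x\<close>, all vertices but the source annihilate it.\<close>

lemma one_L_mult_gen:
  assumes x: "x \<in> leavitt_gens G"
  shows "\<one>\<^bsub>L\<^esub> \<otimes>\<^bsub>FQ\<^esub> word \<one> [x] = word \<one> [x]"
proof -
  let ?s = "gen_source G x"
  have xc: "word \<one> [x] \<in> carrier FQ" using x by (intro word_closed) auto
  have sc: "word \<one> [Vertex v] \<in> carrier FQ" if "v \<in> verts G" for v using vertex_words_closed that by blast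
  have "word \<one> [Vertex v] \<otimes>\<^bsub>FQ\<^esub> word \<one> [x] = (if ?s = v then word \<one> [x] else \<zero>\<^bsub>FQ\<^esub>)" if v: "v \<in> verts G" for v
  proof -
    have "word \<one> [Vertex v] \<otimes>\<^bsub>FQ\<^esub> word \<one> [x] =
        word \<one> [Vertex v] \<otimes>\<^bsub>FQ\<^esub> (word \<one> [Vertex ?s] \<otimes>\<^bsub>FQ\<^esub> word \<one> [x])"
      by (simp add: source_word_mult(1)[OF x])
    also have "\<dots> = (word \<one> [Vertex v] \<otimes>\<^bsub>FQ\<^esub> word \<one> [Vertex ?s]) \<otimes>\<^bsub>FQ\<^esub> word \<one> [x]"
      by (rule FQ.m_assoc[symmetric]) (use v source_word_mult(2)[OF x] xc sc in auto)
    also have "\<dots> = (if ?s = v then word \<one> [x] else \<zero>\<^bsub>FQ\<^esub>)"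
      using vertex_word_mult[OF v source_word_mult(2)[OF x]] source_word_mult(1)[OF x] xc by auto
    finally show ?thesis .
  qed
  then have "(\<Oplus>\<^bsub>FQ\<^esub>v\<in>verts G. word \<one> [Vertex v] \<otimes>\<^bsub>FQ\<^esub> word \<one> [x]) =
      (\<Oplus>\<^bsub>FQ\<^esub>v\<in>verts G. if ?s = v then word \<one> [x] else \<zero>\<^bsub>FQ\<^esub>)"
    using xc by (intro FQ.add.finprod_cong') auto
  also have "\<dots> = word \<one> [x]"
    using source_word_mult(2)[OF x] xc by (intro FQ.add.finprod_singleton) auto
  finally show ?thesis
    unfolding one_L using xc vertex_words_closed by (subst FQ.finsum_ldistr) auto
qed

lemma gen_mult_one_L:
  assumes x: "x \<in> leavitt_gens G"
  shows "word \<one> [x] \<otimes>\<^bsub>FQ\<^esub> \<one>\<^bsub>L\<^esub> = word \<one> [x]"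
proof -
  let ?t = "gen_target G x"
  have xc: "word \<one> [x] \<in> carrier FQ" using x by (intro word_closed) auto
  have sc: "word \<one> [Vertex v] \<in> carrier FQ" if "v \<in> verts G" for v using vertex_words_closed that by blast
  have "word \<one> [x] \<otimes>\<^bsub>FQ\<^esub> word \<one> [Vertex v] = (if ?t = v then word \<one> [x] else \<zero>\<^bsub>FQ\<^esub>)" if v: "v \<in> verts G" for v
  proof -
    have "word \<one> [x] \<otimes>\<^bsub>FQ\<^esub> word \<one> [Vertex v] =
        (word \<one> [x] \<otimes>\<^bsub>FQ\<^esub> word \<one> [Vertex ?t]) \<otimes>\<^bsub>FQ\<^esub> word \<one> [Vertex v]"
      by (simp add: target_word_mult(1)[OF x])
    also have "\<dots> = word \<one> [x] \<otimes>\<^bsub>FQ\<^esub> (word \<one> [Vertex ?t] \<otimes>\<^bsub>FQ\<^esub> word \<one> [Vertex v])"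
      by (rule FQ.m_assoc) (use v target_word_mult(2)[OF x] xc sc in auto)
    also have "\<dots> = (if ?t = v then word \<one> [x] else \<zero>\<^bsub>FQ\<^esub>)"
      using vertex_word_mult[OF target_word_mult(2)[OF x] v] target_word_mult(1)[OF x] xc by auto
    finally show ?thesis .
  qed
  then have "(\<Oplus>\<^bsub>FQ\<^esub>v\<in>verts G. word \<one> [x] \<otimes>\<^bsub>FQ\<^esub> word \<one> [Vertex v]) =
      (\<Oplus>\<^bsub>FQ\<^esub>v\<in>verts G. if ?t = v then word \<one> [x] else \<zero>\<^bsub>FQ\<^esub>)"
    using xc by (intro FQ.add.finprod_cong') auto
  also have "\<dots> = word \<one> [x]"
    using target_word_mult(2)[OF x] xc by (intro FQ.add.finprod_singleton) auto
  finally show ?thesis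
    unfolding one_L using xc vertex_words_closed by (subst FQ.finsum_rdistr) auto
qed

lemma one_L_closed: "\<one>\<^bsub>L\<^esub> \<in> carrier L"
proof -
  let ?E = "\<Oplus>\<^bsub>FA\<^esub>v\<in>verts G. free_gen R (Vertex v)"
  have c: "free_gen R (Vertex u) \<in> carrier FA" if "u \<in> verts G" for u
    using that G.vertex_gens(1) unfolding free_gen_eq_monomial by (auto intro!: monomial_closed)
  have "(\<Oplus>\<^bsub>FA\<^esub>v\<in>V. free_gen R (Vertex v)) \<in> carrier FA \<and> (\<Oplus>\<^bsub>FA\<^esub>v\<in>V. free_gen R (Vertex v)) [] = \<zero>"
    if "finite V" "V \<subseteq> verts G" for V
    using that
  proof (induction V)
    case empty
    then show ?case using FA.zero_closed by (simp add: free_algebra_simps)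
  next
    case (insert v V)
    have "(\<Oplus>\<^bsub>FA\<^esub>v\<in>insert v V. free_gen R (Vertex v)) =
        free_gen R (Vertex v) \<oplus>\<^bsub>FA\<^esub> (\<Oplus>\<^bsub>FA\<^esub>v\<in>V. free_gen R (Vertex v))"
      using insert c by (intro FA.finsum_insert) auto
    moreover have "free_gen R (Vertex v :: ('v, 'e) leavitt_gen) [] = \<zero>" by (simp add: free_gen_def)
    ultimately show ?case using insert c[of v] FA.a_closed by (simp add: free_algebra_simps)
  qed
  then have "?E \<in> carrier FA \<and> ?E [] = \<zero>" by simp
  then show ?thesis unfolding L_simps by blast
qed

lemma L_add_closed: "\<lbrakk>x \<in> carrier L; y \<in> carrier L\<rbrakk> \<Longrightarrow> x \<oplus>\<^bsub>FQ\<^esub> y \<in> carrier L"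
proof -
  assume "x \<in> carrier L" "y \<in> carrier L"
  then obtain p q where pq: "p \<in> carrier FA" "p [] = \<zero>" "x = cls p" "q \<in> carrier FA" "q [] = \<zero>" "y = cls q"
    unfolding L_simps by blast
  have "x \<oplus>\<^bsub>FQ\<^esub> y = cls (p \<oplus>\<^bsub>FA\<^esub> q)" using pq by simp
  moreover have "p \<oplus>\<^bsub>FA\<^esub> q \<in> carrier FA" "(p \<oplus>\<^bsub>FA\<^esub> q) [] = \<zero>"
    using pq FA.a_closed by (simp_all add: free_algebra_simps)
  ultimately show "x \<oplus>\<^bsub>FQ\<^esub> y \<in> carrier L" unfolding L_simps by blast
qed

lemma L_mult_closed: "\<lbrakk>x \<in> carrier FQ; y \<in> carrier L\<rbrakk> \<Longrightarrow> x \<otimes>\<^bsub>FQ\<^esub> y \<in> carrier L"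
proof -
  assume x: "x \<in> carrier FQ" and "y \<in> carrier L"
  then obtain q where q: "q \<in> carrier FA" "q [] = \<zero>" "y = cls q"
    unfolding L_simps by blast
  obtain p where p: "p \<in> carrier FA" "x = cls p"
    using x unfolding FactRing_def A_RCOSETS_def' cls_def by auto
  have "x \<otimes>\<^bsub>FQ\<^esub> y = cls (p \<otimes>\<^bsub>FA\<^esub> q)" using p q by simp
  moreover have "p \<otimes>\<^bsub>FA\<^esub> q \<in> carrier FA" using p q by simp
  moreover have "(p \<otimes>\<^bsub>FA\<^esub> q) [] = \<zero>"
    using p q by (simp add: free_algebra_simps conv_Nil free_algebra_carrier_iff)
  ultimately show "x \<otimes>\<^bsub>FQ\<^esub> y \<in> carrier L" unfolding L_simps by blast
qed

lemma L_zero_closed: "\<zero>\<^bsub>FQ\<^esub> \<in> carrier L"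
  unfolding L_simps using cls_zero FA.zero_closed
  by (intro CollectI exI[of _ "\<zero>\<^bsub>FA\<^esub>"]) (simp add: free_algebra_simps)

text \<open>Scalars act through the central elements \<open>word a []\<close> of \<open>FQ\<close>, which reduces the module laws to
  ring laws of \<open>FQ\<close>.\<close>

lemma smult_L:
  assumes "a \<in> carrier R" "x \<in> carrier L"
  shows "a \<odot>\<^bsub>L\<^esub> x = word a [] \<otimes>\<^bsub>FQ\<^esub> x"
  using assms smult_cls(1) unfolding L_simps(1) by blast

lemma scalar_closed: "a \<in> carrier R \<Longrightarrow> word a [] \<in> carrier FQ"
  by (rule word_closed) auto

lemma scalar_central:
  assumes "a \<in> carrier R" "x \<in> carrier L"
  shows "x \<otimes>\<^bsub>FQ\<^esub> word a [] = word a [] \<otimes>\<^bsub>FQ\<^esub> x"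
proof -
  obtain p where p: "p \<in> carrier FA" "x = cls p" using assms(2) unfolding L_simps by blast
  have m: "monomial R a [] \<in> carrier FA" using assms(1) by (intro monomial_closed) auto
  have "p w \<in> carrier R" for w using p(1) by (simp add: free_algebra_carrier_iff)
  then have "conv R p (monomial R a []) = conv R (monomial R a []) p"
    using assms(1) by (simp add: fun_eq_iff conv_monomial_left conv_monomial_right m_comm)
  then show ?thesis
    using cls.hom_mult[OF p(1) m] cls.hom_mult[OF m p(1)] p(2) by (simp add: free_algebra_simps)
qed

lemma one_L_left: "x \<in> carrier L \<Longrightarrow> \<one>\<^bsub>L\<^esub> \<otimes>\<^bsub>FQ\<^esub> x = x"
proof (induction rule: L_induct)
  case zero
  then show ?case using L_in_FQ[OF one_L_closed] by (simp add: L_simps(4))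
next
  case (word c y w)
  have eq: "word c (y # w) = word \<one> [y] \<otimes>\<^bsub>FQ\<^esub> word c w" using word by (subst word_mult) auto
  have "word \<one> [y] \<in> carrier FQ" "word c w \<in> carrier FQ" using word by (auto intro!: word_closed)
  then show ?case unfolding eq using one_L_mult_gen[OF word(2)] L_in_FQ[OF one_L_closed]
    by (simp flip: FQ.m_assoc)
next
  case (add x y)
  then show ?case using L_in_FQ one_L_closed by (simp add: L_simps(3) FQ.r_distr)
qed

lemma one_L_right: "x \<in> carrier L \<Longrightarrow> x \<otimes>\<^bsub>FQ\<^esub> \<one>\<^bsub>L\<^esub> = x"
proof (induction rule: L_induct)
  case zero
  then show ?case using L_in_FQ[OF one_L_closed] by (simp add: L_simps(4))
next
  case (word c y w)
  obtain u z where uz: "y # w = u @ [z]" by (metis append_butlast_last_id list.distinct(1))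
  then have "u @ [z] \<in> lists (leavitt_gens G)" using word by (metis Cons_in_lists_iff)
  then have u: "u \<in> lists (leavitt_gens G)" "z \<in> leavitt_gens G" by auto
  have eq: "word c (u @ [z]) = word c u \<otimes>\<^bsub>FQ\<^esub> word \<one> [z]" using word u by (subst word_mult) auto
  have "word \<one> [z] \<in> carrier FQ" "word c u \<in> carrier FQ" using word u by (auto intro!: word_closed)
  then show ?case unfolding uz eq using gen_mult_one_L[OF u(2)] L_in_FQ[OF one_L_closed]
    by (simp add: FQ.m_assoc)
next
  case (add x y)
  then show ?case using L_in_FQ one_L_closed by (simp add: L_simps(3) FQ.l_distr)
qed

text \<open>Everything is inherited from \<open>FQ\<close> except for the identity: that of \<open>FQ\<close> is the class of the empty
  word, that of \<open>L\<close> is the sum of the vertices.\<close>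

lemma L_ring: "ring L"
proof (rule ringI)
  show "abelian_group L"
  proof (rule abelian_groupI)
    fix x y assume "x \<in> carrier L" "y \<in> carrier L"
    then show "x \<oplus>\<^bsub>L\<^esub> y \<in> carrier L" "x \<oplus>\<^bsub>L\<^esub> y = y \<oplus>\<^bsub>L\<^esub> x"
      using L_add_closed L_in_FQ by (simp_all add: L_simps(3) FQ.a_comm)
  next
    show "\<zero>\<^bsub>L\<^esub> \<in> carrier L" using L_zero_closed by (simp add: L_simps(4))
  next
    fix x y z assume "x \<in> carrier L" "y \<in> carrier L" "z \<in> carrier L"
    then show "x \<oplus>\<^bsub>L\<^esub> y \<oplus>\<^bsub>L\<^esub> z = x \<oplus>\<^bsub>L\<^esub> (y \<oplus>\<^bsub>L\<^esub> z)"
      using L_in_FQ by (simp add: L_simps(3) FQ.a_assoc)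
  next
    fix x assume x: "x \<in> carrier L"
    then show "\<zero>\<^bsub>L\<^esub> \<oplus>\<^bsub>L\<^esub> x = x" using L_in_FQ by (simp add: L_simps(3,4))
    have "(\<ominus>\<^bsub>FQ\<^esub> \<one>\<^bsub>FQ\<^esub>) \<otimes>\<^bsub>FQ\<^esub> x \<in> carrier L" using L_mult_closed x by simp
    then show "\<exists>y\<in>carrier L. y \<oplus>\<^bsub>L\<^esub> x = \<zero>\<^bsub>L\<^esub>"
      using L_in_FQ[OF x] by (intro bexI) (simp_all add: L_simps(3,4) FQ.l_minus FQ.l_neg)
  qed
  show "monoid L"
    by (rule monoidI)
      (use one_L_closed one_L_left one_L_right L_mult_closed L_in_FQ in \<open>simp_all add: L_simps(2) FQ.m_assoc\<close>)
qed (use L_in_FQ in \<open>simp_all add: L_simps(2,3) FQ.l_distr FQ.r_distr\<close>)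

lemma L_module: "module R L"
proof (rule moduleI)
  show "cring R" by (rule cring_axioms)
  show "abelian_group L" by (rule ring.is_abelian_group[OF L_ring])
  fix a x assume a: "a \<in> carrier R" and x: "x \<in> carrier L"
  show "a \<odot>\<^bsub>L\<^esub> x \<in> carrier L"
    unfolding smult_L[OF a x] by (rule L_mult_closed[OF scalar_closed[OF a] x])
  fix b assume b: "b \<in> carrier R"
  have "word (a \<oplus> b) [] = word a [] \<oplus>\<^bsub>FQ\<^esub> word b []"
  proof -
    have "monomial R (a \<oplus> b) [] = monomial R a [] \<oplus>\<^bsub>FA\<^esub> monomial R b []"
      using a b by (auto simp: free_algebra_simps monomial_def)
    then show ?thesis using a b by (simp add: monomial_closed)
  qed
  then show "(a \<oplus> b) \<odot>\<^bsub>L\<^esub> x = a \<odot>\<^bsub>L\<^esub> x \<oplus>\<^bsub>L\<^esub> b \<odot>\<^bsub>L\<^esub> x"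
    using a b x by (simp add: smult_L L_simps(3) FQ.l_distr scalar_closed L_in_FQ)
  have "word (a \<otimes> b) [] = word a [] \<otimes>\<^bsub>FQ\<^esub> word b []" using a b by (simp add: word_mult)
  then show "(a \<otimes> b) \<odot>\<^bsub>L\<^esub> x = a \<odot>\<^bsub>L\<^esub> (b \<odot>\<^bsub>L\<^esub> x)"
    using a b x L_mult_closed[OF scalar_closed[OF b] x]
    by (simp add: smult_L FQ.m_assoc scalar_closed L_in_FQ)
next
  fix a x y assume a: "a \<in> carrier R" and x: "x \<in> carrier L" and y: "y \<in> carrier L"
  show "a \<odot>\<^bsub>L\<^esub> (x \<oplus>\<^bsub>L\<^esub> y) = a \<odot>\<^bsub>L\<^esub> x \<oplus>\<^bsub>L\<^esub> a \<odot>\<^bsub>L\<^esub> y"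
    using a x y L_add_closed[OF x y] by (simp add: smult_L L_simps(3) FQ.r_distr scalar_closed L_in_FQ)
next
  fix x assume x: "x \<in> carrier L"
  have "word \<one> [] = \<one>\<^bsub>FQ\<^esub>" using cls.hom_one by (simp add: free_algebra_simps)
  then show "\<one> \<odot>\<^bsub>L\<^esub> x = x" using x by (simp add: smult_L L_in_FQ)
qed

lemma L_smult_mult:
  assumes "a \<in> carrier R" "x \<in> carrier L" "y \<in> carrier L"
  shows "(a \<odot>\<^bsub>L\<^esub> x) \<otimes>\<^bsub>L\<^esub> y = a \<odot>\<^bsub>L\<^esub> (x \<otimes>\<^bsub>L\<^esub> y)" "x \<otimes>\<^bsub>L\<^esub> (a \<odot>\<^bsub>L\<^esub> y) = a \<odot>\<^bsub>L\<^esub> (x \<otimes>\<^bsub>L\<^esub> y)"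
proof -
  have s: "a \<odot>\<^bsub>L\<^esub> (x \<otimes>\<^bsub>L\<^esub> y) = word a [] \<otimes>\<^bsub>FQ\<^esub> (x \<otimes>\<^bsub>FQ\<^esub> y)"
    using assms L_mult_closed L_in_FQ by (simp add: smult_L L_simps(2))
  note cl = scalar_closed[OF assms(1)] L_in_FQ[OF assms(2)] L_in_FQ[OF assms(3)]
  show "(a \<odot>\<^bsub>L\<^esub> x) \<otimes>\<^bsub>L\<^esub> y = a \<odot>\<^bsub>L\<^esub> (x \<otimes>\<^bsub>L\<^esub> y)"
    unfolding s using assms cl by (simp add: smult_L L_simps(2) FQ.m_assoc)
  have "x \<otimes>\<^bsub>FQ\<^esub> (word a [] \<otimes>\<^bsub>FQ\<^esub> y) = (x \<otimes>\<^bsub>FQ\<^esub> word a []) \<otimes>\<^bsub>FQ\<^esub> y"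
    using cl by (simp add: FQ.m_assoc)
  also have "\<dots> = word a [] \<otimes>\<^bsub>FQ\<^esub> (x \<otimes>\<^bsub>FQ\<^esub> y)"
    unfolding scalar_central[OF assms(1,2)] using cl by (simp add: FQ.m_assoc)
  finally show "x \<otimes>\<^bsub>L\<^esub> (a \<odot>\<^bsub>L\<^esub> y) = a \<odot>\<^bsub>L\<^esub> (x \<otimes>\<^bsub>L\<^esub> y)"
    unfolding s using assms by (simp add: smult_L L_simps(2))
qed

end

section \<open>Nontriviality\<close>

text \<open>
  \<open>idx\<close> numbers the arrows out of each vertex. A state is a vertex together with a natural number;
  the states over a vertex with \<open>m\<close> outgoing arrows are divided by residues modulo \<open>m\<close> into \<open>m\<close>
  copies of \<open>\<nat>\<close>, and an arrow is the bijection from the states over its head to its copy over its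
  tail. This is a branching system, so that the defining relations hold.
\<close>

fun branching_step :: "('v, 'e) pre_digraph \<Rightarrow> ('e \<Rightarrow> nat) \<Rightarrow> ('v, 'e) leavitt_gen \<Rightarrow> 'v \<times> nat \<Rightarrow> ('v \<times> nat) option" where
  "branching_step G idx (Vertex v) (u, n) = (if u = v then Some (u, n) else None)"
| "branching_step G idx (Arrow e) (u, n) =
    (if u = head G e then Some (tail G e, n * card (out_arcs G (tail G e)) + idx e) else None)"
| "branching_step G idx (Ghost e) (u, n) =
    (if u = tail G e \<and> n mod card (out_arcs G u) = idx e then Some (head G e, n div card (out_arcs G u)) else None)"

fun word_action :: "('v, 'e) pre_digraph \<Rightarrow> ('e \<Rightarrow> nat) \<Rightarrow> ('v, 'e) leavitt_gen list \<Rightarrow> 'v \<times> nat \<Rightarrow> ('v \<times> nat) option" where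
  "word_action G idx [] s = Some s"
| "word_action G idx (x # w) s = Option.bind (word_action G idx w s) (branching_step G idx x)"

lemma word_action_append: "word_action G idx (u @ v) s = Option.bind (word_action G idx v s) (word_action G idx u)"
  by (induction u) (auto split: Option.bind_splits)

locale branching = leavitt R G for R :: "('r, 'm) ring_scheme" (structure) and G :: "('v, 'e) pre_digraph" +
  fixes idx :: "'e \<Rightarrow> nat"
  assumes idx: "bij_betw idx (out_arcs G v) {..<card (out_arcs G v)}"
begin

definition val :: "('v \<times> nat \<Rightarrow> 'r) \<Rightarrow> ('v \<times> nat) option \<Rightarrow> 'r" where
  "val f t = (case t of None \<Rightarrow> \<zero> | Some s \<Rightarrow> f s)"

text \<open>A word \<open>w\<close> sends the function \<open>f\<close> to \<open>\<lambda>s. f (w s)\<close>. This is the value at \<open>s\<close> of what \<open>p\<close> makes of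
  \<open>f\<close>.\<close>

definition eval_at :: "('v \<times> nat \<Rightarrow> 'r) \<Rightarrow> 'v \<times> nat \<Rightarrow> (('v, 'e) leavitt_gen list \<Rightarrow> 'r) \<Rightarrow> 'r" where
  "eval_at f s p = (\<Oplus>w\<in>{w. p w \<noteq> \<zero>}. p w \<otimes> val f (word_action G idx w s))"

lemma val_closed: "f \<in> UNIV \<rightarrow> carrier R \<Longrightarrow> val f t \<in> carrier R"
  by (cases t) (auto simp: val_def)

lemma val_comp_closed: "f \<in> UNIV \<rightarrow> carrier R \<Longrightarrow> (\<lambda>t. val f (g t)) \<in> UNIV \<rightarrow> carrier R"
  using val_closed by blast

lemma val_bind: "val (\<lambda>t. val f (word_action G idx u t)) x = val f (Option.bind x (word_action G idx u))"
  by (cases x) (auto simp: val_def)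

lemma eval_at_superset:
  assumes "f \<in> UNIV \<rightarrow> carrier R" "p \<in> carrier FA" "finite W" "{w. p w \<noteq> \<zero>} \<subseteq> W"
  shows "eval_at f s p = (\<Oplus>w\<in>W. p w \<otimes> val f (word_action G idx w s))"
  unfolding eval_at_def
  using assms val_closed[OF assms(1)]
  by (intro add.finprod_mono_neutral_cong_left) (auto simp: free_algebra_carrier_iff)

lemma eval_at_closed:
  assumes "f \<in> UNIV \<rightarrow> carrier R" "p \<in> carrier FA"
  shows "eval_at f s p \<in> carrier R"
  unfolding eval_at_def using assms val_closed[OF assms(1)]
  by (intro finsum_closed) (auto simp: free_algebra_carrier_iff)

lemma eval_at_zero: "eval_at f s (\<lambda>w. \<zero>) = \<zero>"
  unfolding eval_at_def by simp

lemma eval_at_monomial: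
  assumes "f \<in> UNIV \<rightarrow> carrier R" "c \<in> carrier R" "w \<in> lists (leavitt_gens G)"
  shows "eval_at f s (monomial R c w) = c \<otimes> val f (word_action G idx w s)"
proof -
  have "eval_at f s (monomial R c w) = (\<Oplus>v\<in>{w}. monomial R c w v \<otimes> val f (word_action G idx v s))"
    using assms by (intro eval_at_superset monomial_closed) (auto simp: monomial_def)
  then show ?thesis using assms val_closed[OF assms(1)] by (simp add: monomial_def)
qed

lemma eval_at_add:
  assumes f: "f \<in> UNIV \<rightarrow> carrier R" and p: "p \<in> carrier FA" and q: "q \<in> carrier FA"
  shows "eval_at f s (\<lambda>w. p w \<oplus> q w) = eval_at f s p \<oplus> eval_at f s q"
proof -
  let ?W = "{w. p w \<noteq> \<zero>} \<union> {w. q w \<noteq> \<zero>}"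
  have cl: "p w \<in> carrier R" "q w \<in> carrier R" for w using p q by (auto simp: free_algebra_carrier_iff)
  have fin: "finite ?W" using p q by (simp add: free_algebra_carrier_iff)
  have pq: "(\<lambda>w. p w \<oplus> q w) \<in> carrier FA" using FA.a_closed[OF p q] by (simp add: free_algebra_simps)
  have "eval_at f s (\<lambda>w. p w \<oplus> q w) = (\<Oplus>w\<in>?W. (p w \<oplus> q w) \<otimes> val f (word_action G idx w s))"
    using f pq fin by (rule eval_at_superset) auto
  also have "\<dots> = (\<Oplus>w\<in>?W. p w \<otimes> val f (word_action G idx w s) \<oplus> q w \<otimes> val f (word_action G idx w s))"
    using cl val_closed[OF f] by (simp add: l_distr)
  also have "\<dots> = (\<Oplus>w\<in>?W. p w \<otimes> val f (word_action G idx w s)) \<oplus> (\<Oplus>w\<in>?W. q w \<otimes> val f (word_action G idx w s))"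
    using cl val_closed[OF f] by (intro finsum_addf) auto
  also have "(\<Oplus>w\<in>?W. p w \<otimes> val f (word_action G idx w s)) = eval_at f s p"
    using f p fin by (rule eval_at_superset[symmetric]) auto
  also have "(\<Oplus>w\<in>?W. q w \<otimes> val f (word_action G idx w s)) = eval_at f s q"
    using f q fin by (rule eval_at_superset[symmetric]) auto
  finally show ?thesis .
qed

lemma eval_at_finsum:
  assumes f: "f \<in> UNIV \<rightarrow> carrier R" and fin: "finite I" and p: "\<And>i. i \<in> I \<Longrightarrow> p i \<in> carrier FA"
  shows "eval_at f s (\<Oplus>\<^bsub>FA\<^esub>i\<in>I. p i) = (\<Oplus>i\<in>I. eval_at f s (p i))"
  using fin p
proof (induction I)
  case empty
  then show ?case using eval_at_zero by (simp add: free_algebra_simps(3))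
next
  case (insert i I)
  have sum: "(\<Oplus>\<^bsub>FA\<^esub>i\<in>I. p i) \<in> carrier FA" using insert by (intro FA.finsum_closed) auto
  have "(\<Oplus>\<^bsub>FA\<^esub>i\<in>insert i I. p i) = p i \<oplus>\<^bsub>FA\<^esub> (\<Oplus>\<^bsub>FA\<^esub>i\<in>I. p i)"
    using insert by (intro FA.finsum_insert) auto
  then have "eval_at f s (\<Oplus>\<^bsub>FA\<^esub>i\<in>insert i I. p i) = eval_at f s (p i) \<oplus> (\<Oplus>i\<in>I. eval_at f s (p i))"
    using insert sum eval_at_add[OF f, of "p i" "\<Oplus>\<^bsub>FA\<^esub>i\<in>I. p i" s] by (simp add: free_algebra_simps(4))
  also have "\<dots> = (\<Oplus>i\<in>insert i I. eval_at f s (p i))"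
    using insert eval_at_closed[OF f] by (intro finsum_insert[symmetric]) auto
  finally show ?case .
qed

lemma eval_at_diff:
  assumes f: "f \<in> UNIV \<rightarrow> carrier R" and p: "p \<in> carrier FA" and q: "q \<in> carrier FA"
    and eq: "eval_at f s p = eval_at f s q"
  shows "eval_at f s (p \<ominus>\<^bsub>FA\<^esub> q) = \<zero>"
proof -
  have d: "p \<ominus>\<^bsub>FA\<^esub> q \<in> carrier FA" using p q by simp
  have "(p \<ominus>\<^bsub>FA\<^esub> q) \<oplus>\<^bsub>FA\<^esub> q = p" using p q by (simp add: FA.minus_eq FA.a_assoc FA.l_neg)
  then have "eval_at f s (p \<ominus>\<^bsub>FA\<^esub> q) \<oplus> eval_at f s q = eval_at f s q"
    using eval_at_add[OF f d q, of s] eq by (simp add: free_algebra_simps(4))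
  then show ?thesis using eval_at_closed[OF f d] eval_at_closed[OF f q] by (simp add: add.r_cancel_one)
qed

text \<open>The words of a product act in turn, the right factor first: a factor on the left changes the function,
  one on the right changes the state.\<close>

lemma eval_at_monomial_left:
  assumes f: "f \<in> UNIV \<rightarrow> carrier R" and c: "c \<in> carrier R" and u: "u \<in> lists (leavitt_gens G)"
    and p: "p \<in> carrier FA"
  shows "eval_at f s (monomial R c u \<otimes>\<^bsub>FA\<^esub> p) = c \<otimes> eval_at (\<lambda>t. val f (word_action G idx u t)) s p"
  using p
proof (induction rule: free_algebra_induct)
  case zero
  have m: "monomial R c u \<in> carrier FA" using c u by (rule monomial_closed)
  then have "monomial R c u \<otimes>\<^bsub>FA\<^esub> \<zero>\<^bsub>FA\<^esub> = \<zero>\<^bsub>FA\<^esub>" by simp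
  then show ?case using c by (simp add: free_algebra_simps eval_at_zero)
next
  case (monomial d w)
  have "u @ w \<in> lists (leavitt_gens G)" using u monomial by simp
  then show ?case
    using f c monomial val_closed[OF f] val_comp_closed[OF f]
    by (simp add: free_algebra_simps(1) monomial_mult eval_at_monomial word_action_append val_bind m_assoc)
next
  case (add p q)
  have m: "monomial R c u \<in> carrier FA" using c u by (rule monomial_closed)
  have "monomial R c u \<otimes>\<^bsub>FA\<^esub> (p \<oplus>\<^bsub>FA\<^esub> q) = monomial R c u \<otimes>\<^bsub>FA\<^esub> p \<oplus>\<^bsub>FA\<^esub> monomial R c u \<otimes>\<^bsub>FA\<^esub> q"
    using m add by (simp add: FA.r_distr)
  then show ?case
    using add eval_at_add[OF f FA.m_closed[OF m add(1)] FA.m_closed[OF m add(2)], of s]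
      eval_at_add[OF val_comp_closed[OF f] add(1,2), of "word_action G idx u" s] eval_at_closed[OF val_comp_closed[OF f, of "word_action G idx u"]] c
    by (simp add: free_algebra_simps(4) r_distr)
qed

lemma eval_at_monomial_right:
  assumes f: "f \<in> UNIV \<rightarrow> carrier R" and c: "c \<in> carrier R" and u: "u \<in> lists (leavitt_gens G)"
    and p: "p \<in> carrier FA"
  shows "eval_at f s (p \<otimes>\<^bsub>FA\<^esub> monomial R c u) = val (\<lambda>t. eval_at f t p) (word_action G idx u s) \<otimes> c"
  using p
proof (induction rule: free_algebra_induct)
  case zero
  have m: "monomial R c u \<in> carrier FA" using c u by (rule monomial_closed)
  then have "\<zero>\<^bsub>FA\<^esub> \<otimes>\<^bsub>FA\<^esub> monomial R c u = \<zero>\<^bsub>FA\<^esub>" by simp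
  then show ?case using c by (cases "word_action G idx u s") (simp_all add: free_algebra_simps eval_at_zero val_def)
next
  case (monomial d w)
  have "w @ u \<in> lists (leavitt_gens G)" using u monomial by simp
  then have eq: "eval_at f s (monomial R d w \<otimes>\<^bsub>FA\<^esub> monomial R c u) =
      d \<otimes> c \<otimes> val f (Option.bind (word_action G idx u s) (word_action G idx w))"
    using f c monomial by (simp add: free_algebra_simps(1) monomial_mult eval_at_monomial word_action_append)
  show ?case
  proof (cases "word_action G idx u s")
    case None
    then show ?thesis unfolding eq using c monomial by (simp add: val_def)
  next
    case (Some t)
    have "d \<otimes> c \<otimes> val f (word_action G idx w t) = d \<otimes> val f (word_action G idx w t) \<otimes> c"
      using c monomial val_closed[OF f] by (simp add: m_ac)
    moreover have "val (\<lambda>t. eval_at f t (monomial R d w)) (Some t) = d \<otimes> val f (word_action G idx w t)"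
      using f monomial eval_at_monomial[of f d w t] by (simp add: val_def)
    ultimately show ?thesis unfolding eq Some by simp
  qed
next
  case (add p q)
  have m: "monomial R c u \<in> carrier FA" using c u by (rule monomial_closed)
  have "(p \<oplus>\<^bsub>FA\<^esub> q) \<otimes>\<^bsub>FA\<^esub> monomial R c u = p \<otimes>\<^bsub>FA\<^esub> monomial R c u \<oplus>\<^bsub>FA\<^esub> q \<otimes>\<^bsub>FA\<^esub> monomial R c u"
    using m add by (simp add: FA.l_distr)
  then have "eval_at f s ((p \<oplus>\<^bsub>FA\<^esub> q) \<otimes>\<^bsub>FA\<^esub> monomial R c u) =
      val (\<lambda>t. eval_at f t p) (word_action G idx u s) \<otimes> c \<oplus> val (\<lambda>t. eval_at f t q) (word_action G idx u s) \<otimes> c"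
    using add eval_at_add[OF f FA.m_closed[OF add(1) m] FA.m_closed[OF add(2) m], of s]
    by (simp add: free_algebra_simps(4))
  also have "\<dots> = val (\<lambda>t. eval_at f t p \<oplus> eval_at f t q) (word_action G idx u s) \<otimes> c"
    using eval_at_closed[OF f add(1)] eval_at_closed[OF f add(2)] c
    by (cases "word_action G idx u s") (simp_all add: val_def l_distr)
  finally show ?case
    using eval_at_add[OF f add(1,2)] by (simp add: free_algebra_simps(4))
qed

lemma idx_less: "e \<in> arcs G \<Longrightarrow> idx e < card (out_arcs G (tail G e))"
  using bij_betwE[OF idx[of "tail G e"]] by (auto simp: out_arcs_def)

lemma idx_inj: "\<lbrakk>e \<in> arcs G; f \<in> arcs G; tail G e = tail G f; idx e = idx f\<rbrakk> \<Longrightarrow> e = f"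
  using bij_betw_imp_inj_on[OF idx[of "tail G e"]] by (auto simp: out_arcs_def inj_on_def)

lemma act_CK1:
  assumes "e \<in> arcs G" "f \<in> arcs G"
  shows "word_action G idx [Ghost e, Arrow f] s = (if e = f then word_action G idx [Vertex (head G e)] s else None)"
  using idx_less[OF assms(2)] idx_inj[OF assms] by (cases s) auto

lemma act_CK2:
  assumes "e \<in> out_arcs G v"
  shows "word_action G idx [Arrow e, Ghost e] (u, n) = (if u = v \<and> n mod card (out_arcs G v) = idx e then Some (u, n) else None)"
  using assms by (auto simp: out_arcs_def) (metis div_mult_mod_eq)

lemma gen_words_closed:
  assumes "x \<in> leavitt_gens G"
  shows "free_gen R x \<in> carrier FA"
  using assms unfolding free_gen_eq_monomial by (auto intro!: monomial_closed)

lemma eval_at_gen: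
  assumes "f \<in> UNIV \<rightarrow> carrier R" "x \<in> leavitt_gens G"
  shows "eval_at f s (free_gen R x) = val f (word_action G idx [x] s)"
  using assms val_closed[OF assms(1)] unfolding free_gen_eq_monomial by (simp add: eval_at_monomial)

lemma eval_at_gen_mult:
  assumes "f \<in> UNIV \<rightarrow> carrier R" "x \<in> leavitt_gens G" "y \<in> leavitt_gens G"
  shows "eval_at f s (free_gen R x \<otimes>\<^bsub>FA\<^esub> free_gen R y) = val f (word_action G idx [x, y] s)"
  using assms val_closed[OF assms(1)] unfolding free_gen_eq_monomial
  by (simp add: free_algebra_simps(1) monomial_mult eval_at_monomial)

text \<open>Among the arrows out of \<open>v\<close>, exactly one is numbered by the residue of \<open>n\<close>; its ghost is the only one
  that is defined at the state \<open>(v, n)\<close>.\<close>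

lemma eval_at_CK2_sum:
  assumes f: "f \<in> UNIV \<rightarrow> carrier R" and v: "v \<in> verts G" and ne: "out_arcs G v \<noteq> {}"
  shows "(\<Oplus>e\<in>out_arcs G v. val f (word_action G idx [Arrow e, Ghost e] s)) = val f (word_action G idx [Vertex v] s)"
proof -
  obtain u n where s: "s = (u, n)" by fastforce
  let ?m = "card (out_arcs G v)"
  have fin: "finite (out_arcs G v)"
    by (rule finite_subset[of _ "arcs G"]) (auto simp: out_arcs_def)
  show ?thesis
  proof (cases "u = v")
    case True
    have "0 < ?m" using ne fin by (simp add: card_gt_0_iff)
    then have "n mod ?m \<in> idx ` out_arcs G v" using bij_betw_imp_surj_on[OF idx[of v]] by simp
    then obtain e0 where e0: "e0 \<in> out_arcs G v" "idx e0 = n mod ?m" by auto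
    have iff: "n mod ?m = idx e \<longleftrightarrow> e0 = e" if "e \<in> out_arcs G v" for e
      using that e0 bij_betw_imp_inj_on[OF idx[of v]] by (auto simp: inj_on_def)
    have "(\<Oplus>e\<in>out_arcs G v. val f (word_action G idx [Arrow e, Ghost e] s)) = (\<Oplus>e\<in>out_arcs G v. if e0 = e then f s else \<zero>)"
    proof (rule add.finprod_cong')
      fix e assume "e \<in> out_arcs G v"
      then show "val f (word_action G idx [Arrow e, Ghost e] s) = (if e0 = e then f s else \<zero>)"
        using act_CK2[of e v u n] iff True unfolding s val_def by simp
    qed (use f in auto)
    also have "\<dots> = f s" using e0 fin f by (intro add.finprod_singleton) auto
    also have "\<dots> = val f (word_action G idx [Vertex v] s)" using True unfolding s val_def by simp
    finally show ?thesis .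
  next
    case False
    have "(\<Oplus>e\<in>out_arcs G v. val f (word_action G idx [Arrow e, Ghost e] s)) = \<zero>"
    proof (rule add.finprod_one_eqI)
      fix e assume "e \<in> out_arcs G v"
      then show "val f (word_action G idx [Arrow e, Ghost e] s) = \<zero>"
        using act_CK2[of e v u n] False unfolding s val_def by simp
    qed
    then show ?thesis using False unfolding s val_def by simp
  qed
qed

lemma eval_at_relation:
  assumes f: "f \<in> UNIV \<rightarrow> carrier R" and r: "r \<in> leavitt_relations R G"
  shows "eval_at f s r = \<zero>"
proof -
  obtain u n where s: "s = (u, n)" by fastforce
  from r show ?thesis
  proof (cases rule: leavitt_relations_cases)
    case (vertices v w)
    show ?thesis unfolding vertices(3)
    proof (rule eval_at_diff[OF f])
      show "eval_at f s (free_gen R (Vertex v) \<otimes>\<^bsub>FA\<^esub> free_gen R (Vertex w)) =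
          eval_at f s (if v = w then free_gen R (Vertex v) else \<zero>\<^bsub>FA\<^esub>)"
        using vertices(1,2) G.vertex_gens(1) f
        by (auto simp: eval_at_gen eval_at_gen_mult eval_at_zero free_algebra_simps(3) s val_def)
    qed (use vertices(1,2) G.vertex_gens(1) gen_words_closed in auto)
  next
    case (source x)
    have x: "x \<in> leavitt_gens G" "Vertex (gen_source G x) \<in> leavitt_gens G"
      using source(1) G.vertex_gens by auto
    show ?thesis unfolding source(2)
    proof (rule eval_at_diff[OF f])
      show "eval_at f s (free_gen R (Vertex (gen_source G x)) \<otimes>\<^bsub>FA\<^esub> free_gen R x) = eval_at f s (free_gen R x)"
        using x f by (cases x) (auto simp: eval_at_gen eval_at_gen_mult s)
    qed (use x gen_words_closed in auto)
  next
    case (target x)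
    have x: "x \<in> leavitt_gens G" "Vertex (gen_target G x) \<in> leavitt_gens G"
      using target(1) G.vertex_gens by auto
    show ?thesis unfolding target(2)
    proof (rule eval_at_diff[OF f])
      show "eval_at f s (free_gen R x \<otimes>\<^bsub>FA\<^esub> free_gen R (Vertex (gen_target G x))) = eval_at f s (free_gen R x)"
        using x f by (cases x) (auto simp: eval_at_gen eval_at_gen_mult s)
    qed (use x gen_words_closed in auto)
  next
    case (CK1 e e')
    have x: "Ghost e \<in> leavitt_gens G" "Arrow e' \<in> leavitt_gens G" "Vertex (head G e) \<in> leavitt_gens G"
      using CK1(1,2) G.vertex_gens by auto
    show ?thesis unfolding CK1(3)
    proof (rule eval_at_diff[OF f])
      show "eval_at f s (free_gen R (Ghost e) \<otimes>\<^bsub>FA\<^esub> free_gen R (Arrow e')) =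
          eval_at f s (if e = e' then free_gen R (Vertex (head G e)) else \<zero>\<^bsub>FA\<^esub>)"
      proof -
        have "eval_at f s (free_gen R (Ghost e) \<otimes>\<^bsub>FA\<^esub> free_gen R (Arrow e')) = val f (word_action G idx [Ghost e, Arrow e'] s)"
          by (rule eval_at_gen_mult[OF f x(1,2)])
        also have "\<dots> = eval_at f s (if e = e' then free_gen R (Vertex (head G e)) else \<zero>\<^bsub>FA\<^esub>)"
          unfolding act_CK1[OF CK1(1,2)]
          by (cases "e = e'") (use x in \<open>simp_all add: eval_at_gen[OF f] eval_at_zero free_algebra_simps(3) val_def\<close>)
        finally show ?thesis .
      qed
    qed (use x gen_words_closed in auto)
  next
    case (CK2 v)
    have x: "Arrow e \<in> leavitt_gens G" "Ghost e \<in> leavitt_gens G" if "e \<in> out_arcs G v" for e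
      using that G.vertex_gens by (auto simp: out_arcs_def)
    have v: "Vertex v \<in> leavitt_gens G" using CK2(1) G.vertex_gens by auto
    have c: "free_gen R (Arrow e) \<otimes>\<^bsub>FA\<^esub> free_gen R (Ghost e) \<in> carrier FA" if "e \<in> out_arcs G v" for e
      using x[OF that] gen_words_closed by simp
    show ?thesis unfolding CK2(4)
    proof (rule eval_at_diff[OF f])
      have "eval_at f s (\<Oplus>\<^bsub>FA\<^esub>e\<in>out_arcs G v. free_gen R (Arrow e) \<otimes>\<^bsub>FA\<^esub> free_gen R (Ghost e)) =
          (\<Oplus>e\<in>out_arcs G v. eval_at f s (free_gen R (Arrow e) \<otimes>\<^bsub>FA\<^esub> free_gen R (Ghost e)))"
        by (rule eval_at_finsum[OF f CK2(2) c])
      also have "\<dots> = (\<Oplus>e\<in>out_arcs G v. val f (word_action G idx [Arrow e, Ghost e] s))"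
        using eval_at_gen_mult[OF f x] val_closed[OF f] by (intro add.finprod_cong') auto
      also have "\<dots> = eval_at f s (free_gen R (Vertex v))"
        unfolding eval_at_CK2_sum[OF f CK2(1,3)] using eval_at_gen[OF f v] by simp
      finally show "eval_at f s (free_gen R (Vertex v)) =
          eval_at f s (\<Oplus>\<^bsub>FA\<^esub>e\<in>out_arcs G v. free_gen R (Arrow e) \<otimes>\<^bsub>FA\<^esub> free_gen R (Ghost e))" ..
    qed (use v c gen_words_closed in \<open>auto intro!: FA.finsum_closed\<close>)
  qed
qed

text \<open>By the product rules, the elements that vanish for all \<open>f\<close> at all states form an ideal.\<close>

lemma eval_at_ideal:
  assumes "p \<in> leavitt_ideal R G" and "f \<in> UNIV \<rightarrow> carrier R"
  shows "eval_at f s p = \<zero>"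
proof -
  define I where "I = {p \<in> carrier FA. \<forall>f s. f \<in> UNIV \<rightarrow> carrier R \<longrightarrow> eval_at f s p = \<zero>}"
  have "ideal I FA"
  proof (rule free_algebra_idealI)
    show "I \<subseteq> carrier FA" unfolding I_def by blast
    show "\<zero>\<^bsub>FA\<^esub> \<in> I" unfolding I_def using FA.zero_closed by (simp add: free_algebra_simps(3) eval_at_zero)
    show "p \<oplus>\<^bsub>FA\<^esub> q \<in> I" if "p \<in> I" "q \<in> I" for p q
    proof -
      have "p \<in> carrier FA" "q \<in> carrier FA" using that unfolding I_def by auto
      moreover have "eval_at f s (p \<oplus>\<^bsub>FA\<^esub> q) = \<zero>" if f: "f \<in> UNIV \<rightarrow> carrier R" for f s
      proof -
        have "eval_at f s p = \<zero>" "eval_at f s q = \<zero>"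
          using f \<open>p \<in> I\<close> \<open>q \<in> I\<close> unfolding I_def by blast+
        then show ?thesis using eval_at_add[OF f calculation, of s] by (simp add: free_algebra_simps(4))
      qed
      ultimately show ?thesis using FA.a_closed unfolding I_def by blast
    qed
    fix c u p assume c: "c \<in> carrier R" and u: "u \<in> lists (leavitt_gens G)" and p: "p \<in> I"
    have pc: "p \<in> carrier FA" and p0: "\<And>f s. f \<in> UNIV \<rightarrow> carrier R \<Longrightarrow> eval_at f s p = \<zero>"
      using p unfolding I_def by auto
    have m: "monomial R c u \<in> carrier FA" using c u by (rule monomial_closed)
    have "eval_at f s (monomial R c u \<otimes>\<^bsub>FA\<^esub> p) = \<zero>" if f: "f \<in> UNIV \<rightarrow> carrier R" for f s
      unfolding eval_at_monomial_left[OF f c u pc] using p0[OF val_comp_closed[OF f]] c by simp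
    then show "monomial R c u \<otimes>\<^bsub>FA\<^esub> p \<in> I" using FA.m_closed[OF m pc] unfolding I_def by blast
    have "eval_at f s (p \<otimes>\<^bsub>FA\<^esub> monomial R c u) = \<zero>" if f: "f \<in> UNIV \<rightarrow> carrier R" for f s
      unfolding eval_at_monomial_right[OF f c u pc] using p0[OF f] c
      by (cases "word_action G idx u s") (simp_all add: val_def)
    then show "p \<otimes>\<^bsub>FA\<^esub> monomial R c u \<in> I" using FA.m_closed[OF pc m] unfolding I_def by blast
  qed
  moreover have "leavitt_relations R G \<subseteq> I"
    using relations_closed[OF cring_axioms G.wf_digraph] eval_at_relation unfolding I_def by blast
  ultimately have "leavitt_ideal R G \<subseteq> I" unfolding leavitt_ideal_def by (rule FA.genideal_minimal)
  then show ?thesis using assms unfolding I_def by blast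
qed

text \<open>On the constant function \<open>1\<close>, the sum of the vertices has the value \<open>1\<close> at each state over a vertex.\<close>

lemma one_neq_zero:
  assumes "\<one> \<noteq> \<zero>" "verts G \<noteq> {}"
  shows "\<one>\<^bsub>L\<^esub> \<noteq> \<zero>\<^bsub>L\<^esub>"
proof
  assume eq: "\<one>\<^bsub>L\<^esub> = \<zero>\<^bsub>L\<^esub>"
  obtain v0 where v0: "v0 \<in> verts G" using assms by blast
  let ?E = "\<Oplus>\<^bsub>FA\<^esub>v\<in>verts G. free_gen R (Vertex v)" and ?f = "\<lambda>s :: 'v \<times> nat. \<one>"
  have c: "free_gen R (Vertex v) \<in> carrier FA" if "v \<in> verts G" for v
    using that G.vertex_gens(1) gen_words_closed by blast
  then have E: "?E \<in> carrier FA" by (intro FA.finsum_closed) auto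
  have "cls ?E = cls \<zero>\<^bsub>FA\<^esub>" using eq unfolding L_simps cls_zero .
  then have "?E \<ominus>\<^bsub>FA\<^esub> \<zero>\<^bsub>FA\<^esub> \<in> leavitt_ideal R G"
    using cls_eq_iff[OF E FA.zero_closed] by blast
  then have "?E \<in> leavitt_ideal R G" using E by (simp add: FA.minus_eq)
  then have "eval_at ?f (v0, 0) ?E = \<zero>" by (rule eval_at_ideal) simp
  moreover have "eval_at ?f (v0, 0) ?E = (\<Oplus>v\<in>verts G. eval_at ?f (v0, 0) (free_gen R (Vertex v)))"
    by (rule eval_at_finsum) (simp_all add: c)
  moreover have "\<dots> = (\<Oplus>v\<in>verts G. if v0 = v then \<one> else \<zero>)"
    using G.vertex_gens(1) by (intro add.finprod_cong') (auto simp: eval_at_gen val_def)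
  moreover have "\<dots> = \<one>"
    using v0 by (intro add.finprod_singleton) auto
  ultimately show False using assms by simp
qed

end

lemma (in leavitt) L_one_neq_zero:
  assumes "\<one> \<noteq> \<zero>" "verts G \<noteq> {}"
  shows "\<one>\<^bsub>L\<^esub> \<noteq> \<zero>\<^bsub>L\<^esub>"
proof -
  have fin: "finite (out_arcs G v)" for v
    by (rule finite_subset[of _ "arcs G"]) (auto simp: out_arcs_def)
  have "\<forall>v. \<exists>h. bij_betw h (out_arcs G v) {..<card (out_arcs G v)}"
    using ex_bij_betw_finite_nat[OF fin] unfolding atLeast0LessThan by blast
  then obtain h where h: "\<And>v. bij_betw (h v) (out_arcs G v) {..<card (out_arcs G v)}" by metis
  have "bij_betw (\<lambda>e. h (tail G e) e) (out_arcs G v) {..<card (out_arcs G v)}" for v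
    using h[of v] by (rule bij_betw_cong[THEN iffD1, rotated]) (auto simp: out_arcs_def)
  then interpret branching R G "\<lambda>e. h (tail G e) e" by unfold_locales
  show ?thesis by (rule one_neq_zero[OF assms])
qed

section \<open>Extension of scalars\<close>

lemma unital_algebra_restrict_scalars:
  assumes "field F" "algebra F K" and M: "module K M" "ring M"
    and compat: "\<And>a x y. \<lbrakk>a \<in> carrier K; x \<in> carrier M; y \<in> carrier M\<rbrakk> \<Longrightarrow>
      (a \<odot>\<^bsub>M\<^esub> x) \<otimes>\<^bsub>M\<^esub> y = a \<odot>\<^bsub>M\<^esub> (x \<otimes>\<^bsub>M\<^esub> y)"
      "\<And>a x y. \<lbrakk>a \<in> carrier K; x \<in> carrier M; y \<in> carrier M\<rbrakk> \<Longrightarrow>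
      x \<otimes>\<^bsub>M\<^esub> (a \<odot>\<^bsub>M\<^esub> y) = a \<odot>\<^bsub>M\<^esub> (x \<otimes>\<^bsub>M\<^esub> y)"
  shows "unital_algebra F (restrict_scalars K M)"
proof -
  interpret F: field F by fact
  interpret K: algebra F K by fact
  interpret Mr: ring M by fact
  interpret M: module K M by fact
  let ?C = "restrict_scalars K M"
  have simps: "carrier ?C = carrier M" "monoid.mult ?C = monoid.mult M" "one ?C = one M" "zero ?C = zero M" "add ?C = add M"
    "smult ?C = (\<lambda>c x. (c \<odot>\<^bsub>K\<^esub> \<one>\<^bsub>K\<^esub>) \<odot>\<^bsub>M\<^esub> x)"
    by (simp_all add: restrict_scalars_def)
  have grp: "abelian_group ?C"
  proof (rule abelian_groupI)
    show "\<exists>y\<in>carrier ?C. y \<oplus>\<^bsub>?C\<^esub> x = \<zero>\<^bsub>?C\<^esub>" if "x \<in> carrier ?C" for x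
      using that by (intro bexI[of _ "\<ominus>\<^bsub>M\<^esub> x"]) (simp_all add: simps Mr.l_neg)
  qed (auto simp: simps Mr.a_assoc intro: Mr.a_comm)
  have ring: "ring ?C"
    by (rule ringI[OF grp], rule monoidI) (auto simp: simps Mr.m_assoc Mr.l_distr Mr.r_distr)
  have s: "c \<odot>\<^bsub>K\<^esub> \<one>\<^bsub>K\<^esub> \<in> carrier K" if "c \<in> carrier F" for c using that by simp
  have s_mult: "(c \<otimes>\<^bsub>F\<^esub> d) \<odot>\<^bsub>K\<^esub> \<one>\<^bsub>K\<^esub> = (c \<odot>\<^bsub>K\<^esub> \<one>\<^bsub>K\<^esub>) \<otimes>\<^bsub>K\<^esub> (d \<odot>\<^bsub>K\<^esub> \<one>\<^bsub>K\<^esub>)"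
    if "c \<in> carrier F" "d \<in> carrier F" for c d
    using that by (simp add: K.smult_assoc1 K.smult_assoc2)
  have "module F ?C"
    by (rule moduleI[OF F.is_cring grp])
      (auto simp: simps s s_mult K.smult_l_distr M.smult_l_distr M.smult_r_distr M.smult_assoc1)
  then have "vectorspace F ?C" by (intro vectorspace.intro F.field_axioms)
  then show ?thesis
    by (intro unital_algebra.intro unital_algebra_axioms.intro ring) (auto simp: simps s compat)
qed

lemma (in leavitt) L_unital_algebra:
  assumes "field R"
  shows "unital_algebra R L"
  using L_module L_ring L_smult_mult assms
  by (intro unital_algebra.intro vectorspace.intro unital_algebra_axioms.intro)

text \<open>The class of a nonempty word is the product of the classes of its letters.\<close>

lemma (in leavitt) L_generated:
  assumes "field R"
  defines "T \<equiv> insert \<one>\<^bsub>L\<^esub> ((\<lambda>x. word \<one> [x]) ` leavitt_gens G)"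
  shows "finite T" "\<one>\<^bsub>L\<^esub> \<in> T" "generates_algebra R L T"
proof -
  show "finite T" "\<one>\<^bsub>L\<^esub> \<in> T" unfolding T_def using gens_finite by auto
  show "generates_algebra R L T"
    unfolding generates_algebra_def
  proof (intro conjI allI impI)
    show "T \<subseteq> carrier L" unfolding T_def using one_L_closed word_in_L[of \<one> _ "[]"] by auto
    fix B assume B: "subspace R B L \<and> subring B L \<and> T \<subseteq> B"
    have sub: "submodule R B L" and ring: "subring B L" using B unfolding subspace_def by auto
    have word_one: "word \<one> (x # w) \<in> B" if "x \<in> leavitt_gens G" "w \<in> lists (leavitt_gens G)" for x w
      using that
    proof (induction w arbitrary: x)
      case Nil
      then show ?case using B unfolding T_def by blast
    next
      case (Cons y w)
      have "word \<one> [x] \<otimes>\<^bsub>FQ\<^esub> word \<one> (y # w) = word \<one> (x # y # w)"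
        using Cons by (subst word_mult) auto
      moreover have "word \<one> [x] \<in> B" using B Cons unfolding T_def by blast
      ultimately show ?case using subringE(6)[OF ring, of "word \<one> [x]" "word \<one> (y # w)"] Cons
        by (simp add: L_simps(2))
    qed
    have "x \<in> B" if "x \<in> carrier L" for x
      using that
    proof (induction rule: L_induct)
      case zero
      then show ?case by (rule submodule.zero_closed[OF sub])
    next
      case (word c y w)
      have "c \<odot>\<^bsub>L\<^esub> word \<one> (y # w) = word c (y # w)"
        using word by (subst smult_cls(1)) (auto simp: monomial_closed word_mult)
      then show ?case using submodule.smult_closed[OF sub word(1) word_one[OF word(2,3)]] by simp
    next
      case (add x y)
      show ?case by (rule submodule.m_closed[OF sub add(3,4)])
    qed
    moreover have "B \<subseteq> carrier L" using submodule.subset[OF sub] .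
    ultimately show "B = carrier L" by blast
  qed
qed

text \<open>The map of path algebras induced by an additive map of the coefficients. The choice of the
  representative is immaterial by \<open>push_leavitt_ideal\<close>.\<close>

locale leavitt_change = R: leavitt R G + S: leavitt S G + coefficient_map R S h
  for R :: "('r, 'm) ring_scheme" and S :: "('s, 'n) ring_scheme"
    and G :: "('v, 'e) pre_digraph" and h :: "'r \<Rightarrow> 's"
begin

definition induced :: "(('v, 'e) leavitt_gen list \<Rightarrow> 'r) set \<Rightarrow> (('v, 'e) leavitt_gen list \<Rightarrow> 's) set" where
  "induced C = S.cls (\<lambda>w. h ((SOME p. p \<in> C) w))"

lemma induced_cls:
  assumes p: "p \<in> carrier R.FA"
  shows "induced (R.cls p) = S.cls (\<lambda>w. h (p w))"
proof -
  let ?q = "SOME q. q \<in> R.cls p"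
  have "p \<in> R.cls p" using p by (simp add: R.in_cls_iff)
  then have "?q \<in> R.cls p" by (rule someI[where P = "\<lambda>q. q \<in> R.cls p"])
  then have q: "?q \<in> carrier R.FA" "R.cls ?q = R.cls p" using R.in_cls_iff[OF p] by auto
  have "?q \<ominus>\<^bsub>R.FA\<^esub> p \<in> leavitt_ideal R G" using R.cls_eq_iff[OF q(1) p] q(2) by simp
  then have "(\<lambda>w. h ((?q \<ominus>\<^bsub>R.FA\<^esub> p) w)) \<in> leavitt_ideal S G"
    using push_leavitt_ideal[OF coefficient_map_axioms R.G.wf_digraph] by blast
  moreover have "(\<lambda>w. h ((?q \<ominus>\<^bsub>R.FA\<^esub> p) w)) = (\<lambda>w. h (?q w)) \<ominus>\<^bsub>S.FA\<^esub> (\<lambda>w. h (p w))"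
  proof -
    have "?q w \<in> carrier R" "p w \<in> carrier R" for w
      using q(1) p by (auto simp: free_algebra_carrier_iff)
    then show ?thesis
      unfolding R.free_algebra_diff[OF q(1) p] S.free_algebra_diff[OF push_closed[OF q(1)] push_closed[OF p]]
      by (simp add: R.minus_eq S.minus_eq)
  qed
  ultimately show ?thesis
    unfolding induced_def using S.cls_eq_iff[OF push_closed[OF q(1)] push_closed[OF p]] by simp
qed

lemma induced_closed:
  assumes "x \<in> carrier R.L"
  shows "induced x \<in> carrier S.L"
proof -
  obtain p where p: "p \<in> carrier R.FA" "p [] = \<zero>\<^bsub>R\<^esub>" "x = R.cls p" using assms unfolding R.L_simps by blast
  have "h (p []) = \<zero>\<^bsub>S\<^esub>" using p(2) by simp
  then show ?thesis
    unfolding p(3) induced_cls[OF p(1)] S.L_simps using push_closed[OF p(1)] by blast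
qed

lemma induced_add:
  assumes "x \<in> carrier R.L" "y \<in> carrier R.L"
  shows "induced (x \<oplus>\<^bsub>R.L\<^esub> y) = induced x \<oplus>\<^bsub>S.L\<^esub> induced y"
proof -
  obtain p where p: "p \<in> carrier R.FA" "x = R.cls p" using assms(1) unfolding R.L_simps by blast
  obtain q where q: "q \<in> carrier R.FA" "y = R.cls q" using assms(2) unfolding R.L_simps by blast
  have "x \<oplus>\<^bsub>R.L\<^esub> y = R.cls (p \<oplus>\<^bsub>R.FA\<^esub> q)" using p q by (simp add: R.L_simps(3))
  then have "induced (x \<oplus>\<^bsub>R.L\<^esub> y) = S.cls (\<lambda>w. h ((p \<oplus>\<^bsub>R.FA\<^esub> q) w))"
    using induced_cls[OF R.FA.a_closed[OF p(1) q(1)]] by (simp only:)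
  also have "(\<lambda>w. h ((p \<oplus>\<^bsub>R.FA\<^esub> q) w)) = (\<lambda>w. h (p w)) \<oplus>\<^bsub>S.FA\<^esub> (\<lambda>w. h (q w))"
    using p(1) q(1) by (simp add: free_algebra_simps free_algebra_carrier_iff)
  also have "S.cls \<dots> = induced x \<oplus>\<^bsub>S.L\<^esub> induced y"
    unfolding p(2) q(2) induced_cls[OF p(1)] induced_cls[OF q(1)] S.L_simps(3)
    by (rule S.cls.hom_add[OF push_closed[OF p(1)] push_closed[OF q(1)]])
  finally show ?thesis .
qed

end

text \<open>
  Scalar extension along \<open>F \<rightarrow> K\<close> pairs \<open>a\<close> with \<open>u\<close> to \<open>a \<cdot> \<iota>(u)\<close>; a linear functional on \<open>K\<close> is an
  additive map of the coefficients, hence contracts the pairing.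
\<close>

locale scalar_extension = F: leavitt F G + K: leavitt K G + field F + algebra F K
  for F :: "('f, 'm) ring_scheme" and K :: "('f, 'k, 'n) module_scheme" and G :: "('v, 'e) pre_digraph"
begin

abbreviation \<iota> :: "'f \<Rightarrow> 'k" where
  "\<iota> c \<equiv> c \<odot>\<^bsub>K\<^esub> \<one>\<^bsub>K\<^esub>"

lemma \<iota>_hom: "ring_hom_cring F K \<iota>"
  by (intro ring_hom_cringI ring_hom_memI F.cring_axioms K.cring_axioms)
    (simp_all add: smult_assoc1 smult_assoc2 smult_l_distr)

sublocale \<iota>: ring_hom_cring F K \<iota>
  by (rule \<iota>_hom)

sublocale ext: leavitt_change F K G \<iota>
  by (intro leavitt_change.intro F.leavitt_axioms K.leavitt_axioms coefficient_map.intro F.cring_axioms K.cring_axioms)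
    (rule \<iota>.ring.abelian_group.abelian_group_hom_axioms)

definition pairing :: "'k \<Rightarrow> (('v, 'e) leavitt_gen list \<Rightarrow> 'f) set \<Rightarrow> (('v, 'e) leavitt_gen list \<Rightarrow> 'k) set" where
  "pairing a u = a \<odot>\<^bsub>K.L\<^esub> ext.induced u"

lemma pairing_cls:
  assumes "a \<in> carrier K" "p \<in> carrier F.FA"
  shows "pairing a (F.cls p) = K.cls (\<lambda>w. a \<otimes>\<^bsub>K\<^esub> \<iota> (p w))"
  unfolding pairing_def ext.induced_cls[OF assms(2)] K.smult_cls(2)[OF assms(1) ext.push_closed[OF assms(2)]] ..

lemma induced_smult:
  assumes "c \<in> carrier F" "u \<in> carrier F.L"
  shows "ext.induced (c \<odot>\<^bsub>F.L\<^esub> u) = \<iota> c \<odot>\<^bsub>K.L\<^esub> ext.induced u"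
proof -
  obtain p where p: "p \<in> carrier F.FA" "u = F.cls p" using assms(2) unfolding F.L_simps by blast
  note cp = F.free_algebra_smult_closed[OF assms(1) p(1)]
  have "p w \<in> carrier F" for w using p(1) by (simp add: free_algebra_carrier_iff)
  then show ?thesis
    using assms(1) p by (simp add: F.smult_cls(2) K.smult_cls(2) ext.induced_cls[OF cp] ext.induced_cls ext.push_closed)
qed

lemma induced_mult:
  assumes "u \<in> carrier F.L" "v \<in> carrier F.L"
  shows "ext.induced (u \<otimes>\<^bsub>F.L\<^esub> v) = ext.induced u \<otimes>\<^bsub>K.L\<^esub> ext.induced v"
proof -
  obtain p where p: "p \<in> carrier F.FA" "u = F.cls p" using assms(1) unfolding F.L_simps by blast
  obtain q where q: "q \<in> carrier F.FA" "v = F.cls q" using assms(2) unfolding F.L_simps by blast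
  have cl: "p w \<in> carrier F" "q w \<in> carrier F" for w using p(1) q(1) by (auto simp: free_algebra_carrier_iff)
  have "u \<otimes>\<^bsub>F.L\<^esub> v = F.cls (p \<otimes>\<^bsub>F.FA\<^esub> q)" using p q by (simp add: F.L_simps(2))
  then have "ext.induced (u \<otimes>\<^bsub>F.L\<^esub> v) = K.cls (\<lambda>w. \<iota> ((p \<otimes>\<^bsub>F.FA\<^esub> q) w))"
    using ext.induced_cls[OF F.FA.m_closed[OF p(1) q(1)]] by (simp only:)
  also have "(\<lambda>w. \<iota> ((p \<otimes>\<^bsub>F.FA\<^esub> q) w)) = (\<lambda>w. \<iota> (p w)) \<otimes>\<^bsub>K.FA\<^esub> (\<lambda>w. \<iota> (q w))"
  proof
    fix w
    have "\<iota> (conv F p q w) = (\<Oplus>\<^bsub>K\<^esub>i\<in>{..length w}. \<iota> (p (take i w) \<otimes>\<^bsub>F\<^esub> q (drop i w)))"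
      unfolding conv_def by (subst \<iota>.hom_finsum) (auto simp: cl comp_def)
    also have "\<dots> = conv K (\<lambda>w. \<iota> (p w)) (\<lambda>w. \<iota> (q w)) w"
      unfolding conv_def by (intro K.add.finprod_cong') (auto simp: cl)
    finally show "\<iota> ((p \<otimes>\<^bsub>F.FA\<^esub> q) w) = ((\<lambda>w. \<iota> (p w)) \<otimes>\<^bsub>K.FA\<^esub> (\<lambda>w. \<iota> (q w))) w"
      by (simp add: free_algebra_simps(1))
  qed
  also have "K.cls \<dots> = ext.induced u \<otimes>\<^bsub>K.L\<^esub> ext.induced v"
    unfolding p(2) q(2) ext.induced_cls[OF p(1)] ext.induced_cls[OF q(1)] K.L_simps(2)
    by (rule K.cls.hom_mult[OF ext.push_closed[OF p(1)] ext.push_closed[OF q(1)]])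
  finally show ?thesis .
qed

lemma induced_one: "ext.induced \<one>\<^bsub>F.L\<^esub> = \<one>\<^bsub>K.L\<^esub>"
proof -
  let ?EF = "\<Oplus>\<^bsub>F.FA\<^esub>v\<in>verts G. free_gen F (Vertex v)" and ?EK = "\<Oplus>\<^bsub>K.FA\<^esub>v\<in>verts G. free_gen K (Vertex v)"
  have rel: "ext.related (leavitt_gens G) ?EF ?EK"
    by (rule ext.related_finsum) (auto intro!: ext.related_gen F.G.vertex_gens(1))
  note cl = ext.related_closed[OF rel]
  have "(\<lambda>w. \<iota> (?EF w)) = ?EK" using cl(4,5) by auto
  then show ?thesis unfolding F.L_simps K.L_simps ext.induced_cls[OF cl(1)] by simp
qed

lemma contraction_exists:
  assumes "linear_functional F K \<phi>"
  shows "\<exists>\<tau>. (\<forall>x\<in>carrier K.L. \<tau> x \<in> carrier F.L) \<and>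
    (\<forall>x\<in>carrier K.L. \<forall>y\<in>carrier K.L. \<tau> (x \<oplus>\<^bsub>K.L\<^esub> y) = \<tau> x \<oplus>\<^bsub>F.L\<^esub> \<tau> y) \<and>
    (\<forall>c\<in>carrier F. \<forall>x\<in>carrier K.L. \<tau> (\<iota> c \<odot>\<^bsub>K.L\<^esub> x) = c \<odot>\<^bsub>F.L\<^esub> \<tau> x) \<and>
    (\<forall>a\<in>carrier K. \<forall>u\<in>carrier F.L. \<tau> (pairing a u) = \<phi> a \<odot>\<^bsub>F.L\<^esub> u)"
proof -
  have \<phi>: "\<And>x. x \<in> carrier K \<Longrightarrow> \<phi> x \<in> carrier F"
    "\<And>x y. \<lbrakk>x \<in> carrier K; y \<in> carrier K\<rbrakk> \<Longrightarrow> \<phi> (x \<oplus>\<^bsub>K\<^esub> y) = \<phi> x \<oplus>\<^bsub>F\<^esub> \<phi> y"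
    "\<And>c x. \<lbrakk>c \<in> carrier F; x \<in> carrier K\<rbrakk> \<Longrightarrow> \<phi> (c \<odot>\<^bsub>K\<^esub> x) = c \<otimes>\<^bsub>F\<^esub> \<phi> x"
    using assms unfolding linear_functional_def by auto
  have "abelian_group_hom K F \<phi>"
    by (rule abelian_group_homI)
      (auto simp: hom_def \<phi> intro!: group_hom.intro group_hom_axioms.intro K.a_group F.a_group
        K.abelian_group_axioms F.abelian_group_axioms)
  then interpret \<tau>: leavitt_change K F G \<phi>
    by (intro leavitt_change.intro F.leavitt_axioms K.leavitt_axioms coefficient_map.intro F.cring_axioms K.cring_axioms)
  have \<iota>_mult: "\<iota> c \<otimes>\<^bsub>K\<^esub> x = c \<odot>\<^bsub>K\<^esub> x" "x \<otimes>\<^bsub>K\<^esub> \<iota> c = c \<odot>\<^bsub>K\<^esub> x"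
    if "c \<in> carrier F" "x \<in> carrier K" for c x
    using that by (simp_all add: smult_assoc2 K.m_comm[of x])
  note scaled = K.free_algebra_smult_closed
  have linear: "\<tau>.induced (\<iota> c \<odot>\<^bsub>K.L\<^esub> x) = c \<odot>\<^bsub>F.L\<^esub> \<tau>.induced x" if c: "c \<in> carrier F" and x: "x \<in> carrier K.L" for c x
  proof -
    obtain q where q: "q \<in> carrier K.FA" "x = K.cls q" using x unfolding K.L_simps by blast
    have qw: "q w \<in> carrier K" for w using q(1) by (simp add: free_algebra_carrier_iff)
    have ic: "\<iota> c \<in> carrier K" using c by simp
    have "\<tau>.induced (\<iota> c \<odot>\<^bsub>K.L\<^esub> x) = F.cls (\<lambda>w. \<phi> (\<iota> c \<otimes>\<^bsub>K\<^esub> q w))"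
      unfolding q(2) K.smult_cls(2)[OF ic q(1)] \<tau>.induced_cls[OF scaled[OF ic q(1)]] ..
    also have "(\<lambda>w. \<phi> (\<iota> c \<otimes>\<^bsub>K\<^esub> q w)) = (\<lambda>w. c \<otimes>\<^bsub>F\<^esub> \<phi> (q w))"
      using c qw by (simp add: \<iota>_mult(1) \<phi>(3))
    also have "F.cls \<dots> = c \<odot>\<^bsub>F.L\<^esub> \<tau>.induced x"
      unfolding q(2) \<tau>.induced_cls[OF q(1)] F.smult_cls(2)[OF c \<tau>.push_closed[OF q(1)]] ..
    finally show ?thesis .
  qed
  have contract: "\<tau>.induced (pairing a u) = \<phi> a \<odot>\<^bsub>F.L\<^esub> u" if a: "a \<in> carrier K" and u: "u \<in> carrier F.L" for a u
  proof -
    obtain p where p: "p \<in> carrier F.FA" "u = F.cls p" using u unfolding F.L_simps by blast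
    have pw: "p w \<in> carrier F" for w using p(1) by (simp add: free_algebra_carrier_iff)
    have "\<tau>.induced (pairing a u) = F.cls (\<lambda>w. \<phi> (a \<otimes>\<^bsub>K\<^esub> \<iota> (p w)))"
      unfolding p(2) pairing_cls[OF a p(1)] \<tau>.induced_cls[OF scaled[OF a ext.push_closed[OF p(1)]]] ..
    also have "(\<lambda>w. \<phi> (a \<otimes>\<^bsub>K\<^esub> \<iota> (p w))) = (\<lambda>w. \<phi> a \<otimes>\<^bsub>F\<^esub> p w)"
      using a pw \<phi>(1) by (simp add: \<iota>_mult(2) \<phi>(3) F.m_comm)
    also have "F.cls \<dots> = \<phi> a \<odot>\<^bsub>F.L\<^esub> u"
      unfolding p(2) F.smult_cls(2)[OF \<phi>(1)[OF a] p(1)] ..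
    finally show ?thesis .
  qed
  show ?thesis
    by (intro exI[of _ \<tau>.induced] conjI ballI \<tau>.induced_closed \<tau>.induced_add linear contract)
qed

lemma restrict_simps:
  "carrier (restrict_scalars K K.L) = carrier K.L" "monoid.mult (restrict_scalars K K.L) = monoid.mult K.L"
  "one (restrict_scalars K K.L) = one K.L" "zero (restrict_scalars K K.L) = zero K.L"
  "add (restrict_scalars K K.L) = add K.L"
  "smult (restrict_scalars K K.L) = (\<lambda>c x. \<iota> c \<odot>\<^bsub>K.L\<^esub> x)"
  by (simp_all add: restrict_scalars_def)

lemma leavitt_tensor_product:
  "tensor_product_algebra F K F.L (restrict_scalars K K.L) pairing"
proof -
  interpret LK: module K K.L by (rule K.L_module)
  interpret LKr: ring K.L by (rule K.L_ring)
  interpret LF: module F F.L by (rule F.L_module)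
  have \<iota>_mult: "\<iota> c \<otimes>\<^bsub>K\<^esub> x = c \<odot>\<^bsub>K\<^esub> x" if "c \<in> carrier F" "x \<in> carrier K" for c x
    using that by (simp add: smult_assoc2)
  have K: "unital_algebra F K"
    using commutative_unital_algebraI[OF field_axioms algebra_axioms]
    by (simp add: commutative_unital_algebra_def)
  have A: "unital_algebra F F.L" by (rule F.L_unital_algebra[OF field_axioms])
  have C: "unital_algebra F (restrict_scalars K K.L)"
    by (rule unital_algebra_restrict_scalars[OF field_axioms algebra_axioms K.L_module K.L_ring])
      (simp_all add: K.L_smult_mult)
  have closed: "pairing a u \<in> carrier (restrict_scalars K K.L)" if "a \<in> carrier K" "u \<in> carrier F.L" for a u
    using that ext.induced_closed unfolding pairing_def restrict_simps by simp
  show ?thesis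
  proof (intro tensor_product_algebra.intro tensor_product_algebra_axioms.intro K A C)
    show "pairing a u \<in> carrier (restrict_scalars K K.L)" if "a \<in> carrier K" "u \<in> carrier F.L" for a u
      by (rule closed[OF that])
    show "pairing (a \<oplus>\<^bsub>K\<^esub> b) u = pairing a u \<oplus>\<^bsub>restrict_scalars K K.L\<^esub> pairing b u"
      if "a \<in> carrier K" "b \<in> carrier K" "u \<in> carrier F.L" for a b u
      using that ext.induced_closed unfolding pairing_def restrict_simps by (simp add: LK.smult_l_distr)
    show "pairing a (u \<oplus>\<^bsub>F.L\<^esub> v) = pairing a u \<oplus>\<^bsub>restrict_scalars K K.L\<^esub> pairing a v"
      if "a \<in> carrier K" "u \<in> carrier F.L" "v \<in> carrier F.L" for a u v
      using that ext.induced_closed unfolding pairing_def restrict_simps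
      by (simp add: ext.induced_add LK.smult_r_distr)
    fix c a u assume c: "c \<in> carrier F" and a: "a \<in> carrier K" and "u \<in> carrier F.L"
    then have u: "ext.induced u \<in> carrier K.L" and ic: "\<iota> c \<in> carrier K" by (simp_all add: ext.induced_closed)
    have left: "(\<iota> c \<otimes>\<^bsub>K\<^esub> a) \<odot>\<^bsub>K.L\<^esub> ext.induced u = \<iota> c \<odot>\<^bsub>K.L\<^esub> (a \<odot>\<^bsub>K.L\<^esub> ext.induced u)"
      by (rule LK.smult_assoc1[OF ic a u])
    show "pairing (c \<odot>\<^bsub>K\<^esub> a) u = c \<odot>\<^bsub>restrict_scalars K K.L\<^esub> pairing a u"
      unfolding pairing_def restrict_simps left[symmetric] \<iota>_mult[OF c a] ..
    have "a \<odot>\<^bsub>K.L\<^esub> (\<iota> c \<odot>\<^bsub>K.L\<^esub> ext.induced u) = (a \<otimes>\<^bsub>K\<^esub> \<iota> c) \<odot>\<^bsub>K.L\<^esub> ext.induced u"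
      by (rule LK.smult_assoc1[OF a ic u, symmetric])
    also have "a \<otimes>\<^bsub>K\<^esub> \<iota> c = \<iota> c \<otimes>\<^bsub>K\<^esub> a" by (rule K.m_comm[OF a ic])
    finally show "pairing a (c \<odot>\<^bsub>F.L\<^esub> u) = c \<odot>\<^bsub>restrict_scalars K K.L\<^esub> pairing a u"
      unfolding pairing_def restrict_simps induced_smult[OF c \<open>u \<in> carrier F.L\<close>] left .
  next
    fix a b u v assume a: "a \<in> carrier K" and b: "b \<in> carrier K" and u: "u \<in> carrier F.L" and v: "v \<in> carrier F.L"
    note iu = ext.induced_closed[OF u] and iv = ext.induced_closed[OF v]
    have "(a \<odot>\<^bsub>K.L\<^esub> ext.induced u) \<otimes>\<^bsub>K.L\<^esub> (b \<odot>\<^bsub>K.L\<^esub> ext.induced v) =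
        a \<odot>\<^bsub>K.L\<^esub> (ext.induced u \<otimes>\<^bsub>K.L\<^esub> (b \<odot>\<^bsub>K.L\<^esub> ext.induced v))"
      by (rule K.L_smult_mult(1)[OF a iu LK.smult_closed[OF b iv]])
    also have "\<dots> = a \<odot>\<^bsub>K.L\<^esub> (b \<odot>\<^bsub>K.L\<^esub> (ext.induced u \<otimes>\<^bsub>K.L\<^esub> ext.induced v))"
      unfolding K.L_smult_mult(2)[OF b iu iv] ..
    also have "\<dots> = (a \<otimes>\<^bsub>K\<^esub> b) \<odot>\<^bsub>K.L\<^esub> (ext.induced u \<otimes>\<^bsub>K.L\<^esub> ext.induced v)"
      by (rule LK.smult_assoc1[OF a b LKr.m_closed[OF iu iv], symmetric])
    finally show "pairing (a \<otimes>\<^bsub>K\<^esub> b) (u \<otimes>\<^bsub>F.L\<^esub> v) = pairing a u \<otimes>\<^bsub>restrict_scalars K K.L\<^esub> pairing b v"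
      unfolding pairing_def restrict_simps induced_mult[OF u v] by (rule sym)
  next
    show "pairing \<one>\<^bsub>K\<^esub> \<one>\<^bsub>F.L\<^esub> = \<one>\<^bsub>restrict_scalars K K.L\<^esub>"
      unfolding pairing_def restrict_simps induced_one by simp
    show "\<exists>\<tau>. (\<forall>x\<in>carrier (restrict_scalars K K.L). \<tau> x \<in> carrier F.L) \<and>
        (\<forall>x\<in>carrier (restrict_scalars K K.L). \<forall>y\<in>carrier (restrict_scalars K K.L).
          \<tau> (x \<oplus>\<^bsub>restrict_scalars K K.L\<^esub> y) = \<tau> x \<oplus>\<^bsub>F.L\<^esub> \<tau> y) \<and>
        (\<forall>c\<in>carrier F. \<forall>x\<in>carrier (restrict_scalars K K.L).
          \<tau> (c \<odot>\<^bsub>restrict_scalars K K.L\<^esub> x) = c \<odot>\<^bsub>F.L\<^esub> \<tau> x) \<and>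
        (\<forall>a\<in>carrier K. \<forall>u\<in>carrier F.L. \<tau> (pairing a u) = \<phi> a \<odot>\<^bsub>F.L\<^esub> u)"
      if "linear_functional F K \<phi>" for \<phi>
      unfolding restrict_simps by (rule contraction_exists[OF that])
    show "generates_algebra F (restrict_scalars K K.L) {pairing a u |a u. a \<in> carrier K \<and> u \<in> carrier F.L}"
      unfolding generates_algebra_def
    proof (intro conjI allI impI)
      show "{pairing a u |a u. a \<in> carrier K \<and> u \<in> carrier F.L} \<subseteq> carrier (restrict_scalars K K.L)"
        using closed by blast
      fix B assume B: "subspace F B (restrict_scalars K K.L) \<and> subring B (restrict_scalars K K.L) \<and>
        {pairing a u |a u. a \<in> carrier K \<and> u \<in> carrier F.L} \<subseteq> B"
      have sub: "submodule F B (restrict_scalars K K.L)" using B unfolding subspace_def by blast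
      have "x \<in> B" if "x \<in> carrier K.L" for x
        using that
      proof (induction rule: K.L_induct)
        case zero
        then show ?case using submodule.zero_closed[OF sub] by (simp add: restrict_simps)
      next
        case (word c y w)
        have m: "monomial F \<one>\<^bsub>F\<^esub> (y # w) \<in> carrier F.FA" using word by (intro F.monomial_closed) auto
        have "(\<lambda>v. c \<otimes>\<^bsub>K\<^esub> \<iota> (monomial F \<one>\<^bsub>F\<^esub> (y # w) v)) = monomial K c (y # w)"
          using word(1) by (auto simp: monomial_def)
        then have "pairing c (F.word \<one>\<^bsub>F\<^esub> (y # w)) = K.word c (y # w)"
          using pairing_cls[OF word(1) m] by simp
        moreover have "F.word \<one>\<^bsub>F\<^esub> (y # w) \<in> carrier F.L" using word by (intro F.word_in_L) auto
        ultimately show ?case using B word(1) by blast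
      next
        case (add x y)
        then show ?case using submodule.m_closed[OF sub add(3,4)] by (simp add: restrict_simps)
      qed
      moreover have "B \<subseteq> carrier K.L" using submodule.subset[OF sub] by (simp add: restrict_simps)
      ultimately show "B = carrier (restrict_scalars K K.L)" unfolding restrict_simps by blast
    qed
  qed
qed

end

theorem theorem29:
  fixes G :: "('v, 'e) pre_digraph"
    and F :: "('f, 'm) ring_scheme"
    and K :: "('f, 'k, 'n) module_scheme"
  assumes "fin_digraph G" and "verts G \<noteq> {}"
    and "field F"
    and "algebra F K" and "finitely_generated_algebra F K" and "\<one>\<^bsub>K\<^esub> \<noteq> \<zero>\<^bsub>K\<^esub>"
  shows "GKdim F (restrict_scalars K (leavitt_path_algebra K G)) =
    GKdim F (leavitt_path_algebra F G) + GKdim F K"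
proof -
  interpret G: fin_digraph G by fact
  interpret F: field F by fact
  interpret K: algebra F K by fact
  have leavitt: "leavitt F G" "leavitt K G"
    by (intro leavitt.intro F.is_cring K.cring_axioms assms(1))+
  interpret scalar_extension F K G
    by (intro scalar_extension.intro leavitt assms(3,4))
  interpret T: tensor_product_algebra F K F.L "restrict_scalars K K.L" pairing
    by (rule leavitt_tensor_product)
  interpret CK: commutative_unital_algebra F K
    by (rule commutative_unital_algebraI[OF assms(3,4)])
  obtain S0 where S0: "finite S0" "generates_algebra F K S0"
    using assms(5) unfolding finitely_generated_algebra_def by blast
  have S0_car: "S0 \<subseteq> carrier K" using S0 unfolding generates_algebra_def by blast
  define S where "S = insert \<one>\<^bsub>K\<^esub> S0"
  have S: "finite S" "\<one>\<^bsub>K\<^esub> \<in> S" "generates_algebra F K S"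
    using S0 unfolding S_def generates_algebra_def by auto
  obtain d :: nat where "(\<lambda>n. ln (real (power_dim F K S n)) / ln (real n)) \<longlonglongrightarrow> real d"
    using CK.finite_growth_tendsto[OF assms(6) S0(1) S0_car] unfolding S_def by blast
  then show ?thesis
    by (rule T.GKdim_tensor_product[OF assms(6) F.L_one_neq_zero[OF F.one_not_zero assms(2)] S F.L_generated[OF assms(3)]])
qed

end
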